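(* Let $\mathscr{H}$ be a complex Hilbert space, let $A \in \mathscr{B}(\mathscr{H})$ be a spectral operator, and let $e_A$ be the idempotent-valued spectral resolution of $A$. For $\lambda \in \mathbb{R}$, let $F_\lambda := \mathbf{R}(e_A(\mathbb{D}_\lambda))$. Then the following assertions hold. (i) $\{F_\lambda\}_{\lambda \in \mathbb{R}}$ is a bounded resolution of the identity and $$\lim_{n \to \infty} |A^n|^{\frac{1}{n}} = \int_0^{\mathrm{r}(A)} \lambda \, \mathrm{d}F_\lambda \quad \text{in norm}.$$ Moreover, the spectrum of the limiting positive operator $\int_0^{\mathrm{r}(A)} \lambda\, \mathrm{d}F_\lambda$ is $\{ |\lambda| : \lambda \in \mathrm{sp}(A)\}$. (ii) For every vector $x \in \mathscr{H}$, there is a smallest non-negative real number $\lambda_x$ such that $x$ lies in the range of the spectral idempotent $e_A(\mathbb{D}_{\lambda_x})$, and it may be obtained as the limit $$\lim_{n \to \infty} \|A^n x\|^{\frac{1}{n}} = \lambda_x .$$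
   Context: $\mathscr{B}(\mathscr{H})$ is the set of bounded linear operators on $\mathscr{H}$. For $T\in\mathscr{B}(\mathscr{H})$: $|T| := (T^*T)^{1/2}$; $\mathrm{sp}(T)$ is the spectrum; $\mathrm{r}(T)$ is the spectral radius; $\mathrm{ran}(T)$ is the range; $\mathbf{R}(T)$ is the orthogonal projection onto the closure of $\mathrm{ran}(T)$. "Projection" means orthogonal projection. For $r \ge 0$, $\mathbb{D}_r := \{z \in \mathbb{C} : |z| \le r\}$, and $\mathbb{D}_r := \varnothing$ for $r<0$. Idempotent-valued spectral resolution and spectral operators: Let $\mathcal{B}$ be the Borel $\sigma$-algebra of $\mathbb{C}$. An idempotent-valued spectral resolution of $T \in \mathscr{B}(\mathscr{H})$ is a map $e: \mathcal{B} \to \mathscr{B}(\mathscr{H})$ whose values are (not necessarily self-adjoint) idempotents such that: (1) $T e(\Omega) = e(\Omega) T$ and $\mathrm{sp}(T|_{\mathrm{ran}(e(\Omega))}) \subseteq \overline{\Omega}$ for all $\Omega \in \mathcal{B}$; (2) $e(\varnothing) = 0$, $e(\mathbb{C}) = I$, and $e(\mathbb{C} \setminus \Omega) = I - e(\Omega)$ for all $\Omega \in \mathcal{B}$; (3) $e(\Omega_1 \cap \Omega_2) = e(\Omega_1) e(\Omega_2)$ and $e(\Omega_1 \cup \Omega_2) = e(\Omega_1) + e(\Omega_2) - e(\Omega_1) e(\Omega_2)$ for all $\Omega_1, \Omega_2 \in \mathcal{B}$; (4) there is a constant $M \ge 0$ with $\|e(\Omega)\| \le M$ for all $\Omega \in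 \mathcal{B}$; (5) $e\big(\bigcup_{n} \Omega_n\big)x = \sum_{n=1}^\infty e(\Omega_n) x$ for every $x \in \mathscr{H}$ and every sequence $\{\Omega_n\}_{n\in\mathbb{N}}$ of disjoint Borel sets. If such a map exists, it is uniquely determined by $T$ and is denoted $e_T$; in that case $T$ is called a spectral operator. Resolution of the identity: a family $\{E_\lambda\}_{\lambda \in \mathbb{R}}$ of projections such that (a) $\bigwedge_\lambda E_\lambda = 0$ and $\bigvee_\lambda E_\lambda = I$; (b) $E_\lambda \le E_{\lambda'}$ when $\lambda \le \lambda'$; (c) $E_\lambda = \bigwedge_{\lambda' > \lambda} E_{\lambda'}$. It is bounded if there is a constant $a \in \mathbb{R}$ such that $E_\lambda = 0$ when $\lambda < -a$ and $E_\lambda = I$ when $\lambda > a$. Integrals against a bounded resolution of the identity are understood as norm limits of approximating Riemann(–Stieltjes) sums. *)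

theory Defs
  imports "HOL-Analysis.Analysis"
begin

section \<open>Complex Hilbert spaces\<close>

text \<open>
  The real scalar multiplication and the norm come from \<^class>\<open>banach\<close>; the axioms tie them to
  the complex structure. The inner product is linear in its first argument. The last axiom
  also makes it positive definite.
\<close>

class complex_hilbert_space = banach +
  fixes scaleC :: "complex \<Rightarrow> 'a \<Rightarrow> 'a" (infixr "*\<^sub>C" 75)
    and cinner :: "'a \<Rightarrow> 'a \<Rightarrow> complex"
  assumes scaleC_add_right: "c *\<^sub>C (x + y) = c *\<^sub>C x + c *\<^sub>C y"
    and scaleC_add_left: "(c + d) *\<^sub>C x = c *\<^sub>C x + d *\<^sub>C x"
    and scaleC_scaleC: "c *\<^sub>C (d *\<^sub>C x) = (c * d) *\<^sub>C x"
    and scaleR_scaleC: "r *\<^sub>R x = complex_of_real r *\<^sub>C x"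
    and cinner_commute: "cinner x y = cnj (cinner y x)"
    and cinner_add_left: "cinner (x + y) z = cinner x z + cinner y z"
    and cinner_scaleC_left: "cinner (c *\<^sub>C x) y = c * cinner x y"
    and cinner_self: "cinner x x = complex_of_real ((norm x)\<^sup>2)"

instantiation complex :: complex_hilbert_space
begin

definition scaleC_complex :: "complex \<Rightarrow> complex \<Rightarrow> complex"
  where "scaleC_complex c x = c * x"

definition cinner_complex :: "complex \<Rightarrow> complex \<Rightarrow> complex"
  where "cinner_complex x y = x * cnj y"

instance
  by standard
    (simp_all add: scaleC_complex_def cinner_complex_def algebra_simps scaleR_conv_of_real
      complex_norm_square[symmetric])

end


section \<open>Bounded operators\<close>

text \<open>
  The type \<open>'a \<Rightarrow>\<^sub>L 'a\<close> contains all bounded real-linear maps, with the operator norm;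
  the bounded complex-linear operators are a closed subalgebra of it.
\<close>

definition bounded_ops :: "('a::complex_hilbert_space \<Rightarrow>\<^sub>L 'a) set"
  where "bounded_ops = {T :: 'a \<Rightarrow>\<^sub>L 'a. \<forall>c x. T (c *\<^sub>C x) = c *\<^sub>C T x}"

primrec op_power :: "('a::real_normed_vector \<Rightarrow>\<^sub>L 'a) \<Rightarrow> nat \<Rightarrow> ('a \<Rightarrow>\<^sub>L 'a)"
  where
    "op_power T 0 = id_blinfun"
  | "op_power T (Suc n) = T o\<^sub>L op_power T n"

definition adjoint_op :: "('a::complex_hilbert_space \<Rightarrow>\<^sub>L 'a) \<Rightarrow> ('a \<Rightarrow>\<^sub>L 'a)"
  where "adjoint_op T = (THE S. S \<in> bounded_ops \<and> (\<forall>x y. cinner (T x) y = cinner x (S y)))"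

definition positive_op :: "('a::complex_hilbert_space \<Rightarrow>\<^sub>L 'a) \<Rightarrow> bool"
  where "positive_op T \<longleftrightarrow> T \<in> bounded_ops \<and> (\<forall>x. cinner (T x) x \<in> \<real>\<^sub>\<ge>\<^sub>0)"

definition op_le :: "('a::complex_hilbert_space \<Rightarrow>\<^sub>L 'a) \<Rightarrow> ('a \<Rightarrow>\<^sub>L 'a) \<Rightarrow> bool"
  where "op_le S T \<longleftrightarrow> positive_op (T - S)"

text \<open>The unique positive \<open>n\<close>-th root of a positive operator, for \<open>n \<ge> 1\<close>.\<close>

definition op_root :: "nat \<Rightarrow> ('a::complex_hilbert_space \<Rightarrow>\<^sub>L 'a) \<Rightarrow> ('a \<Rightarrow>\<^sub>L 'a)"
  where "op_root n T = (THE S. positive_op S \<and> op_power S n = T)"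

definition op_abs :: "('a::complex_hilbert_space \<Rightarrow>\<^sub>L 'a) \<Rightarrow> ('a \<Rightarrow>\<^sub>L 'a)"
  where "op_abs T = op_root 2 (adjoint_op T o\<^sub>L T)"


section \<open>Spectrum\<close>

definition bounded_clinear_on :: "'a::complex_hilbert_space set \<Rightarrow> ('a \<Rightarrow> 'a) \<Rightarrow> bool"
  where "bounded_clinear_on V f \<longleftrightarrow>
    (\<forall>x\<in>V. \<forall>y\<in>V. f (x + y) = f x + f y) \<and>
    (\<forall>c. \<forall>x\<in>V. f (c *\<^sub>C x) = c *\<^sub>C f x) \<and>
    (\<exists>K. \<forall>x\<in>V. norm (f x) \<le> K * norm x)"

text \<open>
  Spectrum of the restriction of \<open>T\<close> to a \<open>T\<close>-invariant closed subspace \<open>V\<close>, i.e. in the algebra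
  of bounded operators on \<open>V\<close>: the inverse \<open>S\<close> need only be defined on \<open>V\<close> (its values outside
  \<open>V\<close> are irrelevant). For \<open>V = {0}\<close> the spectrum is empty.
\<close>

definition spectrum_on :: "'a::complex_hilbert_space set \<Rightarrow> ('a \<Rightarrow>\<^sub>L 'a) \<Rightarrow> complex set"
  where "spectrum_on V T = {z. \<not> (\<exists>S. S ` V \<subseteq> V \<and> bounded_clinear_on V S \<and>
    (\<forall>x\<in>V. S (T x - z *\<^sub>C x) = x \<and> T (S x) - z *\<^sub>C S x = x))}"

definition spectrum :: "('a::complex_hilbert_space \<Rightarrow>\<^sub>L 'a) \<Rightarrow> complex set"
  where "spectrum T = spectrum_on UNIV T"

text \<open>The spectrum is empty exactly on the zero space, where the spectral radius is \<open>0\<close>.\<close>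

definition spectral_radius :: "('a::complex_hilbert_space \<Rightarrow>\<^sub>L 'a) \<Rightarrow> real"
  where "spectral_radius T = (if spectrum T = {} then 0 else (SUP z\<in>spectrum T. cmod z))"


section \<open>Projections and resolutions of the identity\<close>

definition projection_op :: "('a::complex_hilbert_space \<Rightarrow>\<^sub>L 'a) \<Rightarrow> bool"
  where "projection_op P \<longleftrightarrow>
    P \<in> bounded_ops \<and> P o\<^sub>L P = P \<and> (\<forall>x y. cinner (P x) y = cinner x (P y))"

definition range_projection :: "('a::complex_hilbert_space \<Rightarrow>\<^sub>L 'a) \<Rightarrow> ('a \<Rightarrow>\<^sub>L 'a)"
  where "range_projection T = (THE P. projection_op P \<and> range P = closure (range T))"

text \<open>Infima and suprema are taken in the lattice of projections.\<close>

definition is_proj_Inf :: "('a::complex_hilbert_space \<Rightarrow>\<^sub>L 'a) set \<Rightarrow> ('a \<Rightarrow>\<^sub>L 'a) \<Rightarrow> bool"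
  where "is_proj_Inf \<P> P \<longleftrightarrow> projection_op P \<and> (\<forall>Q\<in>\<P>. op_le P Q) \<and>
    (\<forall>R. projection_op R \<and> (\<forall>Q\<in>\<P>. op_le R Q) \<longrightarrow> op_le R P)"

definition is_proj_Sup :: "('a::complex_hilbert_space \<Rightarrow>\<^sub>L 'a) set \<Rightarrow> ('a \<Rightarrow>\<^sub>L 'a) \<Rightarrow> bool"
  where "is_proj_Sup \<P> P \<longleftrightarrow> projection_op P \<and> (\<forall>Q\<in>\<P>. op_le Q P) \<and>
    (\<forall>R. projection_op R \<and> (\<forall>Q\<in>\<P>. op_le Q R) \<longrightarrow> op_le P R)"

definition resolution_of_identity :: "(real \<Rightarrow> ('a::complex_hilbert_space \<Rightarrow>\<^sub>L 'a)) \<Rightarrow> bool"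
  where "resolution_of_identity E \<longleftrightarrow>
    (\<forall>l. projection_op (E l)) \<and>
    is_proj_Inf (range E) 0 \<and> is_proj_Sup (range E) id_blinfun \<and>
    (\<forall>l l'. l \<le> l' \<longrightarrow> op_le (E l) (E l')) \<and>
    (\<forall>l. is_proj_Inf (E ` {l<..}) (E l))"

definition bounded_resolution_of_identity ::
    "(real \<Rightarrow> ('a::complex_hilbert_space \<Rightarrow>\<^sub>L 'a)) \<Rightarrow> bool"
  where "bounded_resolution_of_identity E \<longleftrightarrow> resolution_of_identity E \<and>
    (\<exists>a. (\<forall>l < - a. E l = 0) \<and> (\<forall>l > a. E l = id_blinfun))"

text \<open>
  \<open>has_stieltjes_integral f E a b J\<close>: the Riemann--Stieltjes sums of \<open>f\<close> against \<open>E\<close> over tagged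
  partitions \<open>a = s 0 \<le> \<dots> \<le> s n = b\<close> converge in norm to \<open>J\<close> as the mesh tends to \<open>0\<close>.
\<close>

definition has_stieltjes_integral ::
    "(real \<Rightarrow> real) \<Rightarrow> (real \<Rightarrow> ('a::real_normed_vector \<Rightarrow>\<^sub>L 'a)) \<Rightarrow> real \<Rightarrow> real
      \<Rightarrow> ('a \<Rightarrow>\<^sub>L 'a) \<Rightarrow> bool"
  where "has_stieltjes_integral f E a b J \<longleftrightarrow>
    (\<forall>\<epsilon>>0. \<exists>\<delta>>0. \<forall>n (s :: nat \<Rightarrow> real) (t :: nat \<Rightarrow> real).
      s 0 = a \<and> s n = b \<and>
      (\<forall>i<n. s i \<le> t i \<and> t i \<le> s (Suc i) \<and> s (Suc i) - s i < \<delta>) \<longrightarrow>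
      norm ((\<Sum>i<n. f (t i) *\<^sub>R (E (s (Suc i)) - E (s i))) - J) < \<epsilon>)"


section \<open>Spectral operators\<close>

text \<open>
  Only the values of \<open>e\<close> on Borel sets are constrained.
\<close>

definition idempotent_spectral_resolution ::
    "('a::complex_hilbert_space \<Rightarrow>\<^sub>L 'a) \<Rightarrow> (complex set \<Rightarrow> ('a \<Rightarrow>\<^sub>L 'a)) \<Rightarrow> bool"
  where "idempotent_spectral_resolution T e \<longleftrightarrow>
    (\<forall>\<Omega>\<in>sets borel. e \<Omega> \<in> bounded_ops \<and> e \<Omega> o\<^sub>L e \<Omega> = e \<Omega>) \<and>
    (\<forall>\<Omega>\<in>sets borel. T o\<^sub>L e \<Omega> = e \<Omega> o\<^sub>L T \<and> spectrum_on (range (e \<Omega>)) T \<subseteq> closure \<Omega>) \<and>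
    (e {} = 0 \<and> e UNIV = id_blinfun \<and> (\<forall>\<Omega>\<in>sets borel. e (- \<Omega>) = id_blinfun - e \<Omega>)) \<and>
    (\<forall>\<Omega>\<^sub>1\<in>sets borel. \<forall>\<Omega>\<^sub>2\<in>sets borel.
      e (\<Omega>\<^sub>1 \<inter> \<Omega>\<^sub>2) = e \<Omega>\<^sub>1 o\<^sub>L e \<Omega>\<^sub>2 \<and>
      e (\<Omega>\<^sub>1 \<union> \<Omega>\<^sub>2) = e \<Omega>\<^sub>1 + e \<Omega>\<^sub>2 - (e \<Omega>\<^sub>1 o\<^sub>L e \<Omega>\<^sub>2)) \<and>
    (\<exists>M\<ge>0. \<forall>\<Omega>\<in>sets borel. norm (e \<Omega>) \<le> M) \<and>
    (\<forall>x. \<forall>\<Omega> :: nat \<Rightarrow> complex set. range \<Omega> \<subseteq> sets borel \<and> disjoint_family \<Omega> \<longrightarrow>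
      (\<lambda>n. e (\<Omega> n) x) sums e (\<Union>n. \<Omega> n) x)"

definition spectral_operator :: "('a::complex_hilbert_space \<Rightarrow>\<^sub>L 'a) \<Rightarrow> bool"
  where "spectral_operator T \<longleftrightarrow>
    T \<in> bounded_ops \<and> (\<exists>e. idempotent_spectral_resolution T e)"

end

theory Submission
  imports Defs "HOL-Complex_Analysis.Complex_Analysis"
begin

text \<open>
  Cauchy estimates for the resolvent of \<open>A\<close> on the ranges of \<open>e (cball 0 l)\<close> and its complement give
  \<open>\<parallel>A\<^sup>n x\<parallel> \<le> C (l + \<epsilon>)\<^sup>n \<parallel>x\<parallel>\<close> on the former and \<open>(l - \<epsilon>)\<^sup>n \<parallel>x\<parallel> \<le> C \<parallel>A\<^sup>n x\<parallel>\<close> on the latter, which is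
  already (ii). For (i), split the space orthogonally by the increments of \<open>F\<close> over a partition of
  \<open>[0, r]\<close>: the two estimates bound \<open>\<bar>A\<^sup>n\<bar>\<^sup>2\<close> above and below, up to constants, by \<open>2n\<close>-th powers of
  approximating Riemann sums. The Loewner--Heinz inequality allows taking \<open>2n\<close>-th roots, the constants
  disappear in the limit, and \<open>\<bar>A\<^sup>n\<bar>\<^sup>1\<^sup>/\<^sup>n\<close> is squeezed between Riemann sums that differ by the mesh.
\<close>

section \<open>Complex inner products\<close>

text \<open>The idempotents \<open>e (cball 0 l)\<close> commute with \<open>A\<close> but need not
  be self-adjoint, so norms do not split along them; the projections \<open>F l\<close> split norms
  but need not commute with \<open>A\<close>. Each estimate is therefore proved for the idempotents
  and then carried over to \<open>F\<close>, which works because the ranges agree: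
  \<open>F l\<close> and \<open>e (cball 0 l)\<close> fix the same vectors, and
  \<open>1 - F l\<close> kills the range of the idempotent. The positive operators compared
  afterwards do not commute, so roots can only be taken by operator monotonicity. The integral is
  not constructed separately: late roots are close to one fixed Riemann sum and hence form a Cauchy
  sequence, and every fine Riemann sum is close to their limit, which is thereby the integral. For
  the spectrum of the limit, \<open>F\<close> is constant between two radii exactly when the
  idempotents are, and these change precisely near the moduli of spectral points of
  \<open>A\<close>.\<close>

lemma scaleC_zero_right [simp]: "c *\<^sub>C 0 = 0"
  using scaleC_add_right[of c 0 0] by simp

lemma scaleC_zero_left [simp]: "0 *\<^sub>C x = 0"
  using scaleC_add_left[of 0 0 x] by simp

lemma scaleC_one [simp]: "1 *\<^sub>C x = x"
  using scaleR_scaleC[of 1 x] by simp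

lemma scaleC_minus_right: "c *\<^sub>C (- x) = - (c *\<^sub>C x)"
  using scaleC_add_right[of c x "- x"] by (simp add: minus_unique)

lemma scaleC_minus_left: "(- c) *\<^sub>C x = - (c *\<^sub>C x)"
  using scaleC_add_left[of c "- c" x] by (simp add: minus_unique)

lemma scaleC_diff_right: "c *\<^sub>C (x - y) = c *\<^sub>C x - c *\<^sub>C y"
  using scaleC_add_right[of c x "- y"] by (simp add: scaleC_minus_right)

lemma scaleC_diff_left: "(c - d) *\<^sub>C x = c *\<^sub>C x - d *\<^sub>C x"
  using scaleC_add_left[of c "- d" x] by (simp add: scaleC_minus_left)

lemma cinner_zero_left [simp]: "cinner 0 y = 0"
  using cinner_add_left[of 0 0 y] by simp

lemma cinner_zero_right [simp]: "cinner y 0 = 0"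
  using cinner_commute[of y 0] by simp

lemma cinner_minus_left: "cinner (- x) y = - cinner x y"
  using cinner_add_left[of x "- x" y] by (simp add: eq_neg_iff_add_eq_0 add.commute)

lemma cinner_diff_left: "cinner (x - y) z = cinner x z - cinner y z"
  using cinner_add_left[of x "- y" z] by (simp add: cinner_minus_left)

lemma cinner_add_right: "cinner x (y + z) = cinner x y + cinner x z"
  by (metis cinner_commute cinner_add_left complex_cnj_add)

lemma cinner_diff_right: "cinner x (y - z) = cinner x y - cinner x z"
  by (metis cinner_commute cinner_diff_left complex_cnj_diff)

lemma cinner_minus_right: "cinner x (- y) = - cinner x y"
  by (metis cinner_commute cinner_minus_left complex_cnj_minus)

lemma cinner_scaleC_right: "cinner x (c *\<^sub>C y) = cnj c * cinner x y"
  by (metis cinner_commute cinner_scaleC_left complex_cnj_mult)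

lemma cinner_scaleR_left: "cinner (r *\<^sub>R x) y = of_real r * cinner x y"
  by (simp add: scaleR_scaleC cinner_scaleC_left)

lemma cinner_scaleR_right: "cinner x (r *\<^sub>R y) = of_real r * cinner x y"
  by (simp add: scaleR_scaleC cinner_scaleC_right)

lemma Re_cinner_commute: "Re (cinner x y) = Re (cinner y x)"
  by (subst cinner_commute) simp

lemma Re_cinner_self: "Re (cinner x x) = (norm x)\<^sup>2"
  by (simp add: cinner_self)

lemma norm_scaleC: "norm (c *\<^sub>C x) = cmod c * norm x"
proof -
  have "complex_of_real ((norm (c *\<^sub>C x))\<^sup>2) = c * cnj c * cinner x x"
    unfolding cinner_self[symmetric] by (simp only: cinner_scaleC_left cinner_scaleC_right mult_ac)
  also have "\<dots> = complex_of_real ((cmod c * norm x)\<^sup>2)"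
    by (simp add: cinner_self power_mult_distrib complex_norm_square[symmetric])
  finally have "complex_of_real ((norm (c *\<^sub>C x))\<^sup>2) = complex_of_real ((cmod c * norm x)\<^sup>2)" .
  hence "(norm (c *\<^sub>C x))\<^sup>2 = (cmod c * norm x)\<^sup>2"
    using of_real_eq_iff by blast
  thus ?thesis by (simp add: power2_eq_iff_nonneg)
qed

lemma norm_add_square: "(norm (x + y))\<^sup>2 = (norm x)\<^sup>2 + 2 * Re (cinner x y) + (norm y)\<^sup>2"
  using Re_cinner_self[of "x + y"]
  by (simp add: cinner_add_left cinner_add_right Re_cinner_self Re_cinner_commute[of y x])

lemma norm_diff_square: "(norm (x - y))\<^sup>2 = (norm x)\<^sup>2 - 2 * Re (cinner x y) + (norm y)\<^sup>2"
  using norm_add_square[of x "- y"] by (simp add: cinner_minus_right)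

lemma Re_cinner_le: "Re (cinner x y) \<le> norm x * norm y"
proof (cases "x = 0 \<or> y = 0")
  case False
  have "0 \<le> (norm (norm y *\<^sub>R x - norm x *\<^sub>R y))\<^sup>2" by simp
  also have "\<dots> = 2 * (norm x * norm y) * (norm x * norm y - Re (cinner x y))"
    unfolding norm_diff_square
    by (simp add: cinner_scaleR_left cinner_scaleR_right power_mult_distrib)
       (simp add: algebra_simps power2_eq_square)
  finally show ?thesis
    using mult_pos_pos[of "norm x" "norm y"] False by (auto simp: zero_le_mult_iff simp del: mult_pos_pos)
qed auto

lemma cmod_cinner_le: "cmod (cinner x y) \<le> norm x * norm y"
proof (cases "cinner x y = 0")
  case False
  \<comment> \<open>Rotating by the unimodular \<open>u\<close> makes the inner product real and
    nonnegative, which reduces the claim to the bound on real parts.\<close>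
  define u where "u = cnj (sgn (cinner x y))"
  have u: "cmod u = 1" using False by (simp add: u_def norm_sgn)
  have "u * cinner x y = of_real (cmod (cinner x y))"
    using False complex_norm_square[of "cinner x y"] unfolding u_def sgn_div_norm
    by (simp add: scaleR_conv_of_real field_simps power2_eq_square)
  hence "cmod (cinner x y) = Re (cinner (u *\<^sub>C x) y)"
    by (simp add: cinner_scaleC_left)
  also have "\<dots> \<le> norm (u *\<^sub>C x) * norm y" by (rule Re_cinner_le)
  finally show ?thesis by (simp add: norm_scaleC u)
qed simp

lemma cinner_ext_left:
  assumes "\<And>y. cinner x y = cinner x' y"
  shows "x = x'"
proof -
  have "cinner (x - x') (x - x') = 0"
    using assms[of "x - x'"] by (simp add: cinner_diff_left)
  thus ?thesis by (simp add: cinner_self)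
qed

lemma bounded_linear_cinner_left: "bounded_linear (\<lambda>x. cinner x y)"
  by (rule bounded_linear_intro[where K = "norm y"])
     (auto simp: cinner_add_left cinner_scaleR_left cmod_cinner_le scaleR_conv_of_real)

lemma bounded_bilinear_cinner: "bounded_bilinear (cinner :: 'a::complex_hilbert_space \<Rightarrow> 'a \<Rightarrow> complex)"
  by (rule bounded_bilinear.intro)
     (auto simp: cinner_add_left cinner_add_right cinner_scaleR_left cinner_scaleR_right
       scaleR_conv_of_real intro!: exI[of _ 1] cmod_cinner_le)

lemmas tendsto_cinner [tendsto_intros] = bounded_bilinear.tendsto[OF bounded_bilinear_cinner]

lemma bounded_linear_scaleC: "bounded_linear (\<lambda>x::'a::complex_hilbert_space. c *\<^sub>C x)"
  by (rule bounded_linear_intro[where K = "cmod c"])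
     (auto simp: scaleC_add_right norm_scaleC scaleR_scaleC scaleC_scaleC mult.commute)

text \<open>
  The minimiser of \<open>\<parallel>v\<parallel>\<^sup>2 - 2 Re (f v)\<close> over the subspace represents \<open>f\<close>; with \<open>f = cinner _ x\<close> this
  is the orthogonal projection of \<open>x\<close>, with the full space it is the Riesz representation.
\<close>

lemma Riesz_on_closed_subspace:
  fixes V :: "'a::complex_hilbert_space set" and f :: "'a \<Rightarrow> complex"
  assumes V: "closed V" "0 \<in> V" "\<And>x y. x \<in> V \<Longrightarrow> y \<in> V \<Longrightarrow> x + y \<in> V"
    "\<And>c x. x \<in> V \<Longrightarrow> c *\<^sub>C x \<in> V"
  and f: "bounded_linear f" "\<And>c x. f (c *\<^sub>C x) = c * f x"
  shows "\<exists>v\<in>V. \<forall>w\<in>V. cinner w v = f w"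
proof -
  interpret f: bounded_linear f by fact
  have VR: "r *\<^sub>R x \<in> V" if "x \<in> V" for r x
    using V(4)[OF that] by (simp add: scaleR_scaleC)
  define \<phi> where "\<phi> v = (norm v)\<^sup>2 - 2 * Re (f v)" for v
  obtain K where K: "\<And>x. norm (f x) \<le> norm x * K" "K > 0"
    using f.pos_bounded by blast
  have lb: "- K\<^sup>2 \<le> \<phi> v" for v
  proof -
    have "Re (f v) \<le> norm v * K"
      using complex_Re_le_cmod[of "f v"] K(1)[of v] by linarith
    moreover have "0 \<le> (norm v - K)\<^sup>2" by simp
    ultimately show ?thesis unfolding \<phi>_def by (simp add: power2_eq_square algebra_simps)
  qed
  define d where "d = (INF v\<in>V. \<phi> v)"
  have bdd: "bdd_below (\<phi> ` V)" using lb by (auto intro!: bdd_belowI)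
  have dle: "d \<le> \<phi> v" if "v \<in> V" for v
    unfolding d_def using bdd that by (rule cINF_lower)
  have ex: "\<exists>v\<in>V. \<phi> v < d + e" if "e > 0" for e
  proof -
    have "d < d + e" using that by simp
    thus ?thesis unfolding d_def using V(2) bdd by (subst (asm) cINF_less_iff) auto
  qed
  \<comment> \<open>The parallelogram law at the midpoint of \<open>u\<close> and \<open>v\<close>:
    two nearly minimal vectors are close, so a minimising sequence is Cauchy.\<close>
  have par: "(norm (u - v))\<^sup>2 \<le> 2 * (\<phi> u - d) + 2 * (\<phi> v - d)" if "u \<in> V" "v \<in> V" for u v
  proof -
    have m: "(1/2) *\<^sub>R (u + v) \<in> V" using V(3)[OF that] VR by blast
    have "4 * \<phi> ((1/2) *\<^sub>R (u + v)) = (norm (u + v))\<^sup>2 - 4 * Re (f u) - 4 * Re (f v)"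
      unfolding \<phi>_def
      by (simp add: f.scaleR f.add power_mult_distrib power_divide algebra_simps del: scaleR_add_right)
    also have "(norm (u + v))\<^sup>2 = 2 * (norm u)\<^sup>2 + 2 * (norm v)\<^sup>2 - (norm (u - v))\<^sup>2"
      by (simp add: norm_add_square norm_diff_square)
    finally have "(norm (u - v))\<^sup>2 = 2 * \<phi> u + 2 * \<phi> v - 4 * \<phi> ((1/2) *\<^sub>R (u + v))"
      unfolding \<phi>_def by simp
    with dle[OF m] show ?thesis by simp
  qed
  have "\<forall>n. \<exists>v\<in>V. \<phi> v < d + 1 / Suc n" using ex by simp
  then obtain s where s: "\<And>n. s n \<in> V" "\<And>n. \<phi> (s n) < d + 1 / Suc n" by metis
  have "Cauchy s"
  proof (rule metric_CauchyI)
    fix e :: real assume e: "e > 0"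
    obtain N where N: "4 / Suc N < e\<^sup>2"
      using reals_Archimedean[of "e\<^sup>2 / 4"] e by (auto simp: field_simps)
    have "dist (s m) (s n) < e" if "m \<ge> N" "n \<ge> N" for m n
    proof -
      have "1 / Suc m \<le> 1 / Suc N" "1 / Suc n \<le> 1 / Suc N"
        using that by (auto simp: field_simps)
      with par[OF s(1) s(1), of m n] s(2)[of m] s(2)[of n]
      have "(norm (s m - s n))\<^sup>2 < 4 / Suc N" by simp
      with N have "(norm (s m - s n))\<^sup>2 < e\<^sup>2" by linarith
      thus ?thesis using e by (simp add: dist_norm power_less_imp_less_base)
    qed
    thus "\<exists>N. \<forall>m\<ge>N. \<forall>n\<ge>N. dist (s m) (s n) < e" by blast
  qed
  then obtain v where v: "s \<longlonglongrightarrow> v" by (auto simp: Cauchy_convergent_iff convergent_def)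
  have vV: "v \<in> V" using closed_sequentially[OF V(1) _ v] s(1) by blast
  have "(\<lambda>n. \<phi> (s n)) \<longlonglongrightarrow> \<phi> v"
    unfolding \<phi>_def by (intro tendsto_intros v f.tendsto)
  moreover have "(\<lambda>n. \<phi> (s n)) \<longlonglongrightarrow> d"
  proof (rule tendsto_sandwich)
    show "\<forall>\<^sub>F n in sequentially. d \<le> \<phi> (s n)" using dle s(1) by auto
    show "\<forall>\<^sub>F n in sequentially. \<phi> (s n) \<le> d + 1 / Suc n"
      by (rule always_eventually) (use s(2) less_imp_le in blast)
    show "(\<lambda>n. d + 1 / real (Suc n)) \<longlonglongrightarrow> d"
      using tendsto_add[OF tendsto_const[of d] LIMSEQ_inverse_real_of_nat]
      by (simp add: inverse_eq_divide)
  qed simp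
  ultimately have \<phi>v: "\<phi> v = d" using LIMSEQ_unique by blast
  have re: "Re (cinner w v) = Re (f w)" if w: "w \<in> V" for w
  proof -
    define a where "a = Re (cinner w v) - Re (f w)"
    \<comment> \<open>The quadratic polynomial in \<open>t\<close> has its minimum 0 at
      \<open>t = 0\<close>, hence no linear term.\<close>
    have q: "0 \<le> t\<^sup>2 * (norm w)\<^sup>2 + 2 * t * a" for t :: real
    proof -
      have "d \<le> \<phi> (v + t *\<^sub>R w)" using V(3)[OF vV VR[OF w]] dle by blast
      also have "\<dots> = \<phi> v + t\<^sup>2 * (norm w)\<^sup>2 + 2 * t * a"
        unfolding \<phi>_def a_def norm_add_square f.add f.scaleR
        by (simp add: cinner_scaleR_right power_mult_distrib Re_cinner_commute[of v w] algebra_simps)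
      finally show ?thesis using \<phi>v by simp
    qed
    have "a = 0"
    proof (cases "w = 0")
      case False
      have "0 \<le> - (a\<^sup>2 / (norm w)\<^sup>2)"
        using q[of "- a / (norm w)\<^sup>2"] False
        by (simp add: power_divide power2_eq_square field_simps)
      thus ?thesis using False by (simp add: divide_le_0_iff)
    qed (use f.zero in \<open>simp add: a_def\<close>)
    thus ?thesis by (simp add: a_def)
  qed
  have "cinner w v = f w" if w: "w \<in> V" for w
  proof (rule complex_eqI)
    show "Re (cinner w v) = Re (f w)" using re[OF w] .
    \<comment> \<open>The real part at \<open>- \<i>\<close> times \<open>w\<close> is the imaginary
      part at \<open>w\<close>.\<close>
    have "Re (cinner ((- \<i>) *\<^sub>C w) v) = Re (f ((- \<i>) *\<^sub>C w))" using re V(4)[OF w] by blast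
    thus "Im (cinner w v) = Im (f w)" by (simp add: cinner_scaleC_left f(2))
  qed
  with vV show ?thesis by blast
qed

section \<open>The algebra of bounded operators\<close>

text \<open>
  The bounded complex-linear operators as a type of their own, so that products and powers are
  those of a Banach algebra. On the zero space \<open>0 = 1\<close>, hence no \<^class>\<open>ring_1\<close> instance.
\<close>

typedef (overloaded) ('a::complex_hilbert_space) bop = "bounded_ops :: ('a \<Rightarrow>\<^sub>L 'a) set"
  by (rule exI[of _ 0]) (simp add: bounded_ops_def)

setup_lifting type_definition_bop

lift_definition ap :: "'a::complex_hilbert_space bop \<Rightarrow> 'a \<Rightarrow> 'a" (infixl "\<cdot>" 78) is blinfun_apply .

lemma Rep_bop_apply: "blinfun_apply (Rep_bop X) = ap X"
  by (rule ext) (simp add: ap.rep_eq)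

lemma Rep_bop_in [simp]: "Rep_bop X \<in> bounded_ops"
  using Rep_bop .

lemma bop_eqI: "(\<And>x. X \<cdot> x = Y \<cdot> x) \<Longrightarrow> X = Y"
  by transfer (rule blinfun_eqI)

lemma ap_scaleC: "X \<cdot> (c *\<^sub>C x) = c *\<^sub>C (X \<cdot> x)"
  by transfer (simp add: bounded_ops_def)

lemma bounded_linear_ap: "bounded_linear (ap X)"
  unfolding Rep_bop_apply[symmetric] by (rule blinfun.bounded_linear_right)

lemma ap_add: "X \<cdot> (x + y) = X \<cdot> x + X \<cdot> y"
  and ap_diff: "X \<cdot> (x - y) = X \<cdot> x - X \<cdot> y"
  and ap_zero [simp]: "X \<cdot> 0 = 0"
  and ap_scaleR: "X \<cdot> (r *\<^sub>R x) = r *\<^sub>R (X \<cdot> x)"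
  using bounded_linear_ap[of X]
  by (simp_all add: linear_simps)

lemma ap_sum: "X \<cdot> (sum f I) = (\<Sum>i\<in>I. X \<cdot> f i)"
  using bounded_linear_ap[of X] by (rule linear_sum[OF bounded_linear.linear])

lemma tendsto_ap [tendsto_intros]: "(f \<longlongrightarrow> a) G \<Longrightarrow> ((\<lambda>n. X \<cdot> f n) \<longlongrightarrow> X \<cdot> a) G"
  using bounded_linear_ap[of X] by (rule bounded_linear.tendsto)

instantiation bop :: (complex_hilbert_space) "{ring, monoid_mult}"
begin

lift_definition zero_bop :: "'a bop" is 0 by (simp add: bounded_ops_def)
lift_definition one_bop :: "'a bop" is id_blinfun by (simp add: bounded_ops_def)
lift_definition plus_bop :: "'a bop \<Rightarrow> 'a bop \<Rightarrow> 'a bop" is "(+)"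
  by (simp add: bounded_ops_def blinfun.add_left scaleC_add_right)
lift_definition minus_bop :: "'a bop \<Rightarrow> 'a bop \<Rightarrow> 'a bop" is "(-)"
  by (simp add: bounded_ops_def blinfun.diff_left scaleC_diff_right)
lift_definition uminus_bop :: "'a bop \<Rightarrow> 'a bop" is "uminus"
  by (simp add: bounded_ops_def blinfun.minus_left scaleC_minus_right)
lift_definition times_bop :: "'a bop \<Rightarrow> 'a bop \<Rightarrow> 'a bop" is "(o\<^sub>L)"
  by (simp add: bounded_ops_def)

instance
  by standard (transfer; auto intro!: blinfun_eqI simp: blinfun.bilinear_simps)+

end

lemma ap_0 [simp]: "0 \<cdot> x = 0"
  and ap_1 [simp]: "1 \<cdot> x = x"
  and ap_plus: "(X + Y) \<cdot> x = X \<cdot> x + Y \<cdot> x"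
  and ap_sub: "(X - Y) \<cdot> x = X \<cdot> x - Y \<cdot> x"
  and ap_mult [simp]: "(X * Y) \<cdot> x = X \<cdot> (Y \<cdot> x)"
  by (transfer; simp add: blinfun.bilinear_simps)+

instantiation bop :: (complex_hilbert_space) real_vector
begin

lift_definition scaleR_bop :: "real \<Rightarrow> 'a bop \<Rightarrow> 'a bop" is "scaleR"
  by (simp add: bounded_ops_def blinfun.scaleR_left scaleR_scaleC scaleC_scaleC mult.commute)

instance
  by standard (transfer; simp add: algebra_simps)+

end

instantiation bop :: (complex_hilbert_space) real_normed_algebra
begin

lift_definition norm_bop :: "'a bop \<Rightarrow> real" is norm .
definition dist_bop :: "'a bop \<Rightarrow> 'a bop \<Rightarrow> real" where "dist_bop X Y = norm (X - Y)"
definition sgn_bop :: "'a bop \<Rightarrow> 'a bop" where "sgn_bop X = X /\<^sub>R norm X"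
definition uniformity_bop :: "('a bop \<times> 'a bop) filter"
  where "uniformity_bop = (INF e\<in>{0<..}. principal {(x, y). dist x y < e})"
definition open_bop :: "'a bop set \<Rightarrow> bool"
  where "open_bop U \<longleftrightarrow> (\<forall>x\<in>U. \<forall>\<^sub>F (x', y) in uniformity. x' = x \<longrightarrow> y \<in> U)"

instance
proof
  fix X Y Z :: "'a bop" and a b :: real
  show "dist X Y = norm (X - Y)" by (rule dist_bop_def)
  show "sgn X = X /\<^sub>R norm X" by (rule sgn_bop_def)
  show "(uniformity :: ('a bop \<times> 'a bop) filter) = (INF e\<in>{0<..}. principal {(x, y). dist x y < e})"
    by (rule uniformity_bop_def)
  show "open U \<longleftrightarrow> (\<forall>x\<in>U. \<forall>\<^sub>F (x', y) in uniformity. x' = x \<longrightarrow> y \<in> U)" for U :: "'a bop set"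
    by (rule open_bop_def)
  show "a *\<^sub>R X * Y = a *\<^sub>R (X * Y)" "X * a *\<^sub>R Y = a *\<^sub>R (X * Y)"
    by (transfer; auto intro!: blinfun_eqI simp: blinfun.bilinear_simps)+
  show "norm X = 0 \<longleftrightarrow> X = 0" "norm (X + Y) \<le> norm X + norm Y" "norm (a *\<^sub>R X) = \<bar>a\<bar> * norm X"
    "norm (X * Y) \<le> norm X * norm Y"
    by (transfer; simp add: norm_triangle_ineq norm_blinfun_compose)+
qed

end

lemma ap_scaleR_left: "(r *\<^sub>R X) \<cdot> x = r *\<^sub>R (X \<cdot> x)"
  by transfer (simp add: blinfun.bilinear_simps)

lemma norm_ap: "norm (X \<cdot> x) \<le> norm X * norm x"
  by transfer (rule norm_blinfun)

lemma norm_bop_le: "0 \<le> c \<Longrightarrow> (\<And>x. norm (X \<cdot> x) \<le> c * norm x) \<Longrightarrow> norm X \<le> c"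
  by transfer (rule norm_blinfun_bound)

lemma ap_sum_left: "(sum f I) \<cdot> x = (\<Sum>i\<in>I. f i \<cdot> x)"
  by (induction I rule: infinite_finite_induct) (simp_all add: ap_plus)

lemma bounded_bilinear_ap: "bounded_bilinear (ap :: 'a::complex_hilbert_space bop \<Rightarrow> _)"
  by (rule bounded_bilinear.intro)
     (auto simp: ap_add ap_plus ap_scaleR ap_scaleR_left intro!: exI[of _ 1] norm_ap)

lemmas tendsto_ap2 [tendsto_intros] = bounded_bilinear.tendsto[OF bounded_bilinear_ap]

lemma closed_bounded_ops: "closed (bounded_ops :: ('a::complex_hilbert_space \<Rightarrow>\<^sub>L 'a) set)"
proof -
  have bl: "bounded_linear (\<lambda>T::'a \<Rightarrow>\<^sub>L 'a. c *\<^sub>C blinfun_apply T x)" for c x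
    by (rule bounded_linear_compose[OF bounded_linear_scaleC blinfun.bounded_linear_left])
  have "bounded_ops = (\<Inter>c. \<Inter>x. {T :: 'a \<Rightarrow>\<^sub>L 'a. T (c *\<^sub>C x) = c *\<^sub>C T x})"
    by (auto simp: bounded_ops_def)
  also have "closed \<dots>"
    by (intro closed_INT ballI closed_Collect_eq linear_continuous_on bl blinfun.bounded_linear_left)
  finally show ?thesis .
qed

instance bop :: (complex_hilbert_space) banach
proof
  fix S :: "nat \<Rightarrow> 'a bop"
  assume S: "Cauchy S"
  have "Cauchy (\<lambda>n. Rep_bop (S n))"
    using S unfolding Cauchy_def dist_norm by (simp add: norm_bop.rep_eq minus_bop.rep_eq)
  then obtain L where L: "(\<lambda>n. Rep_bop (S n)) \<longlonglongrightarrow> L"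
    by (auto simp: Cauchy_convergent_iff convergent_def)
  have "L \<in> bounded_ops" using closed_sequentially[OF closed_bounded_ops _ L] by simp
  hence "Rep_bop (Abs_bop L) = L" by (rule Abs_bop_inverse)
  hence "S \<longlonglongrightarrow> Abs_bop L"
    using L unfolding LIMSEQ_iff by (simp add: norm_bop.rep_eq minus_bop.rep_eq)
  thus "convergent S" by (auto simp: convergent_def)
qed

lemma tendsto_Rep_bop_iff: "((\<lambda>n. Rep_bop (X n)) \<longlongrightarrow> Rep_bop Y) G \<longleftrightarrow> (X \<longlongrightarrow> Y) G"
  unfolding tendsto_iff dist_norm by (simp add: norm_bop.rep_eq minus_bop.rep_eq)

lemma op_power_Rep_bop: "op_power (Rep_bop X) n = Rep_bop (X ^ n)"
  by (induction n) (simp_all add: one_bop.rep_eq times_bop.rep_eq)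

lemma bop_exists:
  assumes "bounded_linear f" "\<And>c x. f (c *\<^sub>C x) = c *\<^sub>C f x"
  obtains X where "\<And>x. X \<cdot> x = f x"
proof
  have "Blinfun f \<in> bounded_ops"
    using assms by (simp add: bounded_ops_def bounded_linear_Blinfun_apply)
  thus "Abs_bop (Blinfun f) \<cdot> x = f x" for x
    by (simp add: ap.rep_eq Abs_bop_inverse bounded_linear_Blinfun_apply assms)
qed

text \<open>The type \<open>bop\<close> carries only real scalar multiplication; complex scalars
  enter the algebra as central elements.\<close>

lift_definition scalar_op :: "complex \<Rightarrow> 'a::complex_hilbert_space bop" is "\<lambda>c. Blinfun (\<lambda>x. c *\<^sub>C x)"
  by (simp add: bounded_ops_def bounded_linear_Blinfun_apply[OF bounded_linear_scaleC]
      scaleC_scaleC mult.commute)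

lemma scalar_op_ap [simp]: "scalar_op c \<cdot> x = c *\<^sub>C x"
  by transfer (simp add: bounded_linear_Blinfun_apply[OF bounded_linear_scaleC])

lemma scalar_op_commute: "X * scalar_op c = scalar_op c * X"
  by (rule bop_eqI) (simp add: ap_scaleC)

lemma scalar_op_left_commute: "X * (scalar_op c * Y) = scalar_op c * (X * Y)"
  by (rule bop_eqI) (simp add: ap_scaleC)

lemma scalar_op_mult: "scalar_op c * scalar_op d = scalar_op (c * d)"
  by (rule bop_eqI) (simp add: scaleC_scaleC)

lemma scalar_op_0 [simp]: "scalar_op 0 = 0"
  and scalar_op_1 [simp]: "scalar_op 1 = 1"
  and scalar_op_diff: "scalar_op (c - d) = scalar_op c - scalar_op d"
  by (rule bop_eqI; simp add: ap_sub ap_plus scaleC_diff_left scaleC_add_left ap_scaleR_left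
      scaleR_scaleC)+

lemma norm_scalar_op_mult: "norm (scalar_op c * X) \<le> cmod c * norm X"
  by (rule norm_bop_le) (auto simp: norm_scaleC mult.assoc intro: mult_left_mono norm_ap)

lemma norm_le_cinner:
  assumes "0 \<le> c" "\<And>x y. cmod (cinner (X \<cdot> x) y) \<le> c * norm x * norm y"
  shows "norm X \<le> c"
proof (rule norm_bop_le)
  fix x
  have "(norm (X \<cdot> x))\<^sup>2 \<le> c * norm x * norm (X \<cdot> x)"
    using assms(2)[of x "X \<cdot> x"] by (simp add: cinner_self norm_power)
  thus "norm (X \<cdot> x) \<le> c * norm x"
    using assms(1) by (cases "X \<cdot> x = 0") (simp_all add: power2_eq_square)
qed fact

text \<open>The factor \<open>norm 1\<close> takes care of the exponent 0; it is 0 on the zero space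
  and 1 otherwise.\<close>

lemma norm_power_bop: "norm (X ^ n) \<le> norm (1 :: 'a bop) * norm X ^ n"
  for X :: "'a::complex_hilbert_space bop"
proof (induction n)
  case (Suc n)
  have "norm (X * X ^ n) \<le> norm X * norm (X ^ n)" by (rule norm_mult_ineq)
  also have "\<dots> \<le> norm X * (norm (1 :: 'a bop) * norm X ^ n)" by (intro mult_left_mono Suc) simp
  finally show ?case by (simp add: mult_ac)
qed simp

lemma norm_one_bop: "norm (1 :: 'a::complex_hilbert_space bop) \<le> 1"
  by (rule norm_bop_le) auto

lemma norm_power_bop': "norm (X ^ n) \<le> norm X ^ n" for X :: "'a::complex_hilbert_space bop"
  by (rule order.trans[OF norm_power_bop]) (use norm_one_bop in \<open>auto intro: mult_left_le_one_le\<close>)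

lemma commute_power: "X * Y = Y * X \<Longrightarrow> X * Y ^ n = Y ^ n * X" for X Y :: "'a::monoid_mult"
  by (metis power_commuting_commutes)

section \<open>Adjoints\<close>

text \<open>Riesz representation of \<open>\<lambda>w. cinner (X \<cdot> w) y\<close> for each
  \<open>y\<close>; uniqueness of the representing vector makes it linear in
  \<open>y\<close>.\<close>

lemma adjoint_exists: "\<exists>S. \<forall>x y. cinner (X \<cdot> x) y = cinner x (S \<cdot> y)"
proof -
  have "\<exists>v. \<forall>w. cinner w v = cinner (X \<cdot> w) y" for y
    using Riesz_on_closed_subspace[of UNIV "\<lambda>w. cinner (X \<cdot> w) y"]
      bounded_linear_compose[OF bounded_linear_cinner_left bounded_linear_ap[of X]]
    by (auto simp: ap_scaleC cinner_scaleC_left)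
  then obtain g where g: "\<And>x y. cinner x (g y) = cinner (X \<cdot> x) y" by metis
  have eqI: "u = v" if "\<And>x. cinner x u = cinner x v" for u v :: 'a
    by (rule cinner_ext_left) (metis that cinner_commute)
  have "bounded_linear g"
  proof (rule bounded_linear_intro[where K = "norm X"])
    show "g (x + y) = g x + g y" for x y by (rule eqI) (simp add: g cinner_add_right)
    show "g (r *\<^sub>R x) = r *\<^sub>R g x" for r x by (rule eqI) (simp add: g cinner_scaleR_right)
    show "norm (g y) \<le> norm y * norm X" for y
    proof -
      have "(norm (g y))\<^sup>2 \<le> cmod (cinner (X \<cdot> g y) y)"
        using g[of "g y" y] by (simp add: cinner_self norm_power flip: g)
      also have "\<dots> \<le> norm X * norm (g y) * norm y"
        by (rule order.trans[OF cmod_cinner_le]) (intro mult_right_mono norm_ap norm_ge_zero)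
      finally show ?thesis by (cases "g y = 0") (simp_all add: power2_eq_square mult_ac)
    qed
  qed
  moreover have "g (c *\<^sub>C x) = c *\<^sub>C g x" for c x
    by (rule eqI) (simp add: g cinner_scaleC_right)
  ultimately obtain S where "\<And>x. S \<cdot> x = g x" using bop_exists by blast
  thus ?thesis using g by metis
qed

definition adj :: "'a::complex_hilbert_space bop \<Rightarrow> 'a bop"
  where "adj X = (SOME S. \<forall>x y. cinner (X \<cdot> x) y = cinner x (S \<cdot> y))"

lemma cinner_adj: "cinner (X \<cdot> x) y = cinner x (adj X \<cdot> y)"
  using someI_ex[OF adjoint_exists[of X]] unfolding adj_def by blast

lemma cinner_adj': "cinner (adj X \<cdot> x) y = cinner x (X \<cdot> y)"
  by (metis cinner_adj cinner_commute)

lemma adj_eqI: "(\<And>x y. cinner (X \<cdot> x) y = cinner x (Y \<cdot> y)) \<Longrightarrow> adj X = Y"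
  by (rule bop_eqI, rule cinner_ext_left) (metis cinner_adj cinner_commute)

lemma adj_mult: "adj (X * Y) = adj Y * adj X"
  by (rule adj_eqI) (simp add: cinner_adj)

lemma adj_adj [simp]: "adj (adj X) = X"
  by (rule adj_eqI) (rule cinner_adj')

lemma adj_1 [simp]: "adj 1 = 1" and adj_0 [simp]: "adj 0 = 0"
  by (rule adj_eqI; simp)+

lemma adj_power: "adj (X ^ n) = adj X ^ n"
  by (induction n) (simp_all add: adj_mult power_commutes)

lemma adj_add: "adj (X + Y) = adj X + adj Y"
  by (rule adj_eqI) (simp add: ap_plus cinner_add_left cinner_add_right cinner_adj)

lemma adj_diff: "adj (X - Y) = adj X - adj Y"
  by (rule adj_eqI) (simp add: ap_sub cinner_diff_left cinner_diff_right cinner_adj)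

lemma adj_scaleR: "adj (r *\<^sub>R X) = r *\<^sub>R adj X"
  by (rule adj_eqI) (simp add: ap_scaleR_left cinner_scaleR_left cinner_scaleR_right cinner_adj)

lemma adj_sum: "adj (sum f I) = (\<Sum>i\<in>I. adj (f i))"
  by (induction I rule: infinite_finite_induct) (simp_all add: adj_add)

lemma norm_adj_le: "norm (adj X) \<le> norm X"
proof (rule norm_le_cinner)
  fix x y
  have "cmod (cinner (adj X \<cdot> x) y) \<le> norm x * norm (X \<cdot> y)"
    unfolding cinner_adj' by (rule cmod_cinner_le)
  also have "\<dots> \<le> norm x * (norm X * norm y)" by (intro mult_left_mono norm_ap) simp
  finally show "cmod (cinner (adj X \<cdot> x) y) \<le> norm X * norm x * norm y" by (simp add: mult_ac)
qed simp

lemma norm_adj [simp]: "norm (adj X) = norm X"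
  using norm_adj_le[of X] norm_adj_le[of "adj X"] by simp

lemma bounded_linear_adj: "bounded_linear adj"
  by (rule bounded_linear_intro[where K = 1]) (simp_all add: adj_add adj_scaleR)

text \<open>The C*-identity. In the Loewner--Heinz argument it gives the exact norm of the powers
  \<open>2 ^ j\<close> of a self-adjoint operator.\<close>

lemma norm_adj_mult_self: "norm (adj X * X) = (norm X)\<^sup>2"
proof (rule antisym)
  show "norm (adj X * X) \<le> (norm X)\<^sup>2"
    using norm_mult_ineq[of "adj X" X] by (simp add: power2_eq_square)
  have "norm X \<le> sqrt (norm (adj X * X))"
  proof (rule norm_bop_le)
    fix x
    have "(norm (X \<cdot> x))\<^sup>2 = Re (cinner ((adj X * X) \<cdot> x) x)"
      by (simp add: cinner_adj' Re_cinner_self)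
    also have "\<dots> \<le> norm ((adj X * X) \<cdot> x) * norm x" by (rule Re_cinner_le)
    also have "\<dots> \<le> norm (adj X * X) * norm x * norm x" by (intro mult_right_mono norm_ap) simp
    finally have "(norm (X \<cdot> x))\<^sup>2 \<le> (sqrt (norm (adj X * X)) * norm x)\<^sup>2"
      unfolding power_mult_distrib by (simp add: power2_eq_square[of "norm x"] mult.assoc)
    thus "norm (X \<cdot> x) \<le> sqrt (norm (adj X * X)) * norm x"
      by (rule power2_le_imp_le) simp
  qed simp
  thus "(norm X)\<^sup>2 \<le> norm (adj X * X)"
    using power_mono[of "norm X" _ 2] by fastforce
qed

lemma adjoint_op_Rep_bop: "adjoint_op (Rep_bop X) = Rep_bop (adj X)"
  unfolding adjoint_op_def
proof (rule the_equality)
  show "Rep_bop (adj X) \<in> bounded_ops \<and>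
      (\<forall>x y. cinner (Rep_bop X x) y = cinner x (Rep_bop (adj X) y))"
    by (simp add: Rep_bop_apply cinner_adj)
  fix S
  assume S: "S \<in> bounded_ops \<and> (\<forall>x y. cinner (Rep_bop X x) y = cinner x (S y))"
  hence "adj X = Abs_bop S"
    by (intro adj_eqI) (simp add: Rep_bop_apply ap.rep_eq[of "Abs_bop S"] Abs_bop_inverse)
  thus "S = Rep_bop (adj X)" using S by (simp add: Abs_bop_inverse)
qed

section \<open>Positive operators and their roots\<close>

definition qf :: "'a::complex_hilbert_space bop \<Rightarrow> 'a \<Rightarrow> real"
  where "qf X x = Re (cinner (X \<cdot> x) x)"

text \<open>Self-adjointness is required separately because \<open>qf\<close> sees only the real
  part of the form; agreement with \<open>positive_op\<close> is
  \<open>positive_op_Rep_bop\<close>.\<close>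

definition pos :: "'a::complex_hilbert_space bop \<Rightarrow> bool"
  where "pos X \<longleftrightarrow> adj X = X \<and> (\<forall>x. 0 \<le> qf X x)"

lemma qf_simps:
  "qf (X + Y) x = qf X x + qf Y x" "qf (X - Y) x = qf X x - qf Y x"
  "qf (r *\<^sub>R X) x = r * qf X x" "qf 1 x = (norm x)\<^sup>2" "qf 0 x = 0"
  by (simp_all add: qf_def ap_plus ap_sub ap_scaleR_left cinner_add_left cinner_diff_left
      cinner_scaleR_left Re_cinner_self)

lemma qf_sum: "qf (sum f I) x = (\<Sum>i\<in>I. qf (f i) x)"
  by (induction I rule: infinite_finite_induct) (simp_all add: qf_simps)

lemma abs_qf_le: "\<bar>qf X x\<bar> \<le> norm X * (norm x)\<^sup>2"
proof -
  have "\<bar>qf X x\<bar> \<le> norm (X \<cdot> x) * norm x"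
    unfolding qf_def using abs_Re_le_cmod cmod_cinner_le order.trans by blast
  also have "\<dots> \<le> norm X * norm x * norm x" by (intro mult_right_mono norm_ap) simp
  finally show ?thesis by (simp add: power2_eq_square)
qed

lemma qf_adj_mult: "qf (adj X * X) x = (norm (X \<cdot> x))\<^sup>2"
  by (simp add: qf_def cinner_adj' Re_cinner_self)

lemma qf_adj_mult_middle: "qf (adj X * (Y * X)) x = qf Y (X \<cdot> x)"
  by (simp add: qf_def cinner_adj')

lemma pos_adj_mult: "pos (adj X * X)"
  by (simp add: pos_def adj_mult qf_adj_mult)

lemma pos_add: "pos X \<Longrightarrow> pos Y \<Longrightarrow> pos (X + Y)"
  and pos_scaleR: "0 \<le> r \<Longrightarrow> pos X \<Longrightarrow> pos (r *\<^sub>R X)"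
  and pos_0 [simp]: "pos 0"
  and pos_1 [simp]: "pos 1"
  by (simp_all add: pos_def adj_add adj_scaleR qf_simps)

lemma pos_sum: "(\<And>i. i \<in> I \<Longrightarrow> pos (f i)) \<Longrightarrow> pos (sum f I)"
  by (induction I rule: infinite_finite_induct) (simp_all add: pos_add)

lemma posD_adj: "pos X \<Longrightarrow> adj X = X" and posD_qf: "pos X \<Longrightarrow> 0 \<le> qf X x"
  by (auto simp: pos_def)

lemma tendsto_qf [tendsto_intros]: "(X \<longlongrightarrow> Y) G \<Longrightarrow> ((\<lambda>n. qf (X n) x) \<longlongrightarrow> qf Y x) G"
  unfolding qf_def by (intro tendsto_intros)

lemma tendsto_adj [tendsto_intros]: "(X \<longlongrightarrow> Y) G \<Longrightarrow> ((\<lambda>n. adj (X n)) \<longlongrightarrow> adj Y) G"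
  by (rule bounded_linear.tendsto[OF bounded_linear_adj])

lemma pos_tendsto:
  assumes "X \<longlonglongrightarrow> Y" "\<forall>\<^sub>F n in sequentially. pos (X n)"
  shows "pos Y"
  unfolding pos_def
proof (intro conjI allI)
  have "\<forall>\<^sub>F n in sequentially. adj (X n) = X n"
    using assms(2) by eventually_elim (simp add: pos_def)
  from Lim_transform_eventually[OF tendsto_adj[OF assms(1)] this]
  show "adj Y = Y" using assms(1) LIMSEQ_unique by blast
  fix x
  have "\<forall>\<^sub>F n in sequentially. 0 \<le> qf (X n) x"
    using assms(2) by eventually_elim (simp add: pos_def)
  thus "0 \<le> qf Y x"
    using tendsto_lowerbound[OF tendsto_qf[OF assms(1)]] by simp
qed

text \<open>Polarisation expresses \<open>Re (cinner (K \<cdot> x) y)\<close> through the form at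
  \<open>x + y\<close> and \<open>x - y\<close>, and the parallelogram law bounds the sum. The
  vector \<open>y\<close> is \<open>K \<cdot> x\<close> rescaled to the norm of
  \<open>x\<close>.\<close>

lemma norm_le_qf:
  assumes K: "adj K = K" and c: "0 \<le> c" "\<And>x. \<bar>qf K x\<bar> \<le> c * (norm x)\<^sup>2"
  shows "norm K \<le> c"
proof (rule norm_bop_le)
  fix x
  show "norm (K \<cdot> x) \<le> c * norm x"
  proof (cases "K \<cdot> x = 0 \<or> x = 0")
    case False
    define r where "r = norm x / norm (K \<cdot> x)"
    define y where "y = r *\<^sub>R (K \<cdot> x)"
    have r: "r > 0" using False by (simp add: r_def)
    have ny: "norm y = norm x" using False by (simp add: y_def r_def)
    have kyx: "Re (cinner (K \<cdot> y) x) = Re (cinner (K \<cdot> x) y)"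
      by (metis K Re_cinner_commute cinner_adj)
    have "4 * Re (cinner (K \<cdot> x) y) = qf K (x + y) - qf K (x - y)"
      unfolding qf_def ap_add ap_diff
      by (simp add: cinner_add_left cinner_add_right cinner_diff_left cinner_diff_right kyx)
    also have "\<dots> \<le> c * (norm (x + y))\<^sup>2 + c * (norm (x - y))\<^sup>2"
      using c(2)[of "x + y"] c(2)[of "x - y"] by linarith
    also have "\<dots> = 4 * c * (norm x)\<^sup>2"
      unfolding norm_add_square norm_diff_square ny by (simp add: algebra_simps)
    finally have "Re (cinner (K \<cdot> x) y) \<le> c * (norm x)\<^sup>2" by simp
    moreover have "Re (cinner (K \<cdot> x) y) = r * (norm (K \<cdot> x))\<^sup>2"
      by (simp add: y_def cinner_scaleR_right Re_cinner_self)
    moreover have "\<dots> = norm x * norm (K \<cdot> x)"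
      using False by (simp add: r_def power2_eq_square)
    ultimately have "norm x * norm (K \<cdot> x) \<le> c * (norm x)\<^sup>2" by linarith
    hence "norm x * norm (K \<cdot> x) \<le> norm x * (c * norm x)"
      by (simp add: power2_eq_square mult_ac)
    thus ?thesis using False by simp
  qed (use c(1) in auto)
qed fact

text \<open>A real-valued form forces self-adjointness: compare its values at \<open>x + y\<close>
  and at \<open>x + \<i> *\<^sub>C y\<close>.\<close>

lemma positive_op_Rep_bop: "positive_op (Rep_bop X) \<longleftrightarrow> pos X"
proof
  assume "positive_op (Rep_bop X)"
  hence p: "cinner (X \<cdot> x) x \<in> \<real>\<^sub>\<ge>\<^sub>0" for x by (simp add: positive_op_def Rep_bop_apply)
  hence re: "cinner (X \<cdot> x) x = cinner x (X \<cdot> x)" for x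
    by (metis cinner_commute complex_cnj_complex_of_real nonneg_Reals_cases)
  have "cinner (X \<cdot> x) y = cinner x (X \<cdot> y)" for x y
  proof -
    have 1: "cinner (X \<cdot> x) y + cinner (X \<cdot> y) x = cinner x (X \<cdot> y) + cinner y (X \<cdot> x)"
      using re[of "x + y"] by (simp add: ap_add cinner_add_left cinner_add_right re algebra_simps)
    have 2: "- \<i> * cinner (X \<cdot> x) y + \<i> * cinner (X \<cdot> y) x
        = - \<i> * cinner x (X \<cdot> y) + \<i> * cinner y (X \<cdot> x)"
      using re[of "x + \<i> *\<^sub>C y"]
      by (simp add: ap_add cinner_add_left cinner_add_right ap_scaleC cinner_scaleC_left
          cinner_scaleC_right re algebra_simps)
    hence "\<i> * (cinner (X \<cdot> y) x - cinner (X \<cdot> x) y) = \<i> * (cinner y (X \<cdot> x) - cinner x (X \<cdot> y))"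
      by (simp add: algebra_simps)
    hence "cinner (X \<cdot> y) x - cinner (X \<cdot> x) y = cinner y (X \<cdot> x) - cinner x (X \<cdot> y)"
      by (simp del: mult_cancel_left add: mult_left_cancel)
    with 1 show ?thesis by (simp add: algebra_simps) algebra
  qed
  hence "adj X = X" by (rule adj_eqI)
  moreover have "0 \<le> qf X x" for x
    using p[of x] by (auto simp: qf_def complex_nonneg_Reals_iff)
  ultimately show "pos X" by (simp add: pos_def)
next
  assume p: "pos X"
  have "cinner (X \<cdot> x) x \<in> \<real>\<^sub>\<ge>\<^sub>0" for x
  proof -
    have "cinner (X \<cdot> x) x = cnj (cinner (X \<cdot> x) x)"
      by (metis cinner_adj cinner_commute p pos_def)
    from arg_cong[OF this, of Im] have "Im (cinner (X \<cdot> x) x) = 0" by simp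
    thus ?thesis using posD_qf[OF p, of x] by (simp add: complex_nonneg_Reals_iff qf_def)
  qed
  thus "positive_op (Rep_bop X)" by (simp add: positive_op_def Rep_bop_apply)
qed

section \<open>Binomial series and existence of roots\<close>

text \<open>Consecutive coefficients have ratio \<open>(a - j) / (j + 1)\<close>, which is
  nonpositive from \<open>j = 1\<close> on. Knowing the signs lets the absolute values be summed in
  closed form below.\<close>

lemma gbinomial_alternating:
  fixes a :: real
  assumes "0 \<le> a" "a \<le> 1"
  shows "(-1) ^ k * (a gchoose Suc k) \<ge> 0"
proof (induction k)
  case (Suc k)
  have "(a gchoose Suc (Suc k)) * real (Suc (Suc k)) = (a - Suc k) * (a gchoose Suc k)"
    using gbinomial_mult_1[of a "Suc k"] by (simp add: algebra_simps)
  hence *: "(a gchoose Suc (Suc k)) = - ((Suc k - a) / Suc (Suc k)) * (a gchoose Suc k)"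
    by (simp add: field_simps)
  have "(-1) ^ Suc k * (a gchoose Suc (Suc k))
      = ((Suc k - a) / Suc (Suc k)) * ((-1) ^ k * (a gchoose Suc k))"
    unfolding * by simp
  moreover have "(Suc k - a) / Suc (Suc k) \<ge> 0" using assms by simp
  ultimately show ?case using Suc by (metis mult_nonneg_nonneg)
qed (use assms in simp)

text \<open>
  For \<open>0 \<le> x < 1\<close> the sum of \<open>\<bar>a gchoose k\<bar> x ^ k\<close> over \<open>k \<ge> 1\<close> is \<open>1 - (1 - x) powr a \<le> 1\<close>; let \<open>x\<close> tend
  to \<open>1\<close>.
\<close>

lemma gbinomial_sum_le_1:
  fixes a :: real
  assumes "0 \<le> a" "a \<le> 1"
  shows "(\<Sum>k<N. \<bar>a gchoose Suc k\<bar>) \<le> 1"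
proof (rule tendsto_upperbound)
  have c: "isCont (\<lambda>x::real. \<Sum>k<N. \<bar>a gchoose Suc k\<bar> * x ^ Suc k) 1"
    by (intro continuous_intros)
  show "((\<lambda>x::real. \<Sum>k<N. \<bar>a gchoose Suc k\<bar> * x ^ Suc k) \<longlongrightarrow> (\<Sum>k<N. \<bar>a gchoose Suc k\<bar>)) (at_left 1)"
    using tendsto_within_subset[OF c[unfolded isCont_def], of "{..<1}"] by simp
  have "(\<Sum>k<N. \<bar>a gchoose Suc k\<bar> * x ^ Suc k) \<le> 1" if x: "0 < x" "x < 1" for x :: real
  proof -
    have abs: "\<bar>a gchoose Suc k\<bar> = - ((-1) ^ Suc k * (a gchoose Suc k))" for k
      using gbinomial_alternating[OF assms, of k] abs_of_nonneg[of "(-1) ^ k * (a gchoose Suc k)"]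
      by (simp add: abs_mult)
    have "(\<lambda>n. (a gchoose n) * (- x) ^ n) sums (1 + (- x)) powr a"
      by (rule gen_binomial_real) (use x in simp)
    hence "(\<lambda>n. (a gchoose Suc n) * (- x) ^ Suc n) sums ((1 - x) powr a - 1)"
      by (subst sums_Suc_iff) simp
    from sums_minus[OF this]
    have s: "(\<lambda>n. \<bar>a gchoose Suc n\<bar> * x ^ Suc n) sums (1 - (1 - x) powr a)"
      unfolding abs power_minus[of x] by (simp add: mult_ac)
    have "(\<Sum>k<N. \<bar>a gchoose Suc k\<bar> * x ^ Suc k) \<le> (\<Sum>k. \<bar>a gchoose Suc k\<bar> * x ^ Suc k)"
      by (rule sum_le_suminf) (use s x in \<open>auto simp: sums_iff\<close>)
    also have "\<dots> \<le> 1" using s by (simp add: sums_iff)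
    finally show ?thesis .
  qed
  thus "\<forall>\<^sub>F x in at_left 1. (\<Sum>k<N. \<bar>a gchoose Suc k\<bar> * x ^ Suc k) \<le> (1::real)"
    by (intro eventually_at_leftI[of 0]) auto
qed simp

text \<open>A power series calculus for contractions: identities between formal series with
  absolutely summable coefficients become identities between operators. It is applied to the
  \<open>n\<close>-th power of the binomial series with exponent \<open>1 / n\<close>, which is
  \<open>1 + fps_X\<close>.\<close>

definition fps_op :: "real fps \<Rightarrow> 'a::complex_hilbert_space bop \<Rightarrow> 'a bop"
  where "fps_op F Z = (\<Sum>k. fps_nth F k *\<^sub>R Z ^ k)"

lemma summable_norm_fps_op:
  fixes Z :: "'a::complex_hilbert_space bop"
  assumes "norm Z \<le> 1" "summable (\<lambda>k. \<bar>fps_nth F k\<bar>)"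
  shows "summable (\<lambda>k. norm (fps_nth F k *\<^sub>R Z ^ k))"
proof (rule summable_comparison_test'[OF assms(2)])
  fix k
  have "norm (Z ^ k) \<le> 1"
    using norm_power_bop'[of Z k] power_le_one[OF norm_ge_zero assms(1), of k] by linarith
  thus "norm (norm (fps_nth F k *\<^sub>R Z ^ k)) \<le> \<bar>fps_nth F k\<bar>"
    by (simp add: mult_left_le)
qed

lemma fps_op_mult:
  fixes Z :: "'a::complex_hilbert_space bop"
  assumes Z: "norm Z \<le> 1" and F: "summable (\<lambda>k. \<bar>fps_nth F k\<bar>)" and G: "summable (\<lambda>k. \<bar>fps_nth G k\<bar>)"
  shows "summable (\<lambda>k. \<bar>fps_nth (F * G) k\<bar>)" "fps_op (F * G) Z = fps_op F Z * fps_op G Z"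
proof -
  have "summable (\<lambda>k. \<Sum>i\<le>k. \<bar>fps_nth F i\<bar> * \<bar>fps_nth G (k - i)\<bar>)"
    by (rule summable_Cauchy_product) (use F G in simp_all)
  thus "summable (\<lambda>k. \<bar>fps_nth (F * G) k\<bar>)"
  proof (rule summable_comparison_test')
    show "norm \<bar>fps_nth (F * G) k\<bar> \<le> (\<Sum>i\<le>k. \<bar>fps_nth F i\<bar> * \<bar>fps_nth G (k - i)\<bar>)" for k
      unfolding fps_mult_nth by (simp add: atLeast0AtMost abs_mult[symmetric] sum_abs)
  qed
  have "fps_op F Z * fps_op G Z
      = (\<Sum>k. \<Sum>i\<le>k. (fps_nth F i *\<^sub>R Z ^ i) * (fps_nth G (k - i) *\<^sub>R Z ^ (k - i)))"
    unfolding fps_op_def by (intro Cauchy_product summable_norm_fps_op Z F G)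
  also have "(\<lambda>k. \<Sum>i\<le>k. (fps_nth F i *\<^sub>R Z ^ i) * (fps_nth G (k - i) *\<^sub>R Z ^ (k - i)))
      = (\<lambda>k. fps_nth (F * G) k *\<^sub>R Z ^ k)"
    by (rule ext) (simp add: fps_mult_nth atLeast0AtMost scaleR_sum_left power_add[symmetric] mult.commute)
  finally show "fps_op (F * G) Z = fps_op F Z * fps_op G Z" by (simp add: fps_op_def)
qed

lemma fps_op_1: "fps_op 1 Z = 1"
  unfolding fps_op_def by (subst suminf_finite[of "{0}"]) auto

lemma fps_op_power:
  fixes Z :: "'a::complex_hilbert_space bop"
  assumes Z: "norm Z \<le> 1" and F: "summable (\<lambda>k. \<bar>fps_nth F k\<bar>)"
  shows "summable (\<lambda>k. \<bar>fps_nth (F ^ n) k\<bar>) \<and> fps_op (F ^ n) Z = fps_op F Z ^ n"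
proof (induction n)
  case 0
  have "summable (\<lambda>k. \<bar>fps_nth 1 k\<bar> :: real)"
    by (rule summable_finite[of "{0}"]) auto
  thus ?case by (simp add: fps_op_1)
next
  case (Suc n)
  thus ?case using fps_op_mult[OF Z F, of "F ^ n"] by simp
qed

text \<open>The binomial series for \<open>(1 + Z)\<close> to the power \<open>1 / n\<close>
  converges absolutely even for \<open>norm Z = 1\<close>, because its coefficients are summable.
  Its partial sums are polynomials in \<open>Z\<close>, whence the commutation property.\<close>

lemma nth_root_exists_contraction:
  fixes Z :: "'a::complex_hilbert_space bop"
  assumes Z: "norm Z \<le> 1" "adj Z = Z" and n: "n \<ge> 1"
  shows "\<exists>S. pos S \<and> S ^ n = 1 + Z \<and> (\<forall>Y. Y * Z = Z * Y \<longrightarrow> Y * S = S * Y)"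
proof (intro exI conjI allI impI)
  define a where "a = 1 / real n"
  have a: "0 \<le> a" "a \<le> 1" using n by (auto simp: a_def)
  define c where "c k = (a gchoose k)" for k
  define S where "S = fps_op (fps_binomial a) Z"
  have sc: "summable (\<lambda>k. \<bar>c (Suc k)\<bar>)" and sc1: "(\<Sum>k. \<bar>c (Suc k)\<bar>) \<le> 1"
  proof -
    show s: "summable (\<lambda>k. \<bar>c (Suc k)\<bar>)"
      by (rule bounded_imp_summable[of _ 1])
         (use gbinomial_sum_le_1[OF a, of "Suc _"] in \<open>auto simp: c_def lessThan_Suc_atMost\<close>)
    show "(\<Sum>k. \<bar>c (Suc k)\<bar>) \<le> 1"
      by (rule suminf_le_const[OF s]) (use gbinomial_sum_le_1[OF a] in \<open>auto simp: c_def\<close>)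
  qed
  have sF: "summable (\<lambda>k. \<bar>fps_nth (fps_binomial a) k\<bar>)"
    using sc by (subst summable_Suc_iff[symmetric]) (simp add: c_def)
  have sn: "summable (\<lambda>k. norm (c k *\<^sub>R Z ^ k))"
    using summable_norm_fps_op[OF Z(1) sF] by (simp add: c_def)
  hence sz: "summable (\<lambda>k. c k *\<^sub>R Z ^ k)" by (rule summable_norm_cancel)
  have S: "S = (\<Sum>k. c k *\<^sub>R Z ^ k)" by (simp add: S_def fps_op_def c_def)
  have "S ^ n = fps_op (fps_binomial a ^ n) Z"
    using fps_op_power[OF Z(1) sF] by (simp add: S_def)
  also have "fps_binomial a ^ n = 1 + fps_X"
    unfolding fps_binomial_power using n by (simp add: a_def fps_binomial_1)
  also have "fps_op (1 + fps_X) Z = 1 + Z"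
    unfolding fps_op_def by (subst suminf_finite[of "{0, 1}"]) auto
  finally show "S ^ n = 1 + Z" .
  show "Y * S = S * Y" if "Y * Z = Z * Y" for Y
    unfolding S bounded_linear.suminf[OF bounded_linear_mult_right sz]
      bounded_linear.suminf[OF bounded_linear_mult_left sz]
    using commute_power[OF that] by simp
  have "adj S = S"
    unfolding S bounded_linear.suminf[OF bounded_linear_adj sz]
    by (simp add: adj_scaleR adj_power Z)
  moreover have "0 \<le> qf S x" for x
  proof -
    \<comment> \<open>Positivity: the constant coefficient is 1 and the remaining series
      \<open>R\<close> has norm at most 1.\<close>
    define R where "R = (\<Sum>k. c (Suc k) *\<^sub>R Z ^ Suc k)"
    have "S = R + c 0 *\<^sub>R Z ^ 0"
      unfolding S R_def using suminf_split_head[OF sz] by simp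
    hence SR: "S = R + 1" by (simp add: c_def)
    have sn': "summable (\<lambda>k. norm (c (Suc k) *\<^sub>R Z ^ Suc k))"
      using sn by (subst summable_Suc_iff)
    have "norm R \<le> (\<Sum>k. norm (c (Suc k) *\<^sub>R Z ^ Suc k))"
      unfolding R_def by (rule summable_norm[OF sn'])
    also have "\<dots> \<le> (\<Sum>k. \<bar>c (Suc k)\<bar>)"
    proof (rule suminf_le[OF _ sn' sc])
      fix k
      have "norm (Z ^ Suc k) \<le> 1"
        using norm_power_bop'[of Z "Suc k"] power_le_one[OF norm_ge_zero Z(1), of "Suc k"] by linarith
      thus "norm (c (Suc k) *\<^sub>R Z ^ Suc k) \<le> \<bar>c (Suc k)\<bar>" by (simp add: mult_left_le)
    qed
    also have "\<dots> \<le> 1" by (rule sc1)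
    finally have "norm R * (norm x)\<^sup>2 \<le> 1 * (norm x)\<^sup>2" by (intro mult_right_mono) auto
    with abs_qf_le[of R x] show ?thesis unfolding SR qf_simps by linarith
  qed
  ultimately show "pos S" by (simp add: pos_def)
qed

lemma scaleR_power_bop: "(r *\<^sub>R X) ^ n = r ^ n *\<^sub>R X ^ n" for X :: "'a::complex_hilbert_space bop"
  by (induction n) simp_all

lemma nth_root_exists:
  assumes T: "pos T" and n: "n \<ge> 1"
  shows "\<exists>S. pos S \<and> S ^ n = T \<and> (\<forall>Y. Y * T = T * Y \<longrightarrow> Y * S = S * Y)"
proof (cases "T = 0")
  case True
  thus ?thesis using n by (intro exI[of _ 0]) (cases n, auto)
next
  case False
  define t where "t = norm T"
  have t: "t > 0" using False by (simp add: t_def)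
  \<comment> \<open>After division by its norm, \<open>T\<close> has its form between 0 and that of
    the identity, so \<open>Z\<close> has its form between -1 and 0 times the square of the norm and
    is a contraction.\<close>
  define Z where "Z = (1 / t) *\<^sub>R T - 1"
  have aZ: "adj Z = Z" using T by (simp add: Z_def adj_diff adj_scaleR pos_def)
  have "norm Z \<le> 1"
  proof (rule norm_le_qf[OF aZ])
    fix x
    have "0 \<le> qf T x / t" using T t by (simp add: pos_def)
    moreover have "qf T x / t \<le> (norm x)\<^sup>2"
      using abs_qf_le[of T x] t by (simp add: t_def field_simps)
    ultimately show "\<bar>qf Z x\<bar> \<le> 1 * (norm x)\<^sup>2" by (simp add: Z_def qf_simps)
  qed simp
  from nth_root_exists_contraction[OF this aZ n] obtain S where
    S: "pos S" "S ^ n = 1 + Z" "\<And>Y. Y * Z = Z * Y \<Longrightarrow> Y * S = S * Y" by blast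
  show ?thesis
  proof (intro exI conjI allI impI)
    show "pos (root n t *\<^sub>R S)" using t S(1) by (intro pos_scaleR real_root_ge_zero) auto
    show "(root n t *\<^sub>R S) ^ n = T"
      unfolding scaleR_power_bop S(2) using t n by (simp add: Z_def)
    fix Y assume "Y * T = T * Y"
    hence "Y * Z = Z * Y" by (simp add: Z_def right_diff_distrib left_diff_distrib)
    from S(3)[OF this] show "Y * (root n t *\<^sub>R S) = root n t *\<^sub>R S * Y"
      by (simp only: mult_scaleR_left mult_scaleR_right)
  qed
qed

lemma pos_sqrt_obtain:
  assumes "pos T"
  obtains S where "pos S" "S * S = T" "\<And>Y. Y * T = T * Y \<Longrightarrow> Y * S = S * Y"
  using nth_root_exists[OF assms, of 2, unfolded power2_eq_square] one_le_numeral by blast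

text \<open>The root \<open>S\<close> of \<open>X\<close> also commutes with \<open>Y\<close>, so
  the product is \<open>S * Y * S\<close>, whose form is that of \<open>Y\<close> at
  \<open>S \<cdot> x\<close>.\<close>

lemma pos_mult:
  assumes X: "pos X" and Y: "pos Y" and c: "X * Y = Y * X"
  shows "pos (X * Y)"
proof -
  obtain S where S: "pos S" "S * S = X" "\<And>Z. Z * X = X * Z \<Longrightarrow> Z * S = S * Z"
    using pos_sqrt_obtain[OF X] by blast
  have "X * Y = S * (S * Y)" by (simp only: S(2)[symmetric] mult.assoc)
  also have "\<dots> = adj S * (Y * S)" using S(3)[OF c[symmetric]] posD_adj[OF S(1)] by simp
  finally have "X * Y = adj S * (Y * S)" .
  hence "qf (X * Y) x = qf Y (S \<cdot> x)" for x by (simp only: qf_adj_mult_middle)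
  thus ?thesis using X Y c by (simp add: pos_def adj_mult)
qed

lemma pos_power: "pos X \<Longrightarrow> pos (X ^ n)"
  by (induction n) (auto intro: pos_mult simp: power_commutes)

section \<open>Inverses by Neumann series\<close>

lemma Neumann_inverse:
  fixes Z :: "'a::complex_hilbert_space bop"
  assumes "norm Z < 1"
  shows "\<exists>W. W * (1 - Z) = 1 \<and> (1 - Z) * W = 1"
proof (intro exI conjI)
  have "summable (\<lambda>k. norm (Z ^ k))"
    by (rule summable_comparison_test'[OF summable_geometric[of "norm Z"]])
       (use assms norm_power_bop' in auto)
  hence s: "summable (\<lambda>k. Z ^ k)" by (rule summable_norm_cancel)
  have h: "(\<Sum>k. Z ^ Suc k) = (\<Sum>k. Z ^ k) - 1"
    using suminf_split_head[OF s] by simp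
  have "(\<Sum>k. Z ^ k) * Z = (\<Sum>k. Z ^ Suc k)"
    unfolding bounded_linear.suminf[OF bounded_linear_mult_left s] by (simp add: power_commutes)
  thus "(\<Sum>k. Z ^ k) * (1 - Z) = 1" by (simp only: right_diff_distrib h) simp
  have "Z * (\<Sum>k. Z ^ k) = (\<Sum>k. Z ^ Suc k)"
    unfolding bounded_linear.suminf[OF bounded_linear_mult_right s] by simp
  thus "(1 - Z) * (\<Sum>k. Z ^ k) = 1" by (simp only: left_diff_distrib h) simp
qed

lemma pos_bounded_below_inverse:
  assumes Y: "adj Y = Y" and d: "0 < d" "\<And>x. d * (norm x)\<^sup>2 \<le> qf Y x"
  shows "\<exists>W. W * Y = 1 \<and> Y * W = 1"
proof -
  \<comment> \<open>The maximum with \<open>d\<close> keeps \<open>1 - d / t\<close> nonnegative on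
    the zero space too, where \<open>norm Y = 0\<close>.\<close>
  define t where "t = max (norm Y) d"
  have t: "t > 0" "d \<le> t" "norm Y \<le> t" using d by (auto simp: t_def)
  define Z where "Z = 1 - (1 / t) *\<^sub>R Y"
  have aZ: "adj Z = Z" using Y by (simp add: Z_def adj_diff adj_scaleR)
  have "norm Z \<le> 1 - d / t"
  proof (rule norm_le_qf[OF aZ])
    show "0 \<le> 1 - d / t" using t by simp
    fix x
    have "qf Y x \<le> t * (norm x)\<^sup>2"
      using abs_qf_le[of Y x] mult_right_mono[OF t(3), of "(norm x)\<^sup>2"] by simp
    hence "qf Y x / t \<le> (norm x)\<^sup>2" using t by (simp add: field_simps)
    moreover have "d / t * (norm x)\<^sup>2 \<le> qf Y x / t"
      using d(2)[of x] t by (simp add: field_simps)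
    ultimately show "\<bar>qf Z x\<bar> \<le> (1 - d / t) * (norm x)\<^sup>2"
      by (simp add: Z_def qf_simps algebra_simps)
  qed
  also have "1 - d / t < 1" using d t by simp
  finally obtain W where W: "W * (1 - Z) = 1" "(1 - Z) * W = 1" using Neumann_inverse by blast
  have "1 - Z = (1 / t) *\<^sub>R Y" by (simp add: Z_def)
  with W show ?thesis
    by (intro exI[of _ "(1 / t) *\<^sub>R W"]) simp
qed

section \<open>The Loewner--Heinz inequality\<close>

text \<open>For self-adjoint \<open>K\<close> the norm is the spectral radius, which similarity
  preserves. Directly: the powers \<open>2 ^ j\<close> of \<open>K\<close> have norm exactly
  \<open>norm K ^ (2 ^ j)\<close>, while the conjugation costs the same factor
  \<open>norm V * norm Q\<close> for every power, so \<open>norm K > norm Z\<close> is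
  impossible.\<close>

lemma selfadjoint_norm_le_similar:
  fixes K Z V Q :: "'a::complex_hilbert_space bop"
  assumes K: "adj K = K" "K = V * Z * Q" and QV: "Q * V = 1"
  shows "norm K \<le> norm Z"
proof (rule ccontr)
  assume "\<not> norm K \<le> norm Z"
  hence l: "norm Z < norm K" by simp
  have aK: "adj (K ^ n) = K ^ n" for n by (simp add: adj_power K(1))
  have n2: "norm (K ^ (2 ^ j)) = norm K ^ (2 ^ j)" for j
  proof (induction j)
    case (Suc j)
    have "K ^ (2 ^ Suc j) = adj (K ^ (2 ^ j)) * K ^ (2 ^ j)"
      unfolding aK by (simp add: power_add[symmetric] mult_2)
    hence "norm (K ^ (2 ^ Suc j)) = (norm (K ^ (2 ^ j)))\<^sup>2" by (simp only: norm_adj_mult_self)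
    thus ?case unfolding Suc by (simp add: power_mult[symmetric] mult.commute)
  qed simp
  have Kn: "K ^ Suc n = V * Z ^ Suc n * Q" for n
  proof (induction n)
    case (Suc n)
    have "K ^ Suc (Suc n) = (V * Z * Q) * (V * Z ^ Suc n * Q)"
      unfolding power_Suc[of K "Suc n"] Suc by (simp only: K(2)[symmetric])
    also have "\<dots> = V * Z * (Q * V) * Z ^ Suc n * Q" by (simp only: mult.assoc)
    finally show ?case by (simp add: QV mult.assoc)
  qed (use K(2) in simp)
  define C where "C = norm V * norm Q"
  have bnd: "norm K ^ (2 ^ j) \<le> C * norm Z ^ (2 ^ j)" for j
  proof -
    obtain n where n: "2 ^ j = Suc n" by (metis not0_implies_Suc power_not_zero zero_neq_numeral)
    have "norm (K ^ Suc n) \<le> norm V * norm (Z ^ Suc n) * norm Q"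
      unfolding Kn by (rule order.trans[OF norm_mult_ineq]) (intro mult_right_mono norm_mult_ineq norm_ge_zero)
    also have "\<dots> \<le> norm V * norm Z ^ Suc n * norm Q"
      by (intro mult_right_mono mult_left_mono norm_power_bop') auto
    finally have "norm (K ^ (2 ^ j)) \<le> C * norm Z ^ (2 ^ j)" unfolding n C_def by (simp add: mult_ac)
    thus ?thesis unfolding n2 .
  qed
  have Z: "norm Z > 0"
  proof (rule ccontr)
    assume "\<not> norm Z > 0"
    hence "norm K ^ (2 ^ 0) \<le> 0" using bnd[of 0] by simp
    with l show False by simp
  qed
  define q where "q = norm K / norm Z"
  have q: "q > 1" using l Z by (simp add: q_def)
  have qb: "q ^ (2 ^ j) \<le> C" for j
    using bnd[of j] Z by (simp add: q_def power_divide field_simps)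
  obtain n where "C < q ^ n" using real_arch_pow[OF q] by blast
  also have "q ^ n \<le> q ^ (2 ^ n)"
    using q less_exp[of n] by (intro power_increasing) auto
  finally show False using qb[of n] by simp
qed

text \<open>Under logarithmic convexity the ratios of consecutive terms do not decrease: a step up
  from \<open>g 0\<close> to \<open>g 1\<close> would keep the sequence above 1, also at
  \<open>m\<close>.\<close>

lemma log_convex_le_1:
  fixes g :: "nat \<Rightarrow> real"
  assumes g: "\<And>k. 0 \<le> g k" "g 0 \<le> 1" "\<And>k. (g (Suc k))\<^sup>2 \<le> g k * g (Suc (Suc k))" and m: "g m \<le> 1" "m \<ge> 1"
  shows "g 1 \<le> 1"
proof (rule ccontr)
  assume "\<not> g 1 \<le> 1"
  hence g1: "g 1 > 1" by simp
  have "g (Suc k) > 1 \<and> g k \<le> g (Suc k)" for k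
  proof (induction k)
    case (Suc k)
    have "(g (Suc k))\<^sup>2 \<le> g (Suc k) * g (Suc (Suc k))"
      using g(3)[of k] mult_right_mono[of "g k" "g (Suc k)" "g (Suc (Suc k))"] Suc g(1) by fastforce
    hence "g (Suc k) \<le> g (Suc (Suc k))" using Suc by (simp add: power2_eq_square)
    with Suc show ?case by simp
  qed (use g1 g(2) in auto)
  hence "g (Suc (m - 1)) > 1" by blast
  thus False using m by simp
qed

text \<open>
  With \<open>X = P\<^sup>2\<close>, \<open>Y = Q\<^sup>2\<close> and \<open>V\<close> the inverse of \<open>Q\<close>, the norms of \<open>P\<^sup>k V\<^sup>k\<close> are logarithmically convex in \<open>k\<close>;
  they are at most \<open>1\<close> for \<open>k = 0\<close> and \<open>k = m\<close>, hence for \<open>k = 1\<close>.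
\<close>

lemma Loewner_Heinz_invertible:
  assumes X: "pos X" and Y: "pos Y" and d: "0 < d" "\<And>x. d * (norm x)\<^sup>2 \<le> qf Y x"
    and m: "m \<ge> 1" and le: "\<And>x. qf (X ^ m) x \<le> qf (Y ^ m) x"
  shows "qf X x \<le> qf Y x"
proof -
  obtain P where P: "pos P" "P * P = X" using pos_sqrt_obtain[OF X] by blast
  obtain Q where Q: "pos Q" "Q * Q = Y" using pos_sqrt_obtain[OF Y] by blast
  obtain W where W: "W * Y = 1" "Y * W = 1"
    using pos_bounded_below_inverse[OF posD_adj[OF Y] d] by blast
  define V where "V = Q * W"
  have "W * Q = W * Q * (Y * W)" by (simp add: W)
  also have "\<dots> = W * Y * (Q * W)" by (simp add: Q(2)[symmetric] mult.assoc)
  finally have WQ: "W * Q = Q * W" by (simp add: W)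
  have QV: "Q * V = 1" by (simp add: V_def mult.assoc[symmetric] Q W)
  have VQ: "V * Q = 1" by (simp add: V_def mult.assoc WQ) (simp add: mult.assoc[symmetric] Q W)
  have aP: "adj P = P" and aQ: "adj Q = Q" using P Q by (auto simp: pos_def)
  have aV: "adj V = V"
  proof -
    have "adj V * Q = 1" using arg_cong[OF QV, of adj] by (simp add: adj_mult aQ)
    hence "adj V * (Q * V) = V" by (metis mult.assoc mult_1_left)
    thus ?thesis by (simp add: QV)
  qed
  have QVn: "Q ^ k * V ^ k = 1" for k
  proof (induction k)
    case (Suc k)
    have "Q ^ Suc k * V ^ Suc k = Q ^ k * (Q * V) * V ^ k"
      by (simp add: mult.assoc power_Suc2[of Q] del: power_Suc) (simp add: mult.assoc)
    thus ?case using Suc by (simp add: QV)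
  qed simp
  define g where "g k = norm (P ^ k * V ^ k)" for k
  have "g 1 \<le> 1"
  proof (rule log_convex_le_1[of g])
    show "0 \<le> g k" for k by (simp add: g_def)
    show "g 0 \<le> 1" by (simp add: g_def norm_one_bop)
    show "m \<ge> 1" by fact
    show "(g (Suc k))\<^sup>2 \<le> g k * g (Suc (Suc k))" for k
    proof -
      \<comment> \<open>Inserting \<open>V * Q = 1\<close> on the right and splitting a factor
        \<open>V\<close> off on the left exhibits \<open>adj B * B\<close> as a conjugate of
        \<open>Z\<close>, which pairs the exponents \<open>k\<close> and \<open>k + 2\<close>. This
        is the log-convexity.\<close>
      define B where "B = P ^ Suc k * V ^ Suc k"
      define Z where "Z = adj (P ^ k * V ^ k) * (P ^ Suc (Suc k) * V ^ Suc (Suc k))"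
      have pp: "P ^ Suc k * P ^ Suc k = P ^ k * P ^ Suc (Suc k)"
        by (simp only: power_add[symmetric]) simp
      have "adj B * B = V ^ Suc k * (P ^ Suc k * P ^ Suc k) * V ^ Suc k"
        by (simp only: B_def adj_mult adj_power aP aV mult.assoc)
      also have "\<dots> = V ^ Suc k * (P ^ k * P ^ Suc (Suc k)) * V ^ Suc k" by (simp only: pp)
      also have "\<dots> = V * V ^ k * (P ^ k * P ^ Suc (Suc k)) * (V ^ Suc k * (V * Q))"
        by (simp only: VQ power_Suc mult_1_right)
      also have "\<dots> = V * Z * Q"
        by (simp only: Z_def adj_mult adj_power aP aV mult.assoc power_Suc2[of V "Suc k"])
      finally have BZ: "adj B * B = V * Z * Q" .
      have "adj (adj B * B) = adj B * B" by (simp only: adj_mult adj_adj)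
      from selfadjoint_norm_le_similar[OF this BZ QV] have "norm (adj B * B) \<le> norm Z" .
      also have "\<dots> \<le> g k * g (Suc (Suc k))"
        unfolding Z_def g_def by (metis norm_mult_ineq norm_adj)
      finally show ?thesis by (simp add: norm_adj_mult_self B_def g_def)
    qed
    show "g m \<le> 1"
      unfolding g_def
    proof (rule norm_bop_le)
      fix x
      have xx: "(R ^ m) * (R ^ m) = (R * R) ^ m" for R :: "'a bop"
        by (simp add: power_add[symmetric] mult_2[symmetric] power_mult power2_eq_square)
      have sq: "(norm (R ^ m \<cdot> y))\<^sup>2 = qf ((R * R) ^ m) y" if "adj R = R" for R :: "'a bop" and y
        using qf_adj_mult[of "R ^ m" y] by (simp add: adj_power that xx)
      have "(norm ((P ^ m * V ^ m) \<cdot> x))\<^sup>2 = qf (X ^ m) (V ^ m \<cdot> x)"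
        by (simp add: sq[OF aP] P)
      also have "\<dots> \<le> qf (Y ^ m) (V ^ m \<cdot> x)" by (rule le)
      also have "\<dots> = (norm ((Q ^ m * V ^ m) \<cdot> x))\<^sup>2" by (simp add: sq[OF aQ] Q)
      also have "\<dots> = (norm x)\<^sup>2" by (simp only: QVn ap_1)
      finally show "norm ((P ^ m * V ^ m) \<cdot> x) \<le> 1 * norm x" using power2_le_imp_le by fastforce
    qed simp
  qed
  hence PV: "norm (P * V) \<le> 1" by (simp add: g_def)
  have "qf X x = (norm (P \<cdot> x))\<^sup>2" using qf_adj_mult[of P x] by (simp add: aP P)
  also have "P \<cdot> x = (P * V) \<cdot> (Q \<cdot> x)" using VQ by (metis ap_mult ap_1 mult.assoc)
  also have "(norm \<dots>)\<^sup>2 \<le> (norm (Q \<cdot> x))\<^sup>2"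
    using norm_ap[of "P * V" "Q \<cdot> x"] mult_right_mono[OF PV, of "norm (Q \<cdot> x)"]
    by (intro power_mono) auto
  also have "\<dots> = qf Y x" using qf_adj_mult[of Q x] by (simp add: aQ Q)
  finally show ?thesis .
qed

text \<open>Shows that replacing \<open>Y\<close> by \<open>Y + d\<close> in order to make it
  invertible preserves the hypothesis on \<open>m\<close>-th powers. All factors commute, so
  products of positive terms stay positive.\<close>

lemma qf_power_add_scalar_mono:
  assumes "pos Y" "0 \<le> d"
  shows "pos ((Y + d *\<^sub>R 1) ^ m - Y ^ m)"
proof (induction m)
  case (Suc m)
  define U where "U = Y + d *\<^sub>R 1"
  have U: "pos U" using assms by (simp add: U_def pos_add pos_scaleR)
  have UY: "U * Y = Y * U" by (simp add: U_def algebra_simps)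
  have "U ^ Suc m - Y ^ Suc m = Y * (U ^ m - Y ^ m) + d *\<^sub>R U ^ m"
    by (simp add: algebra_simps) (simp add: U_def algebra_simps)
  moreover have "Y * (U ^ m - Y ^ m) = (U ^ m - Y ^ m) * Y"
    using commute_power[OF UY[symmetric], of m] by (simp add: algebra_simps power_commutes)
  ultimately show ?case
    using Suc assms U by (auto simp: U_def[symmetric] intro!: pos_add pos_mult pos_scaleR pos_power)
qed simp

text \<open>Perturb \<open>Y\<close> to \<open>Y + d\<close>, which is bounded below, and let
  \<open>d\<close> tend to 0.\<close>

lemma Loewner_Heinz:
  assumes X: "pos X" and Y: "pos Y" and m: "m \<ge> 1"
    and le: "\<And>x. qf (X ^ m) x \<le> qf (Y ^ m) x"
  shows "qf X x \<le> qf Y x"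
proof -
  have "qf X x \<le> qf Y x + d * (norm x)\<^sup>2" if d: "d > 0" for d
  proof -
    have "qf X x \<le> qf (Y + d *\<^sub>R 1) x"
    proof (rule Loewner_Heinz_invertible[OF X _ d _ m])
      show "pos (Y + d *\<^sub>R 1)" using Y d by (intro pos_add pos_scaleR) auto
      show "d * (norm y)\<^sup>2 \<le> qf (Y + d *\<^sub>R 1) y" for y
        using posD_qf[OF Y, of y] by (simp add: qf_simps)
      show "qf (X ^ m) y \<le> qf ((Y + d *\<^sub>R 1) ^ m) y" for y
        using le[of y] posD_qf[OF qf_power_add_scalar_mono[OF Y], of d m y] d by (simp add: qf_simps)
    qed
    thus ?thesis by (simp add: qf_simps)
  qed
  note * = this
  show ?thesis
  proof (rule field_le_epsilon)
    fix e :: real assume e: "e > 0"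
    have "e / (1 + (norm x)\<^sup>2) * (norm x)\<^sup>2 \<le> e"
      using e by (simp add: field_simps add_pos_nonneg)
    thus "qf X x \<le> qf Y x + e"
      using *[of "e / (1 + (norm x)\<^sup>2)"] e by (simp add: add_pos_nonneg)
  qed
qed

lemma pos_root_unique:
  assumes "pos X" "pos Y" "m \<ge> 1" "X ^ m = Y ^ m"
  shows "X = Y"
proof -
  have "qf X x = qf Y x" for x
    using Loewner_Heinz[of X Y m x] Loewner_Heinz[of Y X m x] assms by simp
  hence "norm (X - Y) \<le> 0"
    using assms by (intro norm_le_qf) (auto simp: pos_def adj_diff qf_simps)
  thus ?thesis by simp
qed

lemma op_root_Rep_bop:
  assumes "pos S" "n \<ge> 1"
  shows "op_root n (Rep_bop (S ^ n)) = Rep_bop S"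
  unfolding op_root_def
proof (rule the_equality)
  show "positive_op (Rep_bop S) \<and> op_power (Rep_bop S) n = Rep_bop (S ^ n)"
    using assms by (simp add: positive_op_Rep_bop op_power_Rep_bop)
  fix R assume R: "positive_op R \<and> op_power R n = Rep_bop (S ^ n)"
  hence "R \<in> bounded_ops" by (simp add: positive_op_def)
  then obtain R' where R': "R = Rep_bop R'" by (metis Abs_bop_inverse)
  show "R = Rep_bop S"
    using R pos_root_unique[of R' S n] assms
    unfolding R' positive_op_Rep_bop op_power_Rep_bop Rep_bop_inject by simp
qed

text \<open>The exponent \<open>2 * n\<close> undoes both the \<open>n\<close>-th root and the
  square root in the absolute value. Positivity and this root-free identity are all that the
  convergence argument needs to know about the normalised powers.\<close>

lemma op_root_op_abs_obtain:
  assumes "n \<ge> 1"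
  obtains S where "pos S" "op_root n (op_abs (Rep_bop X)) = Rep_bop S" "S ^ (2 * n) = adj X * X"
proof -
  obtain R where R: "pos R" "R ^ 2 = adj X * X"
    using nth_root_exists[OF pos_adj_mult[of X], of 2] by auto
  obtain S where S: "pos S" "S ^ n = R" using nth_root_exists[OF R(1) assms] by blast
  have "op_abs (Rep_bop X) = Rep_bop R"
    unfolding op_abs_def adjoint_op_Rep_bop times_bop.rep_eq[symmetric] R(2)[symmetric]
    by (rule op_root_Rep_bop) (use R in auto)
  hence "op_root n (op_abs (Rep_bop X)) = Rep_bop S"
    using op_root_Rep_bop[OF S(1) assms] S(2) by simp
  moreover have "S ^ (2 * n) = adj X * X"
    using R(2) S(2) by (simp add: power_mult mult.commute[of 2])
  ultimately show ?thesis using that S(1) by blast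
qed

section \<open>Growth of powers on spectral subspaces\<close>

lemma norm_mult_inverse_less_1: "1 / (norm x + 1) * norm x < (1::real)"
proof -
  have "norm x + 1 > 0" using norm_ge_zero[of x] by linarith
  thus ?thesis by (simp add: divide_less_eq)
qed

text \<open>For \<open>X\<close> commuting with the idempotent \<open>P\<close>, this is the inverse
  of \<open>X\<close> on the range of \<open>P\<close>, extended by 0 on the kernel. Restricted
  resolvents thus stay in the algebra of operators on the whole space.\<close>

definition corner_inverse :: "'a::complex_hilbert_space bop \<Rightarrow> 'a bop \<Rightarrow> 'a bop \<Rightarrow> bool"
  where "corner_inverse P X S \<longleftrightarrow> P * S = S \<and> S * P = S \<and> S * X = P \<and> X * S = P"

lemma scalar_op_mult_mult:
  "(scalar_op c * X) * (scalar_op d * Y) = scalar_op (c * d) * (X * Y)"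
  by (rule bop_eqI) (simp add: ap_scaleC scaleC_scaleC mult.commute)

lemma corner_inverse_scalar_mult:
  assumes "corner_inverse P X S" "c \<noteq> 0"
  shows "corner_inverse P (scalar_op c * X) (scalar_op (1 / c) * S)"
  using assms scalar_op_left_commute[of P "1 / c" S]
  by (simp add: corner_inverse_def scalar_op_mult_mult) (simp add: mult.assoc)

text \<open>The inverse \<open>f\<close> provided by \<open>spectrum_on\<close> is meaningful only
  on the range of \<open>P\<close>; precomposing it with \<open>P\<close> gives a bounded operator
  on the whole space.\<close>

lemma corner_inverse_notin_spectrum_on:
  fixes A P :: "'a::complex_hilbert_space bop"
  assumes P: "P * P = P" "A * P = P * A" and z: "z \<notin> spectrum_on (range (ap P)) (Rep_bop A)"
  shows "\<exists>S. corner_inverse P (A - scalar_op z) S"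
proof -
  obtain f where fV: "f ` range (ap P) \<subseteq> range (ap P)" and f: "bounded_clinear_on (range (ap P)) f"
    and inv: "\<And>x. f (A \<cdot> (P \<cdot> x) - z *\<^sub>C (P \<cdot> x)) = P \<cdot> x"
      "\<And>x. A \<cdot> f (P \<cdot> x) - z *\<^sub>C f (P \<cdot> x) = P \<cdot> x"
    using z unfolding spectrum_on_def Rep_bop_apply by auto
  obtain K where K: "\<And>x. norm (f (P \<cdot> x)) \<le> K * norm (P \<cdot> x)"
    using f unfolding bounded_clinear_on_def by blast
  have add: "f (P \<cdot> x + P \<cdot> y) = f (P \<cdot> x) + f (P \<cdot> y)" and scale: "f (c *\<^sub>C (P \<cdot> x)) = c *\<^sub>C f (P \<cdot> x)"
    for x y c
    using f unfolding bounded_clinear_on_def by blast+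
  have "bounded_linear (\<lambda>x. f (P \<cdot> x))"
  proof (rule bounded_linear_intro[where K = "\<bar>K\<bar> * norm P"])
    show "f (P \<cdot> (x + y)) = f (P \<cdot> x) + f (P \<cdot> y)" for x y by (simp add: ap_add add)
    show "f (P \<cdot> (r *\<^sub>R x)) = r *\<^sub>R f (P \<cdot> x)" for r x
      by (simp add: scaleR_scaleC ap_scaleC scale)
    show "norm (f (P \<cdot> x)) \<le> norm x * (\<bar>K\<bar> * norm P)" for x
    proof -
      have "norm (f (P \<cdot> x)) \<le> \<bar>K\<bar> * norm (P \<cdot> x)"
        by (rule order.trans[OF K mult_right_mono]) auto
      also have "\<dots> \<le> \<bar>K\<bar> * (norm P * norm x)" by (intro mult_left_mono norm_ap) auto
      finally show ?thesis by (simp add: mult_ac)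
    qed
  qed
  moreover have "f (P \<cdot> (c *\<^sub>C x)) = c *\<^sub>C f (P \<cdot> x)" for c x by (simp add: ap_scaleC scale)
  ultimately obtain S where S: "\<And>x. S \<cdot> x = f (P \<cdot> x)" using bop_exists by blast
  have PP: "P \<cdot> (P \<cdot> x) = P \<cdot> x" for x by (metis P(1) ap_mult)
  have AP: "P \<cdot> (A \<cdot> x) = A \<cdot> (P \<cdot> x)" for x by (metis P(2) ap_mult)
  have "P \<cdot> f (P \<cdot> x) = f (P \<cdot> x)" for x
  proof -
    obtain y where "f (P \<cdot> x) = P \<cdot> y" using fV by blast
    thus ?thesis by (simp add: PP)
  qed
  moreover have "S \<cdot> (A \<cdot> x - z *\<^sub>C x) = P \<cdot> x" for x
    unfolding S using inv(1)[of x] by (simp add: ap_diff ap_scaleC AP)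
  ultimately show ?thesis
    unfolding corner_inverse_def
    by (intro exI[of _ S] conjI bop_eqI) (simp_all add: S PP ap_sub inv)
qed

lemma notin_spectrum_iff:
  "z \<notin> spectrum (Rep_bop A) \<longleftrightarrow> (\<exists>S. S * (A - scalar_op z) = 1 \<and> (A - scalar_op z) * S = 1)"
proof
  assume "z \<notin> spectrum (Rep_bop A)"
  hence "z \<notin> spectrum_on (range (ap 1)) (Rep_bop A)" by (simp add: spectrum_def)
  from corner_inverse_notin_spectrum_on[OF _ _ this]
  show "\<exists>S. S * (A - scalar_op z) = 1 \<and> (A - scalar_op z) * S = 1"
    by (auto simp: corner_inverse_def)
next
  assume "\<exists>S. S * (A - scalar_op z) = 1 \<and> (A - scalar_op z) * S = 1"
  then obtain S where S: "S * (A - scalar_op z) = 1" "(A - scalar_op z) * S = 1" by blast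
  have "bounded_clinear_on UNIV (ap S)"
    unfolding bounded_clinear_on_def using norm_ap[of S] by (auto simp: ap_add ap_scaleC)
  moreover have "S \<cdot> (A \<cdot> x - z *\<^sub>C x) = x" "A \<cdot> (S \<cdot> x) - z *\<^sub>C (S \<cdot> x) = x" for x
    using arg_cong[OF S(1), of "\<lambda>X. X \<cdot> x"] arg_cong[OF S(2), of "\<lambda>X. X \<cdot> x"]
    by (simp_all add: ap_sub)
  ultimately show "z \<notin> spectrum (Rep_bop A)"
    unfolding spectrum_def spectrum_on_def Rep_bop_apply by auto
qed

text \<open>The resolvent of \<open>A\<close> commutes with \<open>P\<close>, hence maps the range
  of \<open>P\<close> into itself and inverts the restriction.\<close>

lemma spectrum_subset_spectrum_on:
  fixes A P :: "'a::complex_hilbert_space bop"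
  assumes P: "P * P = P" "A * P = P * A"
  shows "spectrum_on (range (ap P)) (Rep_bop A) \<subseteq> spectrum (Rep_bop A)"
proof (intro subsetI, rule ccontr)
  fix z assume z: "z \<in> spectrum_on (range (ap P)) (Rep_bop A)" "z \<notin> spectrum (Rep_bop A)"
  then obtain S where S: "S * (A - scalar_op z) = 1" "(A - scalar_op z) * S = 1"
    using notin_spectrum_iff by blast
  have c: "P * (A - scalar_op z) = (A - scalar_op z) * P"
    using P by (simp add: left_diff_distrib right_diff_distrib scalar_op_commute)
  have "P * S = S * (A - scalar_op z) * P * S" by (simp add: S)
  also have "\<dots> = S * ((A - scalar_op z) * P) * S" by (simp only: mult.assoc)
  also have "\<dots> = S * P * ((A - scalar_op z) * S)" unfolding c[symmetric] by (simp only: mult.assoc)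
  finally have PS: "P * S = S * P" by (simp add: S)
  have "ap S ` range (ap P) \<subseteq> range (ap P)"
    by clarify (metis PS ap_mult rangeI)
  moreover have "bounded_clinear_on (range (ap P)) (ap S)"
    unfolding bounded_clinear_on_def using norm_ap[of S] by (auto simp: ap_add ap_scaleC)
  moreover have "S \<cdot> (A \<cdot> x - z *\<^sub>C x) = x" "A \<cdot> (S \<cdot> x) - z *\<^sub>C (S \<cdot> x) = x" for x
    using arg_cong[OF S(1), of "\<lambda>X. X \<cdot> x"] arg_cong[OF S(2), of "\<lambda>X. X \<cdot> x"]
    by (simp_all add: ap_sub)
  ultimately have "z \<notin> spectrum_on (range (ap P)) (Rep_bop A)"
    unfolding spectrum_on_def Rep_bop_apply by auto
  with z show False by blast
qed

section \<open>Boundedness and closedness of the spectrum\<close>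

lemma spectrum_cmod_le: "z \<in> spectrum (Rep_bop A) \<Longrightarrow> cmod z \<le> norm A"
proof (rule ccontr)
  assume z: "z \<in> spectrum (Rep_bop A)" "\<not> cmod z \<le> norm A"
  hence z0: "cmod z > norm A" by simp
  hence zn: "z \<noteq> 0" using norm_ge_zero[of A] by auto
  have "norm (scalar_op (1 / z) * A) \<le> cmod (1 / z) * norm A" by (rule norm_scalar_op_mult)
  also have "\<dots> < 1" using z0 zn by (simp add: norm_divide)
  finally obtain W where W: "W * (1 - scalar_op (1 / z) * A) = 1" "(1 - scalar_op (1 / z) * A) * W = 1"
    using Neumann_inverse by blast
  have e: "A - scalar_op z = scalar_op (- z) * (1 - scalar_op (1 / z) * A)"
    using zn by (simp add: right_diff_distrib mult.assoc[symmetric] scalar_op_mult)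
      (simp add: scalar_op_diff[of 0, simplified] scalar_op_1)
  have "corner_inverse 1 (A - scalar_op z) (scalar_op (1 / (- z)) * W)"
    unfolding e using zn W by (intro corner_inverse_scalar_mult) (auto simp: corner_inverse_def)
  hence "\<exists>S. S * (A - scalar_op z) = 1 \<and> (A - scalar_op z) * S = 1"
    unfolding corner_inverse_def by blast
  with z(1) notin_spectrum_iff show False by blast
qed

text \<open>If \<open>S\<close> inverts \<open>A - z\<close>, then \<open>A - y\<close> is
  \<open>A - z\<close> times \<open>1 - (y - z) S\<close>, on either side; the second factor has a
  Neumann inverse for \<open>y\<close> near \<open>z\<close>.\<close>

lemma closed_spectrum: "closed (spectrum (Rep_bop A))"
  unfolding closed_def open_dist
proof (intro ballI)
  fix z assume "z \<in> - spectrum (Rep_bop A)"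
  then obtain S where S: "S * (A - scalar_op z) = 1" "(A - scalar_op z) * S = 1"
    using notin_spectrum_iff by blast
  show "\<exists>e>0. \<forall>y. dist y z < e \<longrightarrow> y \<in> - spectrum (Rep_bop A)"
  proof (intro exI conjI allI impI)
    show "1 / (norm S + 1) > 0" by (simp add: add_nonneg_pos)
    fix y assume y: "dist y z < 1 / (norm S + 1)"
    have "norm (scalar_op (y - z) * S) \<le> cmod (y - z) * norm S" by (rule norm_scalar_op_mult)
    also have "\<dots> \<le> 1 / (norm S + 1) * norm S"
      using y by (intro mult_right_mono) (auto simp: dist_norm)
    also have "\<dots> < 1" by (rule norm_mult_inverse_less_1)
    finally obtain W where W: "W * (1 - scalar_op (y - z) * S) = 1" "(1 - scalar_op (y - z) * S) * W = 1"
      using Neumann_inverse by blast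
    have e1: "A - scalar_op y = (A - scalar_op z) * (1 - scalar_op (y - z) * S)"
      unfolding right_diff_distrib[of "A - scalar_op z"] scalar_op_left_commute[of "A - scalar_op z"] S
      by (simp add: scalar_op_diff)
    have e2: "A - scalar_op y = (1 - scalar_op (y - z) * S) * (A - scalar_op z)"
      by (simp add: left_diff_distrib mult.assoc S scalar_op_diff)
    have "(W * S) * (A - scalar_op y) = W * (S * (A - scalar_op z)) * (1 - scalar_op (y - z) * S)"
      unfolding e1 by (simp only: mult.assoc)
    hence 1: "(W * S) * (A - scalar_op y) = 1" by (simp add: S W)
    have "(A - scalar_op y) * (S * W) = (1 - scalar_op (y - z) * S) * ((A - scalar_op z) * S) * W"
      unfolding e2 by (simp only: mult.assoc)
    hence 2: "(A - scalar_op y) * (S * W) = 1" by (simp add: S W)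
    have "W * S = (W * S) * ((A - scalar_op y) * (S * W))" by (simp add: 2)
    also have "\<dots> = S * W" by (simp only: mult.assoc[symmetric] 1 mult_1_left)
    finally have "W * S = S * W" .
    with 1 2 show "y \<in> - spectrum (Rep_bop A)" using notin_spectrum_iff by auto
  qed
qed

text \<open>
  \<open>w \<mapsto> \<langle>S w x, y\<rangle>\<close> is holomorphic with Taylor coefficients \<open>\<langle>A\<^sup>n P x, y\<rangle>\<close>, so Cauchy's inequality
  bounds the powers.
\<close>

lemma resolvent_powers_bound:
  fixes A P :: "'a::complex_hilbert_space bop"
  assumes P: "P * P = P" "A * P = P * A"
  and inv: "\<And>w. cmod w < R \<Longrightarrow> \<exists>S. corner_inverse P (1 - scalar_op w * A) S"
  and r: "0 < r" "r < R"
  shows "\<exists>C\<ge>0. \<forall>n. norm (A ^ n * P) \<le> C / r ^ n"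
proof -
  obtain S where S: "\<And>w. cmod w < R \<Longrightarrow> corner_inverse P (1 - scalar_op w * A) (S w)"
    using inv by metis
  \<comment> \<open>The resolvent identity, obtained by placing \<open>1 - v A\<close> and
    \<open>1 - w A\<close> between \<open>S w\<close> and \<open>S v\<close>. It yields first
    continuity and then the derivative of \<open>S\<close>.\<close>
  have res: "S w - S v = scalar_op (w - v) * (S w * A * S v)" if "cmod w < R" "cmod v < R" for w v
  proof -
    have 1: "S w * (1 - scalar_op v * A) * S v = S w"
      using S[OF that(1)] S[OF that(2)] by (simp add: corner_inverse_def mult.assoc)
    have 2: "S w * (1 - scalar_op w * A) * S v = S v"
      using S[OF that(1)] S[OF that(2)] by (simp add: corner_inverse_def)
    have "S w - S v = S w * (1 - scalar_op v * A) * S v - S w * (1 - scalar_op w * A) * S v"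
      unfolding 1 2 ..
    also have "\<dots> = S w * (scalar_op (w - v) * A) * S v"
      by (simp add: scalar_op_diff left_diff_distrib right_diff_distrib)
    finally show ?thesis by (simp only: scalar_op_left_commute[of "S w"] mult.assoc)
  qed
  have cont: "(S \<longlongrightarrow> S v) (at v)" if v: "cmod v < R" for v
  proof -
    define c where "c = norm A * norm (S v)"
    have c: "c \<ge> 0" by (simp add: c_def)
    have "((\<lambda>w. cmod (w - v) * (2 * c * norm (S v))) \<longlongrightarrow> cmod (v - v) * (2 * c * norm (S v))) (at v)"
      by (intro tendsto_intros)
    hence lim: "((\<lambda>w. cmod (w - v) * (2 * c * norm (S v))) \<longlongrightarrow> 0) (at v)" by simp
    have "((\<lambda>w. cmod (w - v) * c) \<longlongrightarrow> cmod (v - v) * c) (at v)" by (intro tendsto_intros)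
    hence "\<forall>\<^sub>F w in at v. cmod (w - v) * c < 1 / 2"
      by (rule order_tendstoD) simp
    moreover have "\<forall>\<^sub>F w in at v. cmod w < R"
      using order_tendstoD(2)[OF tendsto_norm[OF tendsto_ident_at] v] .
    ultimately have "\<forall>\<^sub>F w in at v. norm (S w - S v) \<le> cmod (w - v) * (2 * c * norm (S v))"
    proof eventually_elim
      case (elim w)
      \<comment> \<open>Here \<open>norm (S w)\<close> still stands on the right. For
        \<open>w\<close> near \<open>v\<close> the bound implies
        \<open>norm (S w) \<le> 2 * norm (S v)\<close>, which is then substituted back.\<close>
      have 1: "norm (S w - S v) \<le> cmod (w - v) * (norm (S w) * c)"
      proof -
        have "norm (S w - S v) \<le> cmod (w - v) * norm (S w * A * S v)"
          unfolding res[OF elim(2) v] by (rule norm_scalar_op_mult)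
        also have "norm (S w * A * S v) \<le> norm (S w) * (norm A * norm (S v))"
          using norm_mult_ineq[of "S w" "A * S v"]
            mult_left_mono[OF norm_mult_ineq[of A "S v"], of "norm (S w)"] by (simp add: mult.assoc)
        finally show ?thesis by (simp add: c_def mult_left_mono)
      qed
      also have "\<dots> = (cmod (w - v) * c) * norm (S w)" by simp
      also have "\<dots> \<le> 1 / 2 * norm (S w)" using elim by (intro mult_right_mono) auto
      finally have "norm (S w) \<le> 2 * norm (S v)"
        using norm_triangle_ineq2[of "S w" "S v"] by linarith
      hence "cmod (w - v) * (norm (S w) * c) \<le> cmod (w - v) * (2 * norm (S v) * c)"
        using c by (intro mult_left_mono mult_right_mono) auto
      with 1 show ?case by (simp add: mult_ac)
    qed
    hence "((\<lambda>w. S w - S v) \<longlongrightarrow> 0) (at v)" by (rule Lim_null_comparison[OF _ lim])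
    thus ?thesis by (simp add: LIM_zero_iff)
  qed
  have contS: "continuous_on (cball 0 r) S"
    unfolding continuous_on_def
    using r by (intro ballI tendsto_mono[OF at_le[OF subset_UNIV] cont]) auto
  have "compact (S ` cball 0 r)" using contS compact_cball by (rule compact_continuous_image)
  then obtain C where C: "C > 0" "\<And>w. cmod w \<le> r \<Longrightarrow> norm (S w) \<le> C"
    using compact_imp_bounded[of "S ` cball 0 r"] unfolding bounded_pos by auto
  have "norm (A ^ n * P) \<le> C / r ^ n" for n
  proof (rule norm_le_cinner)
    show "0 \<le> C / r ^ n" using C r by simp
    fix x y :: 'a
    define f where "f w = cinner (S w \<cdot> x) y" for w
    have der: "(f has_field_derivative cinner ((S v * A * S v) \<cdot> x) y) (at v)" if v: "cmod v < R" for v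
      unfolding has_field_derivative_iff
    proof (rule Lim_transform_eventually)
      show "((\<lambda>w. cinner ((S w * A * S v) \<cdot> x) y) \<longlongrightarrow> cinner ((S v * A * S v) \<cdot> x) y) (at v)"
        by (intro tendsto_intros cont v)
      have "\<forall>\<^sub>F w in at v. cmod w < R"
        using order_tendstoD(2)[OF tendsto_norm[OF tendsto_ident_at] v] .
      moreover have "\<forall>\<^sub>F w in at v. w \<noteq> v" by (simp add: eventually_at_filter)
      ultimately show "\<forall>\<^sub>F w in at v. cinner ((S w * A * S v) \<cdot> x) y = (f w - f v) / (w - v)"
      proof eventually_elim
        case (elim w)
        have "f w - f v = cinner ((S w - S v) \<cdot> x) y" by (simp add: f_def ap_sub cinner_diff_left)
        also have "\<dots> = (w - v) * cinner ((S w * A * S v) \<cdot> x) y"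
          unfolding res[OF elim(1) v] by (simp add: cinner_scaleC_left)
        finally show ?case using elim by simp
      qed
    qed
    have holf: "f holomorphic_on ball 0 r"
    proof (rule holomorphic_onI)
      fix v :: complex assume "v \<in> ball 0 r"
      hence "cmod v < R" using r by simp
      from der[OF this] have "f field_differentiable at v" unfolding field_differentiable_def by blast
      thus "f field_differentiable at v within ball 0 r" by (rule field_differentiable_at_within)
    qed
    have contf: "continuous_on (cball 0 r) f"
      unfolding f_def continuous_on_def
      using contS[unfolded continuous_on_def] by (intro ballI tendsto_intros) auto
    have bnd: "norm ((deriv ^^ n) f 0) \<le> fact n * (C * norm x * norm y) / r ^ n"
    proof (rule Cauchy_inequality[OF holf contf r(1)])
      fix w :: complex assume "norm (0 - w) = r"
      hence "norm (S w) \<le> C" using C(2) by simp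
      have "norm (f w) \<le> norm (S w \<cdot> x) * norm y" unfolding f_def by (rule cmod_cinner_le)
      also have "\<dots> \<le> (norm (S w) * norm x) * norm y" by (intro mult_right_mono norm_ap) simp
      also have "\<dots> \<le> C * norm x * norm y"
        using \<open>norm (S w) \<le> C\<close> by (intro mult_right_mono) auto
      finally show "norm (f w) \<le> C * norm x * norm y" .
    qed
    define c where "c k = cinner ((A ^ k * P) \<cdot> x) y" for k
    \<comment> \<open>On this smaller disc the remainder of the expansion decays geometrically,
      while \<open>d \<le> r\<close> keeps \<open>S w\<close> bounded by \<open>C\<close>.\<close>
    define d where "d = min r (1 / (norm A + 1))"
    have d: "0 < d" "d \<le> r" "d * norm A < 1"
    proof -
      show "0 < d" "d \<le> r" using r by (auto simp: d_def add_nonneg_pos)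
      have "d * norm A \<le> 1 / (norm A + 1) * norm A" by (intro mult_right_mono) (auto simp: d_def)
      also have "\<dots> < 1" by (rule norm_mult_inverse_less_1)
      finally show "d * norm A < 1" .
    qed
    have sums: "(\<lambda>k. c k * w ^ k) sums f w" if w: "cmod w \<le> d" for w
    proof -
      have wR: "cmod w < R" using w d r by simp
      have Sw: "S w = P + scalar_op w * (A * S w)"
        using S[OF wR] by (simp add: corner_inverse_def left_diff_distrib mult.assoc diff_eq_eq)
      \<comment> \<open>Taylor expansion with remainder, by iterating the fixed-point equation
        \<open>Sw\<close>.\<close>
      have ex: "f w = (\<Sum>k<m. c k * w ^ k) + w ^ m * cinner ((A ^ m * S w) \<cdot> x) y" for m
      proof (induction m)
        case (Suc m)
        have "A ^ m * S w = A ^ m * P + scalar_op w * (A ^ Suc m * S w)"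
          by (subst Sw) (simp add: distrib_left scalar_op_left_commute[of "A ^ m"] power_Suc2 mult.assoc del: power_Suc)
        hence "cinner ((A ^ m * S w) \<cdot> x) y = c m + w * cinner ((A ^ Suc m * S w) \<cdot> x) y"
          by (simp only: c_def ap_plus cinner_add_left) (simp add: cinner_scaleC_left)
        thus ?case using Suc by (simp add: algebra_simps)
      qed (simp add: f_def)
      have lim0: "(\<lambda>m. w ^ m * cinner ((A ^ m * S w) \<cdot> x) y) \<longlonglongrightarrow> 0"
      proof (rule Lim_null_comparison[OF always_eventually[OF allI]])
        show "(\<lambda>m. (d * norm A) ^ m * (C * norm x * norm y)) \<longlonglongrightarrow> 0"
          using d by (intro tendsto_mult_left_zero LIMSEQ_power_zero) simp
        fix m
        have "cmod (cinner ((A ^ m * S w) \<cdot> x) y) \<le> norm (A ^ m * S w) * norm x * norm y"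
          by (rule order.trans[OF cmod_cinner_le]) (intro mult_right_mono norm_ap norm_ge_zero)
        also have "norm (A ^ m * S w) \<le> norm A ^ m * C"
          using C(2)[of w] w d norm_power_bop'[of A m]
          by (intro order.trans[OF norm_mult_ineq] mult_mono) auto
        finally have "cmod (cinner ((A ^ m * S w) \<cdot> x) y) \<le> norm A ^ m * C * norm x * norm y"
          by (simp add: mult_right_mono)
        moreover have "cmod w ^ m \<le> d ^ m" using w by (intro power_mono) auto
        ultimately have "cmod w ^ m * cmod (cinner ((A ^ m * S w) \<cdot> x) y) \<le> d ^ m * (norm A ^ m * C * norm x * norm y)"
          using d by (intro mult_mono) auto
        thus "norm (w ^ m * cinner ((A ^ m * S w) \<cdot> x) y) \<le> (d * norm A) ^ m * (C * norm x * norm y)"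
          by (simp add: norm_mult norm_power power_mult_distrib mult_ac)
      qed
      have "(\<lambda>m. f w - w ^ m * cinner ((A ^ m * S w) \<cdot> x) y) \<longlonglongrightarrow> f w - 0"
        by (rule tendsto_diff[OF tendsto_const lim0])
      moreover have "(\<lambda>m. f w - w ^ m * cinner ((A ^ m * S w) \<cdot> x) y) = (\<lambda>m. \<Sum>k<m. c k * w ^ k)"
      proof
        show "f w - w ^ m * cinner ((A ^ m * S w) \<cdot> x) y = (\<Sum>k<m. c k * w ^ k)" for m
          using ex[of m] by simp
      qed
      ultimately show ?thesis by (simp add: sums_def)
    qed
    have "f has_fps_expansion Abs_fps c"
      unfolding has_fps_expansion_def
    proof
      have "ereal (norm (of_real d :: complex)) \<le> conv_radius c"
        by (rule conv_radius_geI) (use sums[of "of_real d"] d in \<open>auto simp: sums_iff\<close>)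
      hence "ereal d \<le> conv_radius c" using d by simp
      moreover have "(0::ereal) < ereal d" using d by simp
      ultimately have "0 < conv_radius c" using less_le_trans by blast
      thus "0 < fps_conv_radius (Abs_fps c)" by (simp add: fps_conv_radius_def)
      show "\<forall>\<^sub>F z in nhds 0. eval_fps (Abs_fps c) z = f z"
        unfolding eventually_nhds_metric
        using d sums by (intro exI[of _ d]) (auto simp: eval_fps_def sums_iff dist_norm)
    qed
    from fps_nth_fps_expansion[OF this, of n] have "c n = (deriv ^^ n) f 0 / fact n" by simp
    hence "cmod (c n) = norm ((deriv ^^ n) f 0) / fact n" by (simp add: norm_divide)
    also have "\<dots> \<le> C * norm x * norm y / r ^ n" using bnd by (simp add: field_simps)
    finally show "cmod (cinner ((A ^ n * P) \<cdot> x) y) \<le> C / r ^ n * norm x * norm y"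
      by (simp add: c_def)
  qed
  with C(1) show ?thesis by (intro exI[of _ C]) auto
qed

text \<open>The substitution \<open>w = 1 / z\<close> turns the resolvent outside a disc into an
  inverse of \<open>1 - w A\<close> inside the disc of reciprocal radius; \<open>w = 0\<close>
  corresponds to infinity, with inverse \<open>P\<close>.\<close>

lemma power_bound_above:
  fixes A P :: "'a::complex_hilbert_space bop"
  assumes P: "P * P = P" "A * P = P * A"
  and sp: "spectrum_on (range (ap P)) (Rep_bop A) \<subseteq> cball 0 l" and l: "0 \<le> l" "l < \<rho>"
  shows "\<exists>C\<ge>0. \<forall>n. norm (A ^ n * P) \<le> C * \<rho> ^ n"
proof -
  \<comment> \<open>A positive radius is needed for the reciprocal, and \<open>l\<close> may be
    0.\<close>
  obtain s where s: "l < s" "s < \<rho>" using l dense by blast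
  have "\<exists>C\<ge>0. \<forall>n. norm (A ^ n * P) \<le> C / (1 / \<rho>) ^ n"
  proof (rule resolvent_powers_bound[OF P])
    show "0 < 1 / \<rho>" using l by simp
    show "1 / \<rho> < 1 / s" using s l by (simp add: frac_less2)
    fix w :: complex assume w: "cmod w < 1 / s"
    show "\<exists>S. corner_inverse P (1 - scalar_op w * A) S"
    proof (cases "w = 0")
      case True
      thus ?thesis using P by (intro exI[of _ P]) (simp add: corner_inverse_def)
    next
      case False
      have "cmod (1 / w) > s" using False w s l by (simp add: norm_divide field_simps)
      hence "1 / w \<notin> spectrum_on (range (ap P)) (Rep_bop A)" using sp s by auto
      from corner_inverse_notin_spectrum_on[OF P this]
      obtain S where S: "corner_inverse P (A - scalar_op (1 / w)) S" by blast
      have e: "1 - scalar_op w * A = scalar_op (- w) * (A - scalar_op (1 / w))"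
        using False by (simp add: right_diff_distrib scalar_op_mult)
          (simp add: scalar_op_diff[of 0, simplified])
      have "corner_inverse P (1 - scalar_op w * A) (scalar_op (1 / (- w)) * S)"
        unfolding e using S False by (intro corner_inverse_scalar_mult) auto
      thus ?thesis by blast
    qed
  qed
  thus ?thesis using l by (simp add: power_divide)
qed

text \<open>On the range of \<open>P\<close> the operator \<open>A\<close> has an inverse
  \<open>B\<close>, and an upper bound on the powers of \<open>B\<close> is a lower bound on those
  of \<open>A\<close>.\<close>

lemma power_bound_below:
  fixes A P :: "'a::complex_hilbert_space bop"
  assumes P: "P * P = P" "A * P = P * A"
  and sp: "spectrum_on (range (ap P)) (Rep_bop A) \<subseteq> {z. l \<le> cmod z}" and \<rho>: "0 < \<rho>" "\<rho> < l"
  shows "\<exists>C\<ge>0. \<forall>n x. \<rho> ^ n * norm (P \<cdot> x) \<le> C * norm (A ^ n \<cdot> (P \<cdot> x))"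
proof -
  have "0 \<notin> spectrum_on (range (ap P)) (Rep_bop A)" using sp \<rho> by force
  from corner_inverse_notin_spectrum_on[OF P this]
  obtain B where "corner_inverse P (A - scalar_op 0) B" by blast
  hence B: "P * B = B" "B * P = B" "B * A = P" "A * B = P" by (auto simp: corner_inverse_def)
  have "\<exists>C\<ge>0. \<forall>n. norm (B ^ n * P) \<le> C / \<rho> ^ n"
  proof (rule resolvent_powers_bound[OF P(1) _ _ \<rho>])
    show "B * P = P * B" by (simp add: B)
    fix w :: complex assume w: "cmod w < l"
    hence "w \<notin> spectrum_on (range (ap P)) (Rep_bop A)" using sp by auto
    from corner_inverse_notin_spectrum_on[OF P this]
    obtain S where "corner_inverse P (A - scalar_op w) S" by blast
    hence S: "P * S = S" "S * P = S" "S * (A - scalar_op w) = P" "(A - scalar_op w) * S = P"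
      by (auto simp: corner_inverse_def)
    \<comment> \<open>On the range of \<open>P\<close>, \<open>1 - w B\<close> equals
      \<open>(A - w) B\<close>, so its inverse is \<open>A * S\<close>.\<close>
    have "corner_inverse P (1 - scalar_op w * B) (A * S)"
      unfolding corner_inverse_def
    proof (intro conjI)
      show "P * (A * S) = A * S" by (metis P(2) S(1) mult.assoc)
      show "A * S * P = A * S" by (simp add: mult.assoc S)
      have SA: "S * A = A * S"
        using S(3,4) by (simp add: left_diff_distrib right_diff_distrib scalar_op_commute diff_eq_eq)
      have "(1 - scalar_op w * B) * (A * S) = A * S - scalar_op w * (B * A * S)"
        by (simp add: left_diff_distrib mult.assoc)
      also have "\<dots> = (A - scalar_op w) * S" by (simp add: B S left_diff_distrib)
      finally show "(1 - scalar_op w * B) * (A * S) = P" by (simp add: S)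
      have "A * S * (1 - scalar_op w * B) = A * S - scalar_op w * (S * (A * B))"
        by (simp add: right_diff_distrib SA[symmetric] mult.assoc scalar_op_left_commute[of "S"] scalar_op_left_commute[of A])
      also have "\<dots> = (A - scalar_op w) * S" by (simp add: B S left_diff_distrib)
      finally show "A * S * (1 - scalar_op w * B) = P" by (simp add: S)
    qed
    thus "\<exists>S. corner_inverse P (1 - scalar_op w * B) S" by blast
  qed
  then obtain C where C: "C \<ge> 0" "\<And>n. norm (B ^ n * P) \<le> C / \<rho> ^ n" by blast
  have BA: "B ^ n * (A ^ n * P) = P" for n
  proof (induction n)
    case (Suc n)
    have "B ^ Suc n * (A ^ Suc n * P) = B ^ n * ((B * A) * (A ^ n * P))"
      by (simp add: power_Suc2[of B] mult.assoc del: power_Suc) (simp add: mult.assoc)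
    also have "P * (A ^ n * P) = A ^ n * P"
      using commute_power[of P A n] P by (metis mult.assoc)
    hence "(B * A) * (A ^ n * P) = A ^ n * P" by (simp add: B)
    finally show ?case using Suc by simp
  qed simp
  have "\<rho> ^ n * norm (P \<cdot> x) \<le> C * norm (A ^ n \<cdot> (P \<cdot> x))" for n x
  proof -
    have PAP: "P * (A ^ n * P) = A ^ n * P"
      using commute_power[of P A n] P by (metis mult.assoc)
    have "P \<cdot> x = (B ^ n * P) \<cdot> (A ^ n \<cdot> (P \<cdot> x))"
      using arg_cong[OF BA[of n], of "\<lambda>X. X \<cdot> x"] arg_cong[OF PAP, of "\<lambda>X. X \<cdot> x"] by simp
    hence "norm (P \<cdot> x) \<le> norm (B ^ n * P) * norm (A ^ n \<cdot> (P \<cdot> x))" by (metis norm_ap)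
    also have "\<dots> \<le> C / \<rho> ^ n * norm (A ^ n \<cdot> (P \<cdot> x))" by (intro mult_right_mono C) simp
    finally show ?thesis using \<rho> by (simp add: field_simps)
  qed
  with C(1) show ?thesis by blast
qed

text \<open>An operator with empty spectrum would be both invertible and quasinilpotent.\<close>

lemma empty_spectrum_on_imp_zero:
  fixes A P :: "'a::complex_hilbert_space bop"
  assumes P: "P * P = P" "A * P = P * A"
  and sp: "spectrum_on (range (ap P)) (Rep_bop A) = {}"
  shows "P = 0"
proof (rule bop_eqI)
  fix x
  \<comment> \<open>The empty set lies in the disc of radius 0 and outside the unit disc alike; the
    growth rates \<open>1/4\<close> from above and \<open>1/2\<close> from below then contradict
    each other unless \<open>P \<cdot> x = 0\<close>.\<close>
  obtain C where C: "C \<ge> 0" "\<And>n. norm (A ^ n * P) \<le> C * (1/4) ^ n"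
    using power_bound_above[OF P, of 0 "1/4"] sp by auto
  obtain D where D: "D \<ge> 0" "\<And>n x. (1/2) ^ n * norm (P \<cdot> x) \<le> D * norm (A ^ n \<cdot> (P \<cdot> x))"
    using power_bound_below[OF P, of 1 "1/2"] sp by auto
  have "norm (P \<cdot> x) \<le> (1/2) ^ n * (D * C * norm x)" for n
  proof -
    have "norm (A ^ n \<cdot> (P \<cdot> x)) \<le> norm (A ^ n * P) * norm x" using norm_ap[of "A ^ n * P" x] by simp
    also have "\<dots> \<le> C * (1/4) ^ n * norm x" by (intro mult_right_mono C) simp
    finally have "D * norm (A ^ n \<cdot> (P \<cdot> x)) \<le> D * (C * (1/4) ^ n * norm x)"
      using D(1) by (rule mult_left_mono)
    with D(2)[of n x] have "(1/2) ^ n * norm (P \<cdot> x) \<le> D * (C * (1/4) ^ n * norm x)" by linarith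
    also have "(1/4 :: real) ^ n = (1/2) ^ n * (1/2) ^ n" by (simp add: power_mult_distrib[symmetric])
    finally have "(1/2) ^ n * norm (P \<cdot> x) \<le> (1/2) ^ n * ((1/2) ^ n * (D * C * norm x))"
      by (simp only: mult_ac)
    thus ?thesis by (rule mult_left_le_imp_le) simp
  qed
  moreover have "(\<lambda>n. (1/2) ^ n * (D * C * norm x)) \<longlonglongrightarrow> 0"
    by (intro tendsto_mult_left_zero LIMSEQ_power_zero) simp
  ultimately have "norm (P \<cdot> x) \<le> 0" by (intro LIMSEQ_le_const) auto
  thus "P \<cdot> x = 0 \<cdot> x" by simp
qed

section \<open>Orthogonal projections\<close>

text \<open>The two products say that \<open>E\<close> and \<open>F\<close> have the same range, in
  a form suited to algebra; idempotence of \<open>F\<close> follows from them.\<close>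

definition range_proj :: "'a::complex_hilbert_space bop \<Rightarrow> 'a bop \<Rightarrow> bool"
  where "range_proj E F \<longleftrightarrow> adj F = F \<and> F * E = E \<and> E * F = F"

text \<open>The range of an idempotent is its fixed space, hence closed, and Riesz representation on
  it gives the orthogonal projection; the uniqueness in \<open>eqI\<close> makes this map
  linear.\<close>

lemma range_proj_exists:
  assumes E: "E * E = E"
  shows "\<exists>F. range_proj E F"
proof -
  define V where "V = {x. E \<cdot> x = x}"
  have EE: "E \<cdot> (E \<cdot> x) = E \<cdot> x" for x by (metis E ap_mult)
  have clV: "closed V"
    unfolding V_def
    by (intro closed_Collect_eq linear_continuous_on bounded_linear_ap continuous_on_id)
  have V: "0 \<in> V" "\<And>x y. x \<in> V \<Longrightarrow> y \<in> V \<Longrightarrow> x + y \<in> V" "\<And>c x. x \<in> V \<Longrightarrow> c *\<^sub>C x \<in> V"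
    by (auto simp: V_def ap_add ap_scaleC)
  have Vd: "x \<in> V \<Longrightarrow> y \<in> V \<Longrightarrow> x - y \<in> V" and VR: "x \<in> V \<Longrightarrow> r *\<^sub>R x \<in> V" for x y r
    by (auto simp: V_def ap_diff ap_scaleR)
  have "\<exists>v\<in>V. \<forall>w\<in>V. cinner w v = cinner w x" for x
    using Riesz_on_closed_subspace[OF clV V bounded_linear_cinner_left[of x]] cinner_scaleC_left
    by blast
  then obtain g where gV: "\<And>x. g x \<in> V" and g: "\<And>x w. w \<in> V \<Longrightarrow> cinner w (g x) = cinner w x"
    by metis
  have eqI: "g x = v" if v: "v \<in> V" "\<And>w. w \<in> V \<Longrightarrow> cinner w v = cinner w x" for x v
  proof -
    have "cinner (g x - v) (g x - v) = 0"
      using g[OF Vd[OF gV v(1)]] v(2)[OF Vd[OF gV v(1)]] by (simp add: cinner_diff_right)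
    thus ?thesis by (simp add: cinner_self)
  qed
  have "bounded_linear g"
  proof (rule bounded_linear_intro[where K = 1])
    show "g (x + y) = g x + g y" for x y by (rule eqI) (auto simp: gV V g cinner_add_right)
    show "g (r *\<^sub>R x) = r *\<^sub>R g x" for r x by (rule eqI) (auto simp: gV VR g cinner_scaleR_right)
    show "norm (g x) \<le> norm x * 1" for x
    proof -
      have "(norm (g x))\<^sup>2 = Re (cinner (g x) x)" by (metis g gV Re_cinner_self)
      also have "\<dots> \<le> norm (g x) * norm x" by (rule Re_cinner_le)
      finally show ?thesis by (cases "g x = 0") (auto simp: power2_eq_square)
    qed
  qed
  moreover have "g (c *\<^sub>C x) = c *\<^sub>C g x" for c x
    by (rule eqI) (auto simp: gV V g cinner_scaleC_right)
  ultimately obtain F where F: "\<And>x. F \<cdot> x = g x" using bop_exists by blast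
  have "adj F = F"
  proof (rule adj_eqI)
    show "cinner (F \<cdot> x) y = cinner x (F \<cdot> y)" for x y
      by (metis F cinner_commute g gV)
  qed
  moreover have "F * E = E"
    by (rule bop_eqI) (auto simp: F V_def EE intro!: eqI)
  moreover have "E * F = F"
    using gV by (intro bop_eqI) (simp add: F V_def)
  ultimately show ?thesis by (auto simp: range_proj_def)
qed

lemma range_proj_idem: "range_proj E F \<Longrightarrow> F * F = F"
  by (metis range_proj_def mult.assoc)

lemma range_proj_unique: "range_proj E F \<Longrightarrow> range_proj E F' \<Longrightarrow> F = F'"
proof -
  assume a: "range_proj E F" "range_proj E F'"
  hence "F' * F = F" "F * F' = F'" by (metis range_proj_def mult.assoc)+
  thus ?thesis using a by (metis range_proj_def adj_mult)
qed

definition Rng :: "'a::complex_hilbert_space bop \<Rightarrow> 'a bop"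
  where "Rng E = (SOME F. range_proj E F)"

lemma range_proj_Rng: "E * E = E \<Longrightarrow> range_proj E (Rng E)"
  unfolding Rng_def by (rule someI_ex) (rule range_proj_exists)

lemma projection_op_Rep_bop: "projection_op (Rep_bop P) \<longleftrightarrow> P * P = P \<and> adj P = P"
proof -
  have "(\<forall>x y. cinner (P \<cdot> x) y = cinner x (P \<cdot> y)) \<longleftrightarrow> adj P = P"
    by (metis adj_eqI cinner_adj)
  thus ?thesis
    by (simp add: projection_op_def Rep_bop_apply times_bop.rep_eq[symmetric] Rep_bop_inject)
qed

lemma range_eq_iff_idem:
  assumes "P * P = P" "Q * Q = Q"
  shows "range (ap P) = range (ap Q) \<longleftrightarrow> P * Q = Q \<and> Q * P = P"
proof
  have fixed: "x \<in> range (ap R) \<longleftrightarrow> R \<cdot> x = x" if "R * R = R" for R :: "'a bop" and x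
  proof
    assume "x \<in> range (ap R)"
    thus "R \<cdot> x = x" using that by (metis ap_mult imageE)
  qed (metis rangeI)
  show "P * Q = Q \<and> Q * P = P" if "range (ap P) = range (ap Q)"
  proof -
    have "P \<cdot> (Q \<cdot> x) = Q \<cdot> x" "Q \<cdot> (P \<cdot> x) = P \<cdot> x" for x
      using that fixed[OF assms(1), of "Q \<cdot> x"] fixed[OF assms(2), of "P \<cdot> x"] by blast+
    thus ?thesis by (auto intro!: bop_eqI)
  qed
  show "range (ap P) = range (ap Q)" if "P * Q = Q \<and> Q * P = P"
    using that by (metis (no_types, opaque_lifting) ap_mult fixed assms rangeI subsetI subset_antisym)
qed

lemma closed_range_idem: "E * E = E \<Longrightarrow> closed (range (ap E))"
proof -
  assume E: "E * E = E"
  have "range (ap E) = {x. E \<cdot> x = x}" using E by (auto simp flip: ap_mult) (metis rangeI)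
  also have "closed \<dots>"
    by (intro closed_Collect_eq linear_continuous_on bounded_linear_ap continuous_on_id)
  finally show ?thesis .
qed

lemma range_projection_Rep_bop:
  assumes E: "E * E = E"
  shows "range_projection (Rep_bop E) = Rep_bop (Rng E)"
  unfolding range_projection_def Rep_bop_apply closure_closed[OF closed_range_idem[OF E]]
proof (rule the_equality)
  have r: "range_proj E (Rng E)" using E by (rule range_proj_Rng)
  show "projection_op (Rep_bop (Rng E)) \<and> range (blinfun_apply (Rep_bop (Rng E))) = range (ap E)"
    using r range_proj_idem[OF r] range_eq_iff_idem[OF range_proj_idem[OF r] E]
    by (auto simp: projection_op_Rep_bop Rep_bop_apply range_proj_def)
  fix P assume P: "projection_op P \<and> range (blinfun_apply P) = range (ap E)"
  hence "P \<in> bounded_ops" by (simp add: projection_op_def)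
  then obtain P' where P': "P = Rep_bop P'" by (metis Abs_bop_inverse)
  have PP: "P' * P' = P'" "adj P' = P'" using P by (auto simp: P' projection_op_Rep_bop)
  hence "range_proj E P'"
    using P range_eq_iff_idem[OF PP(1) E] by (auto simp: P' Rep_bop_apply range_proj_def)
  thus "P = Rep_bop (Rng E)" unfolding P' using range_proj_unique r by blast
qed

lemma op_le_Rep_bop: "op_le (Rep_bop X) (Rep_bop Y) \<longleftrightarrow> pos (Y - X)"
  by (simp add: op_le_def minus_bop.rep_eq[symmetric] positive_op_Rep_bop)

lemma pos_projection: "P * P = P \<Longrightarrow> adj P = P \<Longrightarrow> pos P"
  using pos_adj_mult[of P] by simp

lemma qf_projection: "P * P = P \<Longrightarrow> adj P = P \<Longrightarrow> qf P x = (norm (P \<cdot> x))\<^sup>2"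
  using qf_adj_mult[of P x] by simp

lemma norm_projection_le: "P * P = P \<Longrightarrow> adj P = P \<Longrightarrow> norm (P \<cdot> x) \<le> norm x"
proof -
  assume "P * P = P" "adj P = P"
  hence "(norm (P \<cdot> x))\<^sup>2 = Re (cinner (P \<cdot> x) x)" by (simp add: qf_projection[symmetric] qf_def)
  also have "\<dots> \<le> norm (P \<cdot> x) * norm x" by (rule Re_cinner_le)
  finally show ?thesis by (cases "P \<cdot> x = 0") (auto simp: power2_eq_square)
qed

lemma projection_le_iff:
  assumes P: "P * P = P" "adj P = P" and Q: "Q * Q = Q" "adj Q = Q"
  shows "pos (Q - P) \<longleftrightarrow> Q * P = P"
proof
  assume p: "pos (Q - P)"
  show "Q * P = P"
  proof (rule bop_eqI)
    fix x
    have "(norm (P \<cdot> x))\<^sup>2 = qf P (P \<cdot> x)" by (metis P qf_projection ap_mult)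
    also have "\<dots> \<le> qf Q (P \<cdot> x)" using posD_qf[OF p, of "P \<cdot> x"] by (simp add: qf_simps)
    also have "\<dots> = Re (cinner (Q \<cdot> (P \<cdot> x)) (P \<cdot> x))" by (simp add: qf_def)
    finally have 1: "(norm (P \<cdot> x))\<^sup>2 \<le> Re (cinner (Q \<cdot> (P \<cdot> x)) (P \<cdot> x))" .
    have "(norm (Q \<cdot> (P \<cdot> x)))\<^sup>2 \<le> (norm (P \<cdot> x))\<^sup>2"
      by (intro power_mono norm_projection_le Q) simp
    hence "(norm (Q \<cdot> (P \<cdot> x) - P \<cdot> x))\<^sup>2 \<le> 0"
      unfolding norm_diff_square using 1 by linarith
    thus "(Q * P) \<cdot> x = P \<cdot> x" by simp
  qed
next
  assume QP: "Q * P = P"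
  hence PQ: "P * Q = P" using P Q by (metis adj_mult)
  show "pos (Q - P)"
    by (rule pos_projection) (simp_all add: left_diff_distrib right_diff_distrib QP PQ P Q adj_diff)
qed

section \<open>The idempotent-valued spectral resolution\<close>

locale spectral_resolution =
  fixes A :: "'a::complex_hilbert_space bop" and E :: "complex set \<Rightarrow> 'a bop" and M :: real
  assumes idem: "\<Omega> \<in> sets borel \<Longrightarrow> E \<Omega> * E \<Omega> = E \<Omega>"
  and comm: "\<Omega> \<in> sets borel \<Longrightarrow> A * E \<Omega> = E \<Omega> * A"
  and sp: "\<Omega> \<in> sets borel \<Longrightarrow> spectrum_on (range (ap (E \<Omega>))) (Rep_bop A) \<subseteq> closure \<Omega>"
  and empty: "E {} = 0" and full: "E UNIV = 1"
  and compl: "\<Omega> \<in> sets borel \<Longrightarrow> E (- \<Omega>) = 1 - E \<Omega>"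
  and inter: "\<Omega> \<in> sets borel \<Longrightarrow> \<Omega>' \<in> sets borel \<Longrightarrow> E (\<Omega> \<inter> \<Omega>') = E \<Omega> * E \<Omega>'"
  and bound: "\<Omega> \<in> sets borel \<Longrightarrow> norm (E \<Omega>) \<le> M"
  and sums: "range W \<subseteq> sets borel \<Longrightarrow> disjoint_family W \<Longrightarrow>
    (\<lambda>n. E (W n) \<cdot> x) sums (E (\<Union>n. W n) \<cdot> x)"
begin

text \<open>For \<open>l < 0\<close> the set \<open>cball 0 l\<close> is empty, so \<open>D\<close>
  and \<open>F\<close> vanish there without a case distinction.\<close>

definition D :: "real \<Rightarrow> 'a bop" where "D l = E (cball 0 l)"
definition F :: "real \<Rightarrow> 'a bop" where "F l = Rng (D l)"
definition r :: real where "r = spectral_radius (Rep_bop A)"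

lemma D_idem: "D l * D l = D l" and D_comm: "A * D l = D l * A"
  by (simp_all add: D_def idem comm)

lemma D_mult: "l \<le> m \<Longrightarrow> D l * D m = D l" "l \<le> m \<Longrightarrow> D m * D l = D l"
  by (auto simp: D_def inter[symmetric] Int_absorb1 Int_absorb2 subset_cball)

lemma D_neg: "l < 0 \<Longrightarrow> D l = 0"
  by (simp add: D_def empty)

lemma E_diff_cball: "a \<le> b \<Longrightarrow> E (cball 0 b \<inter> - cball 0 a) = D b - D a"
  by (simp add: inter compl D_def[symmetric] right_diff_distrib D_mult)

text \<open>Countable additivity on the complement of the disc, exhausted by the complements of the
  discs of radius \<open>l + 1 / (n + 1)\<close>, each of whose idempotents kills
  \<open>x\<close>.\<close>

lemma D_right_continuous:
  assumes "\<And>m. m > l \<Longrightarrow> D m \<cdot> x = x"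
  shows "D l \<cdot> x = x"
proof -
  define W where "W n = - cball (0::complex) (l + 1 / real (Suc n))" for n
  have W: "range W \<subseteq> sets borel" by (auto simp: W_def)
  have UW: "(\<Union>n. W n) = - cball 0 l"
  proof (intro equalityI subsetI)
    fix z :: complex assume "z \<in> - cball 0 l"
    hence "cmod z - l > 0" by simp
    then obtain n where "inverse (real (Suc n)) < cmod z - l"
      using reals_Archimedean by blast
    hence "1 / real (Suc n) < cmod z - l" by (simp only: inverse_eq_divide)
    hence "z \<in> W n" by (simp add: W_def)
    thus "z \<in> (\<Union>n. W n)" by blast
  next
    fix z assume "z \<in> (\<Union>n. W n)"
    then obtain n where "z \<in> W n" by blast
    hence "cmod z > l + 1 / real (Suc n)" by (simp add: W_def)
    moreover have "1 / real (Suc n) > 0" by simp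
    ultimately have "cmod z > l" by linarith
    thus "z \<in> - cball 0 l" by simp
  qed
  \<comment> \<open>Additivity is available for disjoint sequences only. The disjoint pieces lie
    inside the \<open>W n\<close>, so their idempotents kill \<open>x\<close> as well.\<close>
  have dW: "range (disjointed W) \<subseteq> sets borel" by (rule sets.range_disjointed_sets[OF W])
  have "E (disjointed W n) \<cdot> x = 0" for n
  proof -
    have "E (disjointed W n) = E (disjointed W n \<inter> W n)"
      using disjointed_subset[of W n] by (simp add: Int_absorb2)
    also have "\<dots> = E (disjointed W n) * E (W n)" using W dW by (intro inter) auto
    also have "E (W n) = 1 - D (l + 1 / real (Suc n))" by (simp add: W_def compl D_def)
    finally have eq: "E (disjointed W n) = E (disjointed W n) * (1 - D (l + 1 / real (Suc n)))" .
    show ?thesis by (subst eq) (use assms[of "l + 1 / real (Suc n)"] in \<open>simp add: ap_sub\<close>)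
  qed
  with sums[OF dW disjoint_family_disjointed, of x]
  have "(\<lambda>n. 0) sums (E (- cball 0 l) \<cdot> x)" by (simp add: UN_disjointed_eq UW)
  hence "E (- cball 0 l) \<cdot> x = 0" using sums_unique2 sums_zero by blast
  thus ?thesis by (simp add: compl D_def[symmetric] ap_sub)
qed

lemma spectrum_le_r: "z \<in> spectrum (Rep_bop A) \<Longrightarrow> cmod z \<le> r"
  unfolding r_def spectral_radius_def
  using spectrum_cmod_le by (auto intro!: cSUP_upper bdd_aboveI2)

lemma r_nonneg: "0 \<le> r"
proof (cases "spectrum (Rep_bop A) = {}")
  case False
  then obtain z where "z \<in> spectrum (Rep_bop A)" by blast
  from spectrum_le_r[OF this] show ?thesis using norm_ge_zero[of z] by linarith
qed (simp add: r_def spectral_radius_def)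

text \<open>The restriction of \<open>A\<close> to this range has spectrum inside both
  \<open>closure \<Omega>\<close> and the spectrum of \<open>A\<close>, hence empty
  spectrum.\<close>

lemma E_zero_of_disjoint_spectrum:
  assumes "\<Omega> \<in> sets borel" "closure \<Omega> \<inter> spectrum (Rep_bop A) = {}"
  shows "E \<Omega> = 0"
proof (rule empty_spectrum_on_imp_zero[OF idem comm])
  show "spectrum_on (range (ap (E \<Omega>))) (Rep_bop A) = {}"
    using sp spectrum_subset_spectrum_on[OF idem comm] assms by blast
qed fact+

text \<open>For \<open>l = r\<close> the closed complement of the disc contains the circle of radius
  \<open>r\<close>, which may meet the spectrum; hence larger radii come first, then right
  continuity.\<close>

lemma D_ge_r: "r \<le> l \<Longrightarrow> D l = 1"
proof (rule bop_eqI)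
  fix x assume l: "r \<le> l"
  have "D m = 1" if m: "m > l" for m
  proof -
    have "closure (- cball (0::complex) m) \<subseteq> {z. m \<le> cmod z}"
      by (rule closure_minimal) (auto intro: closed_Collect_le continuous_intros)
    hence "E (- cball 0 m) = 0"
      using spectrum_le_r l m by (intro E_zero_of_disjoint_spectrum) fastforce+
    thus ?thesis by (simp add: compl D_def)
  qed
  thus "D l \<cdot> x = 1 \<cdot> x" using D_right_continuous[of l x] by simp
qed

lemma D_eq_of_spectral_gap:
  assumes ab: "a \<le> b" and gap: "\<And>z. z \<in> spectrum (Rep_bop A) \<Longrightarrow> \<not> (a \<le> cmod z \<and> cmod z \<le> b)"
  shows "D b = D a"
proof -
  have "closure (cball 0 b \<inter> - cball (0::complex) a) \<subseteq> {z. a \<le> cmod z \<and> cmod z \<le> b}"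
    by (rule closure_minimal) (auto intro!: closed_Collect_conj closed_Collect_le continuous_intros)
  hence "E (cball 0 b \<inter> - cball 0 a) = 0"
    by (intro E_zero_of_disjoint_spectrum) (use gap in \<open>auto intro: sets.Int borel_closed\<close>)
  thus ?thesis using E_diff_cball[OF ab] by simp
qed

text \<open>Otherwise the complement of the annulus would carry the identity, and its closure would
  contain the whole spectrum. The strict inequalities keep \<open>z\<close> off the boundary
  circles.\<close>

lemma D_neq_of_spectrum:
  assumes z: "z \<in> spectrum (Rep_bop A)" "a < cmod z" "cmod z < b"
  shows "D b \<noteq> D a"
proof
  assume "D b = D a"
  hence "E (- (cball 0 b \<inter> - cball 0 a)) = 1"
    using E_diff_cball[of a b] z by (subst compl) auto
  hence "spectrum (Rep_bop A) \<subseteq> closure (- (cball 0 b \<inter> - cball 0 a))"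
    using sp[of "- (cball 0 b \<inter> - cball 0 a)"] by (simp add: spectrum_def)
  also have "\<dots> \<subseteq> {w. cmod w \<le> a \<or> b \<le> cmod w}"
    by (rule closure_minimal) (auto intro!: closed_Collect_disj closed_Collect_le continuous_intros)
  finally show False using z by auto
qed

lemma growth_above:
  assumes "0 \<le> l" "l < \<rho>"
  shows "\<exists>C\<ge>0. \<forall>n x. D l \<cdot> x = x \<longrightarrow> norm (A ^ n \<cdot> x) \<le> C * \<rho> ^ n * norm x"
proof -
  have "spectrum_on (range (ap (D l))) (Rep_bop A) \<subseteq> cball 0 l"
    using sp[of "cball 0 l"] by (simp add: D_def)
  from power_bound_above[OF D_idem D_comm this assms] obtain C where
    C: "C \<ge> 0" "\<And>n. norm (A ^ n * D l) \<le> C * \<rho> ^ n" by blast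
  have "norm (A ^ n \<cdot> x) \<le> C * \<rho> ^ n * norm x" if "D l \<cdot> x = x" for n x
  proof -
    have "norm (A ^ n \<cdot> x) \<le> norm (A ^ n * D l) * norm x"
      using norm_ap[of "A ^ n * D l" x] that by simp
    also have "\<dots> \<le> C * \<rho> ^ n * norm x" by (intro mult_right_mono C) simp
    finally show ?thesis .
  qed
  with C(1) show ?thesis by blast
qed

lemma norm_one_diff_D: "norm ((1 - D l) \<cdot> x) \<le> M * norm x"
proof -
  have "norm (E (- cball 0 l)) \<le> M" by (intro bound) simp
  hence "norm (1 - D l) \<le> M" by (simp add: compl D_def)
  thus ?thesis by (meson mult_right_mono norm_ap norm_ge_zero order.trans)
qed

text \<open>Since \<open>1 - D l\<close> commutes with \<open>A\<close> and is bounded by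
  \<open>M\<close>, the estimate for its range holds for arbitrary \<open>x\<close>, with
  \<open>A ^ n \<cdot> x\<close> itself on the right.\<close>

lemma growth_below:
  assumes "0 < \<rho>" "\<rho> < l"
  shows "\<exists>C\<ge>0. \<forall>n x. \<rho> ^ n * norm ((1 - D l) \<cdot> x) \<le> C * norm (A ^ n \<cdot> x)"
proof -
  have c: "E (- cball 0 l) = 1 - D l" by (simp add: compl D_def)
  have "closure (- cball (0::complex) l) \<subseteq> {z. l \<le> cmod z}"
    by (rule closure_minimal) (auto intro: closed_Collect_le continuous_intros)
  hence s: "spectrum_on (range (ap (1 - D l))) (Rep_bop A) \<subseteq> {z. l \<le> cmod z}"
    using sp[of "- cball 0 l"] by (simp add: c)
  have i: "(1 - D l) * (1 - D l) = 1 - D l" and cm: "A * (1 - D l) = (1 - D l) * A"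
    using idem[of "- cball 0 l"] comm[of "- cball 0 l"] by (simp_all add: c)
  from power_bound_below[OF i cm s assms] obtain C where
    C: "C \<ge> 0" "\<And>n x. \<rho> ^ n * norm ((1 - D l) \<cdot> x) \<le> C * norm (A ^ n \<cdot> ((1 - D l) \<cdot> x))" by blast
  have M: "0 \<le> M" by (rule order.trans[OF norm_ge_zero bound[of "{}"]]) simp
  have "\<rho> ^ n * norm ((1 - D l) \<cdot> x) \<le> (C * M) * norm (A ^ n \<cdot> x)" for n x
  proof -
    have "A ^ n \<cdot> ((1 - D l) \<cdot> x) = (1 - D l) \<cdot> (A ^ n \<cdot> x)"
      using arg_cong[OF commute_power[OF cm[symmetric], of n], of "\<lambda>X. X \<cdot> x"] by simp
    hence "\<rho> ^ n * norm ((1 - D l) \<cdot> x) \<le> C * norm ((1 - D l) \<cdot> (A ^ n \<cdot> x))"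
      using C(2)[of n x] by simp
    also have "\<dots> \<le> C * (M * norm (A ^ n \<cdot> x))" by (intro mult_left_mono norm_one_diff_D C)
    finally show ?thesis by simp
  qed
  thus ?thesis using C(1) M by (intro exI[of _ "C * M"]) auto
qed

text \<open>Right continuity makes the infimum of the admissible radii a minimum. The growth
  constants disappear because \<open>root n K\<close> tends to 1 for every
  \<open>K > 0\<close>.\<close>

lemma local_spectral_radius:
  "\<exists>l\<ge>0. D l \<cdot> x = x \<and> (\<forall>m\<ge>0. D m \<cdot> x = x \<longrightarrow> l \<le> m) \<and>
     (\<lambda>n. root n (norm (A ^ n \<cdot> x))) \<longlonglongrightarrow> l"
proof -
  define L where "L = {m. 0 \<le> m \<and> D m \<cdot> x = x}"
  have rL: "r \<in> L" using r_nonneg D_ge_r[of r] by (simp add: L_def)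
  have bdd: "bdd_below L" by (auto simp: L_def)
  define l where "l = Inf L"
  have l0: "0 \<le> l" unfolding l_def using rL by (intro cInf_greatest) (auto simp: L_def)
  have "D m \<cdot> x = x" if "m > l" for m
  proof -
    have "\<exists>m'\<in>L. m' < m" using cInf_lessD[of L m] rL that unfolding l_def by blast
    then obtain m' where m': "D m' \<cdot> x = x" "m' < m" by (auto simp: L_def)
    have "D m \<cdot> (D m' \<cdot> x) = D m' \<cdot> x"
      using arg_cong[OF D_mult(2)[of m' m], of "\<lambda>X. X \<cdot> x"] m' by simp
    thus ?thesis by (simp add: m')
  qed
  hence Dl: "D l \<cdot> x = x" by (rule D_right_continuous)
  have lm: "l \<le> m" if "0 \<le> m" "D m \<cdot> x = x" for m
    unfolding l_def by (rule cInf_lower[OF _ bdd]) (use that in \<open>simp add: L_def\<close>)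
  have "(\<lambda>n. root n (norm (A ^ n \<cdot> x))) \<longlonglongrightarrow> l"
  proof (rule order_tendstoI)
    fix a assume a: "l < a"
    obtain \<rho> where \<rho>: "l < \<rho>" "\<rho> < a" using a dense by blast
    obtain C where C: "C \<ge> 0" "\<And>n. norm (A ^ n \<cdot> x) \<le> C * \<rho> ^ n * norm x"
      using growth_above[OF l0 \<rho>(1)] Dl by blast
    \<comment> \<open>The summand 1 keeps \<open>K\<close> positive when
      \<open>C * norm x = 0\<close>, so that its roots tend to 1.\<close>
    define K where "K = C * norm x + 1"
    have K: "K > 0" using C by (simp add: K_def add_nonneg_pos)
    have "(\<lambda>n. root n K * \<rho>) \<longlonglongrightarrow> 1 * \<rho>" by (intro tendsto_intros LIMSEQ_root_const K)
    hence "\<forall>\<^sub>F n in sequentially. root n K * \<rho> < a" using \<rho> by (intro order_tendstoD(2)) auto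
    moreover have "\<forall>\<^sub>F n in sequentially. n \<ge> 1" by (rule eventually_ge_at_top)
    ultimately show "\<forall>\<^sub>F n in sequentially. root n (norm (A ^ n \<cdot> x)) < a"
    proof eventually_elim
      case (elim n)
      have "norm (A ^ n \<cdot> x) \<le> K * \<rho> ^ n"
      proof -
        have "0 \<le> \<rho> ^ n" using \<rho> l0 by simp
        moreover have "K * \<rho> ^ n = C * \<rho> ^ n * norm x + \<rho> ^ n" by (simp add: K_def algebra_simps)
        ultimately show ?thesis using C(2)[of n] by linarith
      qed
      hence "root n (norm (A ^ n \<cdot> x)) \<le> root n (K * \<rho> ^ n)" using elim by simp
      also have "\<dots> = root n K * \<rho>"
        using elim \<rho> l0 by (simp add: real_root_mult real_root_power_cancel)
      finally show ?case using elim by simp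
    qed
  next
    fix a assume a: "a < l"
    show "\<forall>\<^sub>F n in sequentially. a < root n (norm (A ^ n \<cdot> x))"
    proof (cases "a < 0")
      case True
      have "\<forall>\<^sub>F n in sequentially. n \<ge> (1::nat)" by (rule eventually_ge_at_top)
      thus ?thesis
      proof eventually_elim
        case (elim n)
        have "0 \<le> root n (norm (A ^ n \<cdot> x))" by (intro real_root_ge_zero) simp
        with True show ?case by linarith
      qed
    next
      case False
      obtain \<rho> where \<rho>: "a < \<rho>" "\<rho> < l" using a dense by blast
      \<comment> \<open>Minimality of \<open>l\<close> gives
        \<open>D \<mu> \<cdot> x \<noteq> x\<close> for \<open>\<mu>\<close> below \<open>l\<close>,
        and the growth rate \<open>\<rho>\<close> has to be smaller still.\<close>
      obtain \<mu> where \<mu>: "\<rho> < \<mu>" "\<mu> < l" using \<rho> dense by blast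
      have \<rho>0: "0 < \<rho>" using False \<rho> by simp
      obtain C where C: "C \<ge> 0" "\<And>n. \<rho> ^ n * norm ((1 - D \<mu>) \<cdot> x) \<le> C * norm (A ^ n \<cdot> x)"
        using growth_below[OF \<rho>0 \<mu>(1)] by blast
      have nz: "(1 - D \<mu>) \<cdot> x \<noteq> 0" using lm[of \<mu>] \<mu> \<rho>0 by (auto simp: ap_sub)
      define K where "K = norm ((1 - D \<mu>) \<cdot> x) / (C + 1)"
      have K: "K > 0" using C nz by (simp add: K_def add_nonneg_pos)
      have "(\<lambda>n. root n K * \<rho>) \<longlonglongrightarrow> 1 * \<rho>" by (intro tendsto_intros LIMSEQ_root_const K)
      hence "\<forall>\<^sub>F n in sequentially. a < root n K * \<rho>" using \<rho> by (intro order_tendstoD(1)) auto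
      moreover have "\<forall>\<^sub>F n in sequentially. n \<ge> 1" by (rule eventually_ge_at_top)
      ultimately show ?thesis
      proof eventually_elim
        case (elim n)
        have "\<rho> ^ n * norm ((1 - D \<mu>) \<cdot> x) \<le> (C + 1) * norm (A ^ n \<cdot> x)"
          using C(2)[of n] norm_ge_zero[of "A ^ n \<cdot> x"] unfolding distrib_right by linarith
        hence "K * \<rho> ^ n \<le> norm (A ^ n \<cdot> x)" using C(1) by (simp add: K_def field_simps)
        hence "root n (K * \<rho> ^ n) \<le> root n (norm (A ^ n \<cdot> x))" using elim by simp
        moreover have "root n (K * \<rho> ^ n) = root n K * \<rho>"
          using elim \<rho>0 by (simp add: real_root_mult real_root_power_cancel)
        ultimately show ?case using elim by simp
      qed
    qed
  qed
  with l0 Dl lm show ?thesis by blast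
qed

section \<open>The orthogonal projections \<open>F l\<close>\<close>

lemma F: "adj (F l) = F l" "F l * D l = D l" "D l * F l = F l"
  using range_proj_Rng[OF D_idem, of l] by (auto simp: F_def range_proj_def)

lemma F_idem: "F l * F l = F l"
  unfolding F_def by (rule range_proj_idem[OF range_proj_Rng[OF D_idem]])

lemma F_mult: "l \<le> m \<Longrightarrow> F m * F l = F l" "l \<le> m \<Longrightarrow> F l * F m = F l"
proof -
  assume "l \<le> m"
  hence "F m * (D m * D l) = D l" using D_mult(2)[of l m] F(2)[of m] by (metis mult.assoc)
  thus *: "F m * F l = F l" using \<open>l \<le> m\<close> F(3)[of l] D_mult(2)[of l m] by (metis mult.assoc)
  from arg_cong[OF this, of adj] show "F l * F m = F l" by (simp add: adj_mult F)
qed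

lemma F_ge_r: "r \<le> l \<Longrightarrow> F l = 1"
  using F(2)[of l] by (simp add: D_ge_r)

lemma F_neg: "l < 0 \<Longrightarrow> F l = 0"
  using F(3)[of l] by (simp add: D_neg)

text \<open>An idempotent is not determined by its range alone, but \<open>D a * D b = D a\<close>
  also orders the kernels. Spectral gaps and spectral points can thus be read off from
  \<open>F\<close>.\<close>

lemma F_eq_iff: "a \<le> b \<Longrightarrow> F b = F a \<longleftrightarrow> D b = D a"
proof
  assume ab: "a \<le> b" and eq: "F b = F a"
  have "D b = D a * (F a * D b)" by (metis F(2) F(3) eq mult.assoc)
  also have "\<dots> = D a" by (metis F(2) eq D_mult(1)[OF ab])
  finally show "D b = D a" .
qed (simp add: F_def)

lemma F_fixed_iff: "F l \<cdot> x = x \<longleftrightarrow> D l \<cdot> x = x"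
  by (metis F(2,3) ap_mult)

text \<open>\<open>1 - F l\<close> kills the range of \<open>D l\<close>, so it absorbs
  \<open>1 - D l\<close> on its right, and it is a contraction.\<close>

lemma norm_one_diff_F_le: "norm ((1 - F l) \<cdot> x) \<le> norm ((1 - D l) \<cdot> x)"
proof -
  have "(1 - F l) * (1 - D l) = 1 - F l"
    by (simp add: left_diff_distrib right_diff_distrib F)
  hence "(1 - F l) \<cdot> x = (1 - F l) \<cdot> ((1 - D l) \<cdot> x)" by (metis ap_mult)
  moreover have "norm ((1 - F l) \<cdot> ((1 - D l) \<cdot> x)) \<le> norm ((1 - D l) \<cdot> x)"
    by (rule norm_projection_le) (simp_all add: left_diff_distrib right_diff_distrib F_idem adj_diff F)
  ultimately show ?thesis by simp
qed

lemma bounded_resolution_F: "bounded_resolution_of_identity (\<lambda>l. Rep_bop (F l))"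
  unfolding bounded_resolution_of_identity_def resolution_of_identity_def
proof (intro conjI allI impI)
  have le: "op_le (Rep_bop (F l)) (Rep_bop (F m))" if "l \<le> m" for l m
    unfolding op_le_Rep_bop by (subst projection_le_iff) (simp_all add: F F_idem F_mult that)
  show pF: "projection_op (Rep_bop (F l))" for l by (simp add: projection_op_Rep_bop F F_idem)
  show "op_le (Rep_bop (F l)) (Rep_bop (F m))" if "l \<le> m" for l m using le that .
  have proj: "\<exists>Q. R = Rep_bop Q \<and> Q * Q = Q \<and> adj Q = Q" if "projection_op R" for R :: "'a \<Rightarrow>\<^sub>L 'a"
    using that by (metis projection_op_Rep_bop projection_op_def Abs_bop_inverse)
  \<comment> \<open>Infimum and supremum over the whole line are attained, at \<open>-1\<close> and
    at \<open>r\<close>; only right continuity requires an argument.\<close>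
  have zero: "(0 :: 'a \<Rightarrow>\<^sub>L 'a) = Rep_bop (F (-1))" by (simp add: F_neg zero_bop.rep_eq)
  have one: "(id_blinfun :: 'a \<Rightarrow>\<^sub>L 'a) = Rep_bop (F r)" by (simp add: F_ge_r one_bop.rep_eq)
  show "is_proj_Inf (range (\<lambda>l. Rep_bop (F l))) 0"
    unfolding is_proj_Inf_def
  proof (intro conjI ballI allI impI)
    show "projection_op (0 :: 'a \<Rightarrow>\<^sub>L 'a)" unfolding zero by (rule pF)
    fix Q assume "Q \<in> range (\<lambda>l. Rep_bop (F l))"
    then obtain l where "Q = Rep_bop (F l)" by blast
    thus "op_le 0 Q"
      using pos_projection[OF F_idem F(1), of l]
      by (simp add: op_le_def positive_op_Rep_bop)
  next
    fix R :: "'a \<Rightarrow>\<^sub>L 'a"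
    assume "projection_op R \<and> (\<forall>Q\<in>range (\<lambda>l. Rep_bop (F l)). op_le R Q)"
    thus "op_le R 0" unfolding zero by blast
  qed
  show "is_proj_Sup (range (\<lambda>l. Rep_bop (F l))) id_blinfun"
    unfolding is_proj_Sup_def
  proof (intro conjI ballI allI impI)
    show "projection_op (id_blinfun :: 'a \<Rightarrow>\<^sub>L 'a)" unfolding one by (rule pF)
    fix Q assume "Q \<in> range (\<lambda>l. Rep_bop (F l))"
    then obtain l where "Q = Rep_bop (F l)" by blast
    moreover have "op_le (Rep_bop (F l)) (Rep_bop (F (max l r)))" by (rule le) simp
    ultimately show "op_le Q id_blinfun" unfolding one by (simp add: F_ge_r)
  next
    fix R :: "'a \<Rightarrow>\<^sub>L 'a"
    assume "projection_op R \<and> (\<forall>Q\<in>range (\<lambda>l. Rep_bop (F l)). op_le Q R)"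
    thus "op_le id_blinfun R" unfolding one by blast
  qed
  show "is_proj_Inf ((\<lambda>l. Rep_bop (F l)) ` {l<..}) (Rep_bop (F l))" for l
    unfolding is_proj_Inf_def
  proof (intro conjI ballI allI impI)
    show "projection_op (Rep_bop (F l))" by (rule pF)
    show "op_le (Rep_bop (F l)) Q" if "Q \<in> (\<lambda>l. Rep_bop (F l)) ` {l<..}" for Q
      using that le by auto
    fix R :: "'a \<Rightarrow>\<^sub>L 'a"
    assume R: "projection_op R \<and> (\<forall>Q\<in>(\<lambda>l. Rep_bop (F l)) ` {l<..}. op_le R Q)"
    then obtain Q where Q: "R = Rep_bop Q" "Q * Q = Q" "adj Q = Q" using proj by blast
    \<comment> \<open>The range of \<open>Q\<close> is fixed by every \<open>F m\<close> with
      \<open>m > l\<close>, hence by every such \<open>D m\<close>, and right continuity of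
      \<open>D\<close> applies to each of its vectors.\<close>
    have "F m * Q = Q" if "m > l" for m
      using R that projection_le_iff[OF Q(2,3) F_idem F(1), of m] by (auto simp: Q(1) op_le_Rep_bop)
    hence "D m \<cdot> (Q \<cdot> x) = Q \<cdot> x" if "m > l" for m x
      using that F_fixed_iff by (metis ap_mult)
    hence "D l \<cdot> (Q \<cdot> x) = Q \<cdot> x" for x by (rule D_right_continuous)
    hence "F l * Q = Q" by (intro bop_eqI) (simp add: F_fixed_iff)
    thus "op_le R (Rep_bop (F l))"
      unfolding Q(1) op_le_Rep_bop by (subst projection_le_iff) (simp_all add: Q F F_idem)
  qed
  show "\<exists>a. (\<forall>l < - a. Rep_bop (F l) = 0) \<and> (\<forall>l>a. Rep_bop (F l) = id_blinfun)"
    using r_nonneg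
    by (intro exI[of _ r]) (auto simp: F_neg F_ge_r zero_bop.rep_eq one_bop.rep_eq)
qed

end

section \<open>Orthogonal sums of projections\<close>

locale orth_projections =
  fixes p :: "'i \<Rightarrow> 'a::complex_hilbert_space bop" and I :: "'i set"
  assumes fin: "finite I"
  and p_adj: "i \<in> I \<Longrightarrow> adj (p i) = p i"
  and p_idem: "i \<in> I \<Longrightarrow> p i * p i = p i"
  and p_orth: "i \<in> I \<Longrightarrow> j \<in> I \<Longrightarrow> i \<noteq> j \<Longrightarrow> p i * p j = 0"
  and p_sum: "(\<Sum>i\<in>I. p i) = 1"
begin

text \<open>Pythagoras, with complex coefficients because it serves to invert
  \<open>Rsum s s k - z\<close> for non-real \<open>z\<close>.\<close>

lemma norm_square_sum:
  "(norm (\<Sum>i\<in>I. c i *\<^sub>C (p i \<cdot> x)))\<^sup>2 = (\<Sum>i\<in>I. (cmod (c i))\<^sup>2 * (norm (p i \<cdot> x))\<^sup>2)"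
proof -
  have o: "cinner (p i \<cdot> x) (p j \<cdot> x) = (if i = j then of_real ((norm (p i \<cdot> x))\<^sup>2) else 0)"
    if "i \<in> I" "j \<in> I" for i j
  proof (cases "i = j")
    case False
    have "cinner (p i \<cdot> x) (p j \<cdot> x) = cinner ((p j * p i) \<cdot> x) x"
      using cinner_adj[of "p j" "p i \<cdot> x" x] that by (simp add: p_adj)
    also have "\<dots> = 0" using False p_orth[of j i] that by simp
    finally show ?thesis using False by simp
  qed (simp add: cinner_self)
  have l: "cinner (\<Sum>i\<in>J. f i) y = (\<Sum>i\<in>J. cinner (f i) y)" for J and f :: "'i \<Rightarrow> 'a" and y
    by (induction J rule: infinite_finite_induct) (simp_all add: cinner_add_left)
  have rr: "cinner y (\<Sum>i\<in>J. f i) = (\<Sum>i\<in>J. cinner y (f i))" for J and f :: "'i \<Rightarrow> 'a" and y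
    by (induction J rule: infinite_finite_induct) (simp_all add: cinner_add_right)
  have "complex_of_real ((norm (\<Sum>i\<in>I. c i *\<^sub>C (p i \<cdot> x)))\<^sup>2)
      = (\<Sum>i\<in>I. \<Sum>j\<in>I. c i * cnj (c j) * cinner (p i \<cdot> x) (p j \<cdot> x))"
    unfolding cinner_self[symmetric] l rr
    by (simp add: cinner_scaleC_left cinner_scaleC_right mult_ac) (rule sum.swap)
  also have "\<dots> = (\<Sum>i\<in>I. \<Sum>j\<in>I. if i = j then c i * cnj (c j) * of_real ((norm (p i \<cdot> x))\<^sup>2) else 0)"
    by (intro sum.cong refl) (simp add: o)
  also have "\<dots> = (\<Sum>i\<in>I. c i * cnj (c i) * of_real ((norm (p i \<cdot> x))\<^sup>2))"
    using fin by simp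
  also have "\<dots> = complex_of_real (\<Sum>i\<in>I. (cmod (c i))\<^sup>2 * (norm (p i \<cdot> x))\<^sup>2)"
    by (simp add: complex_norm_square[symmetric])
  finally show ?thesis using of_real_eq_iff by blast
qed

lemma norm_square_decomp: "(norm x)\<^sup>2 = (\<Sum>i\<in>I. (norm (p i \<cdot> x))\<^sup>2)"
  using norm_square_sum[of "\<lambda>_. 1" x] p_sum by (simp add: ap_sum_left[symmetric])

lemma qf_sum_scaleR: "qf (\<Sum>i\<in>I. c i *\<^sub>R p i) x = (\<Sum>i\<in>I. c i * (norm (p i \<cdot> x))\<^sup>2)"
  unfolding qf_sum qf_simps by (intro sum.cong refl) (simp add: qf_projection p_idem p_adj)

lemma pos_sum_scaleR: "(\<And>i. i \<in> I \<Longrightarrow> 0 \<le> c i) \<Longrightarrow> pos (\<Sum>i\<in>I. c i *\<^sub>R p i)"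
  by (intro pos_sum pos_scaleR pos_projection p_idem p_adj)

lemma sum_scaleR_mult: "(\<Sum>i\<in>I. c i *\<^sub>R p i) * (\<Sum>i\<in>I. d i *\<^sub>R p i) = (\<Sum>i\<in>I. (c i * d i) *\<^sub>R p i)"
proof -
  have "(\<Sum>i\<in>I. c i *\<^sub>R p i) * (\<Sum>j\<in>I. d j *\<^sub>R p j) = (\<Sum>i\<in>I. \<Sum>j\<in>I. (c i * d j) *\<^sub>R (p i * p j))"
    by (simp add: sum_product mult.commute)
  also have "\<dots> = (\<Sum>i\<in>I. \<Sum>j\<in>I. if i = j then (c i * d j) *\<^sub>R p i else 0)"
    by (intro sum.cong refl) (auto simp: p_idem p_orth)
  also have "\<dots> = (\<Sum>i\<in>I. (c i * d i) *\<^sub>R p i)" using fin by simp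
  finally show ?thesis .
qed

lemma sum_scaleR_power: "(\<Sum>i\<in>I. c i *\<^sub>R p i) ^ m = (\<Sum>i\<in>I. c i ^ m *\<^sub>R p i)"
  by (induction m) (simp_all add: p_sum sum_scaleR_mult)

end

section \<open>Convergence of the normalised powers\<close>

text \<open>\<open>T n\<close> stands for the \<open>n\<close>-th root of the absolute value of
  \<open>A ^ n\<close>, and \<open>T_power\<close> is its root-free description;
  \<open>n = 0\<close> is left open since no 0-th root is meant.\<close>

locale normalised_powers = spectral_resolution A E M
  for A :: "'a::complex_hilbert_space bop" and E M +
  fixes T :: "nat \<Rightarrow> 'a bop"
  assumes T_pos: "n \<ge> 1 \<Longrightarrow> pos (T n)"
  and T_power: "n \<ge> 1 \<Longrightarrow> T n ^ (2 * n) = adj (A ^ n) * A ^ n"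
begin

lemma qf_T_power: "n \<ge> 1 \<Longrightarrow> qf (T n ^ (2 * n)) x = (norm (A ^ n \<cdot> x))\<^sup>2"
  by (simp add: T_power qf_adj_mult del: ap_mult)

definition dF :: "(nat \<Rightarrow> real) \<Rightarrow> nat \<Rightarrow> 'a bop"
  where "dF s i = F (s (Suc i)) - F (s i)"

text \<open>
  \<open>pF s\<close> lists \<open>F (s 0)\<close> followed by the increments \<open>dF s\<close>; the index of an increment is that of the
  right end point.
\<close>

definition pF :: "(nat \<Rightarrow> real) \<Rightarrow> nat \<Rightarrow> 'a bop"
  where "pF s i = (case i of 0 \<Rightarrow> F (s 0) | Suc j \<Rightarrow> dF s j)"

lemma pF_simps [simp]: "pF s 0 = F (s 0)" "pF s (Suc i) = dF s i"
  by (simp_all add: pF_def)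

definition partition :: "(nat \<Rightarrow> real) \<Rightarrow> nat \<Rightarrow> bool"
  where "partition s k \<longleftrightarrow> s 0 = 0 \<and> s k = r \<and> (\<forall>i<k. s i \<le> s (Suc i))"

lemma partition_mono: "partition s k \<Longrightarrow> i \<le> j \<Longrightarrow> j \<le> k \<Longrightarrow> s i \<le> s j"
proof (induction j)
  case (Suc j)
  show ?case
  proof (cases "i = Suc j")
    case False
    with Suc have "s i \<le> s j" by simp
    also have "s j \<le> s (Suc j)" using Suc.prems by (simp add: partition_def)
    finally show ?thesis .
  qed simp
qed simp

lemma partition_nonneg: "partition s k \<Longrightarrow> i \<le> k \<Longrightarrow> 0 \<le> s i"
  using partition_mono[of s k 0 i] by (simp add: partition_def)

lemma partition_le_r: "partition s k \<Longrightarrow> i \<le> k \<Longrightarrow> s i \<le> r"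
  using partition_mono[of s k i k] by (simp add: partition_def)

lemma F_pF: "partition s k \<Longrightarrow> i \<le> j \<Longrightarrow> j \<le> k \<Longrightarrow> F (s j) * pF s i = pF s i"
  using partition_mono[of s k]
  by (cases i) (auto simp: dF_def right_diff_distrib F_mult)

lemma F_pF_zero: "partition s k \<Longrightarrow> i \<le> j \<Longrightarrow> j < k \<Longrightarrow> F (s i) * pF s (Suc j) = 0"
  using partition_mono[of s k]
  by (auto simp: dF_def right_diff_distrib F_mult)

lemma adj_pF: "adj (pF s i) = pF s i"
  by (cases i) (auto simp: dF_def adj_diff F)

lemma orth_projections_pF:
  assumes s: "partition s k"
  shows "orth_projections (pF s) {..k}"
proof
  show "finite {..k}" by simp
  show "adj (pF s i) = pF s i" for i by (rule adj_pF)
  show idem: "pF s i * pF s i = pF s i" if "i \<in> {..k}" for i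
  proof (cases i)
    case (Suc j)
    have "F (s i) * pF s i = pF s i" "F (s j) * pF s i = 0"
      using F_pF[OF s, of i i] F_pF_zero[OF s, of j j] that Suc by auto
    thus ?thesis unfolding Suc by (simp add: dF_def left_diff_distrib)
  qed (simp add: F_idem)
  have orth: "pF s i * pF s j = 0" if "i < j" "j \<le> k" for i j
  proof -
    obtain j' where j: "j = Suc j'" using \<open>i < j\<close> by (cases j) auto
    have "pF s i = pF s i * F (s i)"
      using arg_cong[OF F_pF[OF s, of i i], of adj] that by (simp add: adj_mult adj_pF F)
    hence "pF s i * pF s j = pF s i * (F (s i) * pF s j)" by (metis mult.assoc)
    also have "F (s i) * pF s j = 0" unfolding j using that j by (intro F_pF_zero[OF s]) auto
    finally show ?thesis by simp
  qed
  show "pF s i * pF s j = 0" if "i \<in> {..k}" "j \<in> {..k}" "i \<noteq> j" for i j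
  proof (cases "i < j")
    case False
    hence "pF s j * pF s i = 0" using that by (intro orth) auto
    from arg_cong[OF this, of adj] show ?thesis by (simp add: adj_mult adj_pF)
  qed (use orth that in auto)
  have "(\<Sum>i\<le>j. pF s i) = F (s j)" for j
    by (induction j) (simp_all add: dF_def)
  thus "(\<Sum>i\<le>k. pF s i) = 1" using s F_ge_r by (simp add: partition_def)
qed

lemma sum_pF_eq: "(\<Sum>i\<le>k. f i) = f 0 + (\<Sum>i<k. f (Suc i))" for f :: "nat \<Rightarrow> real"
  unfolding lessThan_Suc_atMost[symmetric] by (rule sum.lessThan_Suc_shift)

text \<open>Each piece \<open>pF s i\<close> lies in the range of \<open>D (s i)\<close> and grows
  at most at rate \<open>s i + \<epsilon>\<close>. The partition is fixed, so one \<open>L\<close>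
  serves all \<open>n\<close>, and only its \<open>2 * n\<close>-th root survives.\<close>

lemma upper_estimate:
  assumes s: "partition s k" and e: "\<epsilon> > 0"
  shows "\<exists>L>0. \<forall>n\<ge>1. \<forall>x. qf (T n) x \<le> root (2 * n) L * (\<Sum>i\<le>k. (s i + \<epsilon>) * (norm (pF s i \<cdot> x))\<^sup>2)"
proof -
  interpret p: orth_projections "pF s" "{..k}" using s by (rule orth_projections_pF)
  have "\<forall>i\<in>{..k}. \<exists>C\<ge>0. \<forall>n x. D (s i) \<cdot> x = x \<longrightarrow> norm (A ^ n \<cdot> x) \<le> C * (s i + \<epsilon>) ^ n * norm x"
    using partition_nonneg[OF s] e by (intro ballI growth_above) auto
  then obtain C where C: "\<And>i. i \<le> k \<Longrightarrow> C i \<ge> 0"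
    "\<And>i n x. i \<le> k \<Longrightarrow> D (s i) \<cdot> x = x \<Longrightarrow> norm (A ^ n \<cdot> x) \<le> C i * (s i + \<epsilon>) ^ n * norm x"
    unfolding bchoice_iff by auto
  define c where "c = (\<Sum>i\<le>k. (C i)\<^sup>2)"
  have c: "(C i)\<^sup>2 \<le> c" if "i \<le> k" for i
    unfolding c_def using that by (intro member_le_sum) auto
  have c0: "0 \<le> c" unfolding c_def by (intro sum_nonneg) auto
  define L where "L = real (Suc k) * c + 1"
  have L: "L > 0" unfolding L_def using c0 by (intro add_nonneg_pos mult_nonneg_nonneg) auto
  define K where "K = (\<Sum>i\<le>k. (s i + \<epsilon>) *\<^sub>R pF s i)"
  have K: "pos K"
    unfolding K_def using partition_nonneg[OF s] e by (intro p.pos_sum_scaleR) (simp add: add_nonneg_nonneg)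
  have "qf (T n) x \<le> root (2 * n) L * (\<Sum>i\<le>k. (s i + \<epsilon>) * (norm (pF s i \<cdot> x))\<^sup>2)" if n: "n \<ge> 1" for n x
  proof -
    \<comment> \<open>Loewner--Heinz needs the constant inside the power, hence the factor
      \<open>root (2 * n) L\<close>.\<close>
    have "qf (T n ^ (2 * n)) y \<le> qf ((root (2 * n) L *\<^sub>R K) ^ (2 * n)) y" for y
    proof -
      have yd: "y = (\<Sum>i\<le>k. pF s i \<cdot> y)" using p.p_sum by (simp add: ap_sum_left[symmetric])
      have "norm (A ^ n \<cdot> y) \<le> (\<Sum>i\<le>k. norm (A ^ n \<cdot> (pF s i \<cdot> y)))"
        by (subst yd, subst ap_sum) (rule norm_sum)
      hence "(norm (A ^ n \<cdot> y))\<^sup>2 \<le> (\<Sum>i\<le>k. norm (A ^ n \<cdot> (pF s i \<cdot> y)))\<^sup>2"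
        by (rule power_mono) simp
      \<comment> \<open>The images under \<open>A ^ n\<close> of the orthogonal pieces need not be
        orthogonal; Cauchy--Schwarz costs a factor \<open>k + 1\<close>, independent of
        \<open>n\<close>.\<close>
      also have "\<dots> \<le> real (Suc k) * (\<Sum>i\<le>k. (norm (A ^ n \<cdot> (pF s i \<cdot> y)))\<^sup>2)"
        using sum_squared_le_sum_of_squares[of "\<lambda>i. norm (A ^ n \<cdot> (pF s i \<cdot> y))" "{..k}"] by (simp add: mult.commute)
      also have "\<dots> \<le> real (Suc k) * (\<Sum>i\<le>k. (C i)\<^sup>2 * ((s i + \<epsilon>) ^ (2 * n) * (norm (pF s i \<cdot> y))\<^sup>2))"
      proof (intro mult_left_mono sum_mono)
        fix i assume i: "i \<in> {..k}"
        have "F (s i) \<cdot> (pF s i \<cdot> y) = pF s i \<cdot> y"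
          using F_pF[OF s, of i i] i by (metis ap_mult atMost_iff order_refl)
        hence "D (s i) \<cdot> (pF s i \<cdot> y) = pF s i \<cdot> y" by (simp add: F_fixed_iff)
        hence "norm (A ^ n \<cdot> (pF s i \<cdot> y)) \<le> C i * (s i + \<epsilon>) ^ n * norm (pF s i \<cdot> y)"
          using C(2) i by simp
        hence "(norm (A ^ n \<cdot> (pF s i \<cdot> y)))\<^sup>2 \<le> (C i * (s i + \<epsilon>) ^ n * norm (pF s i \<cdot> y))\<^sup>2"
          by (rule power_mono) simp
        thus "(norm (A ^ n \<cdot> (pF s i \<cdot> y)))\<^sup>2
            \<le> (C i)\<^sup>2 * ((s i + \<epsilon>) ^ (2 * n) * (norm (pF s i \<cdot> y))\<^sup>2)"
          by (simp add: power_mult_distrib power_mult[symmetric] mult_ac)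
      qed simp
      also have "\<dots> \<le> real (Suc k) * (\<Sum>i\<le>k. c * ((s i + \<epsilon>) ^ (2 * n) * (norm (pF s i \<cdot> y))\<^sup>2))"
        by (intro mult_left_mono sum_mono mult_right_mono c mult_nonneg_nonneg) auto
      also have "\<dots> = (real (Suc k) * c) * qf (K ^ (2 * n)) y"
        by (simp add: K_def p.sum_scaleR_power p.qf_sum_scaleR sum_distrib_left mult_ac)
      also have "\<dots> \<le> L * qf (K ^ (2 * n)) y"
        using posD_qf[OF pos_power[OF K]] by (intro mult_right_mono) (auto simp: L_def)
      also have "\<dots> = qf ((root (2 * n) L *\<^sub>R K) ^ (2 * n)) y"
        using L n by (simp add: scaleR_power_bop qf_simps real_root_pow_pos2)
      finally show ?thesis unfolding qf_T_power[OF n] .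
    qed
    note le = this
    have "pos (root (2 * n) L *\<^sub>R K)"
      using L K by (intro pos_scaleR real_root_ge_zero) auto
    from Loewner_Heinz[OF T_pos[OF n] this _ le] have "qf (T n) x \<le> qf (root (2 * n) L *\<^sub>R K) x"
      using n by simp
    also have "\<dots> = root (2 * n) L * (\<Sum>i\<le>k. (s i + \<epsilon>) * (norm (pF s i \<cdot> x))\<^sup>2)"
      by (simp add: qf_simps K_def p.qf_sum_scaleR)
    finally show ?thesis .
  qed
  with L show ?thesis by blast
qed

lemma lower_estimate:
  assumes s: "partition s k" and e: "\<epsilon> > 0"
  shows "\<exists>L>0. \<forall>n\<ge>1. \<forall>x. (\<Sum>i<k. (s i - \<epsilon>) * (norm (dF s i \<cdot> x))\<^sup>2) \<le> root (2 * n) L * qf (T n) x"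
proof -
  interpret p: orth_projections "pF s" "{..k}" using s by (rule orth_projections_pF)
  \<comment> \<open>Clipping at 0 makes \<open>K\<close> positive, as Loewner--Heinz demands; even
    powers of negative rates would falsify the bound. The piece \<open>F (s 0)\<close> gets rate
    0.\<close>
  define \<kappa> where "\<kappa> i = (case i of 0 \<Rightarrow> 0 | Suc j \<Rightarrow> max 0 (s j - \<epsilon>))" for i
  have \<kappa>0: "\<kappa> i \<ge> 0" for i by (simp add: \<kappa>_def split: nat.split)
  \<comment> \<open>For rate 0 the constant 0 works, but only from \<open>n = 1\<close> on, since
    \<open>0 ^ 0 = 1\<close>.\<close>
  have "\<forall>i\<in>{..k}. \<exists>C\<ge>0. \<forall>n x. n \<ge> 1 \<longrightarrow> \<kappa> i ^ n * norm (pF s i \<cdot> x) \<le> C * norm (A ^ n \<cdot> x)"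
  proof
    fix i assume i: "i \<in> {..k}"
    show "\<exists>C\<ge>0. \<forall>n x. n \<ge> 1 \<longrightarrow> \<kappa> i ^ n * norm (pF s i \<cdot> x) \<le> C * norm (A ^ n \<cdot> x)"
    proof (cases "\<kappa> i = 0")
      case False
      then obtain j where j: "i = Suc j" "\<kappa> i = s j - \<epsilon>" "s j - \<epsilon> > 0"
        by (cases i) (auto simp: \<kappa>_def max_def split: if_splits)
      obtain C where C: "C \<ge> 0" "\<And>n x. (s j - \<epsilon>) ^ n * norm ((1 - D (s j)) \<cdot> x) \<le> C * norm (A ^ n \<cdot> x)"
        using growth_below[of "s j - \<epsilon>" "s j"] j e by auto
      have "\<kappa> i ^ n * norm (pF s i \<cdot> x) \<le> C * norm (A ^ n \<cdot> x)" for n x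
      proof -
        have "pF s i * F (s j) = 0"
          using arg_cong[OF F_pF_zero[OF s, of j j], of adj] i j by (simp add: adj_mult adj_pF F del: pF_simps)
        hence "pF s i \<cdot> x = pF s i \<cdot> ((1 - F (s j)) \<cdot> x)"
          by (metis ap_mult right_diff_distrib diff_zero mult_1_right)
        also have "norm \<dots> \<le> norm ((1 - F (s j)) \<cdot> x)"
          using i by (intro norm_projection_le p.p_idem p.p_adj) auto
        also have "\<dots> \<le> norm ((1 - D (s j)) \<cdot> x)" by (rule norm_one_diff_F_le)
        finally have "\<kappa> i ^ n * norm (pF s i \<cdot> x) \<le> (s j - \<epsilon>) ^ n * norm ((1 - D (s j)) \<cdot> x)"
          unfolding j(2) using j(3) by (intro mult_left_mono) auto
        with C(2)[of n x] show ?thesis by linarith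
      qed
      with C(1) show ?thesis by blast
    qed (intro exI[of _ 0], auto simp: power_0_left)
  qed
  then obtain C where C: "\<And>i. i \<le> k \<Longrightarrow> C i \<ge> 0"
    "\<And>i n x. i \<le> k \<Longrightarrow> n \<ge> 1 \<Longrightarrow> \<kappa> i ^ n * norm (pF s i \<cdot> x) \<le> C i * norm (A ^ n \<cdot> x)"
    unfolding bchoice_iff by auto
  define L where "L = (\<Sum>i\<le>k. (C i)\<^sup>2) + 1"
  have L: "L > 0" unfolding L_def by (intro add_nonneg_pos sum_nonneg) auto
  define K where "K = (\<Sum>i\<le>k. \<kappa> i *\<^sub>R pF s i)"
  have K: "pos K" unfolding K_def using \<kappa>0 by (intro p.pos_sum_scaleR) auto
  have "(\<Sum>i<k. (s i - \<epsilon>) * (norm (dF s i \<cdot> x))\<^sup>2) \<le> root (2 * n) L * qf (T n) x" if n: "n \<ge> 1" for n x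
  proof -
    have "qf (K ^ (2 * n)) y \<le> qf ((root (2 * n) L *\<^sub>R T n) ^ (2 * n)) y" for y
    proof -
      have "qf (K ^ (2 * n)) y = (\<Sum>i\<le>k. (\<kappa> i ^ n * norm (pF s i \<cdot> y))\<^sup>2)"
        by (simp add: K_def p.sum_scaleR_power p.qf_sum_scaleR power_mult_distrib power_mult[symmetric] mult.commute)
      also have "\<dots> \<le> (\<Sum>i\<le>k. (C i * norm (A ^ n \<cdot> y))\<^sup>2)"
        using C(2) n \<kappa>0 by (intro sum_mono power_mono) auto
      also have "\<dots> \<le> L * (norm (A ^ n \<cdot> y))\<^sup>2"
        by (simp add: L_def power_mult_distrib sum_distrib_right[symmetric] distrib_right)
      also have "\<dots> = qf ((root (2 * n) L *\<^sub>R T n) ^ (2 * n)) y"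
        using L n by (simp add: scaleR_power_bop qf_simps real_root_pow_pos2 qf_T_power)
      finally show ?thesis .
    qed
    note le = this
    have "pos (root (2 * n) L *\<^sub>R T n)"
      using L n by (intro pos_scaleR T_pos real_root_ge_zero) auto
    from Loewner_Heinz[OF K this _ le] have "qf K x \<le> qf (root (2 * n) L *\<^sub>R T n) x"
      using n by simp
    also have "\<dots> = root (2 * n) L * qf (T n) x" by (simp add: qf_simps)
    finally have "qf K x \<le> root (2 * n) L * qf (T n) x" .
    moreover have "qf K x = (\<Sum>i<k. max 0 (s i - \<epsilon>) * (norm (dF s i \<cdot> x))\<^sup>2)"
      unfolding K_def p.qf_sum_scaleR sum_pF_eq by (simp add: \<kappa>_def)
    moreover have "(\<Sum>i<k. (s i - \<epsilon>) * (norm (dF s i \<cdot> x))\<^sup>2) \<le> \<dots>"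
      by (intro sum_mono mult_right_mono) auto
    ultimately show ?thesis by linarith
  qed
  with L show ?thesis by blast
qed

lemma LIMSEQ_root_2n: "L > 0 \<Longrightarrow> (\<lambda>n. root (2 * n) L) \<longlonglongrightarrow> 1"
  using LIMSEQ_subseq_LIMSEQ[OF LIMSEQ_root_const, of L "\<lambda>n. 2 * n"]
  by (simp add: o_def strict_mono_def)

lemma T_squeeze:
  assumes s: "partition s k" and e: "\<epsilon> > 0"
  shows "\<forall>\<^sub>F n in sequentially. \<forall>x.
    qf (T n) x \<le> (\<Sum>i<k. s (Suc i) * (norm (dF s i \<cdot> x))\<^sup>2) + \<epsilon> * (norm x)\<^sup>2 \<and>
    (\<Sum>i<k. s i * (norm (dF s i \<cdot> x))\<^sup>2) - \<epsilon> * (norm x)\<^sup>2 \<le> qf (T n) x"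
proof -
  interpret p: orth_projections "pF s" "{..k}" using s by (rule orth_projections_pF)
  define d where "d = \<epsilon> / 2"
  have d: "d > 0" using e by (simp add: d_def)
  obtain L where L: "L > 0" "\<And>n x. n \<ge> 1 \<Longrightarrow>
      qf (T n) x \<le> root (2 * n) L * (\<Sum>i\<le>k. (s i + d) * (norm (pF s i \<cdot> x))\<^sup>2)"
    using upper_estimate[OF s d] by blast
  obtain L' where L': "L' > 0" "\<And>n x. n \<ge> 1 \<Longrightarrow>
      (\<Sum>i<k. (s i - d) * (norm (dF s i \<cdot> x))\<^sup>2) \<le> root (2 * n) L' * qf (T n) x"
    using lower_estimate[OF s d] by blast
  \<comment> \<open>\<open>R\<close> bounds the form \<open>U\<close> relative to the square of the
    norm, so a factor \<open>1 + d / R\<close> adds at most \<open>d\<close>; for the lower bound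
    \<open>R + d\<close> plays this role for \<open>T n\<close>.\<close>
  define R where "R = r + d"
  have R: "R > 0" using d r_nonneg by (simp add: R_def)
  have dec: "(\<Sum>i\<le>k. (norm (pF s i \<cdot> x))\<^sup>2) = (norm x)\<^sup>2" for x
    using p.norm_square_decomp[of x] by simp
  have decd: "(\<Sum>i<k. (norm (dF s i \<cdot> x))\<^sup>2) \<le> (norm x)\<^sup>2" for x
    using dec[of x] zero_le_power2[of "norm (F (s 0) \<cdot> x)"] unfolding sum_pF_eq pF_simps by linarith
  have "\<forall>\<^sub>F n in sequentially. root (2 * n) L < 1 + d / R"
    using R d by (intro order_tendstoD(2)[OF LIMSEQ_root_2n[OF L(1)]]) auto
  moreover have "\<forall>\<^sub>F n in sequentially. root (2 * n) L' < 1 + d / (R + d)"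
    using R d by (intro order_tendstoD(2)[OF LIMSEQ_root_2n[OF L'(1)]]) auto
  moreover have "\<forall>\<^sub>F n in sequentially. n \<ge> 1" by (rule eventually_ge_at_top)
  ultimately show ?thesis
  proof eventually_elim
    case (elim n)
    show ?case
    proof
      fix x
      define U where "U = (\<Sum>i\<le>k. (s i + d) * (norm (pF s i \<cdot> x))\<^sup>2)"
      have U0: "0 \<le> U" unfolding U_def using partition_nonneg[OF s] d by (intro sum_nonneg mult_nonneg_nonneg) (auto simp: add_nonneg_nonneg)
      have "U \<le> (\<Sum>i\<le>k. R * (norm (pF s i \<cdot> x))\<^sup>2)"
        unfolding U_def R_def using partition_le_r[OF s] by (intro sum_mono mult_right_mono) auto
      hence UR: "U \<le> R * (norm x)\<^sup>2" by (simp add: sum_distrib_left[symmetric] dec)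
      have "qf (T n) x \<le> root (2 * n) L * U" unfolding U_def by (rule L(2)[OF elim(3)])
      also have "\<dots> \<le> (1 + d / R) * U" using elim U0 by (intro mult_right_mono) auto
      also have "\<dots> = U + d * (U / R)" by (simp add: algebra_simps)
      also have "U / R \<le> (norm x)\<^sup>2" using UR R by (simp add: field_simps)
      hence "U + d * (U / R) \<le> U + d * (norm x)\<^sup>2"
        using d by (intro add_left_mono mult_left_mono) auto
      finally have T1: "qf (T n) x \<le> U + d * (norm x)\<^sup>2" .
      have "U = (\<Sum>i\<le>k. s i * (norm (pF s i \<cdot> x))\<^sup>2) + d * (norm x)\<^sup>2"
        by (simp add: U_def distrib_right sum.distrib sum_distrib_left[symmetric] dec)
      \<comment> \<open>The piece \<open>F (s 0)\<close> drops out because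
        \<open>s 0 = 0\<close>.\<close>
      also have "(\<Sum>i\<le>k. s i * (norm (pF s i \<cdot> x))\<^sup>2) = (\<Sum>i<k. s (Suc i) * (norm (dF s i \<cdot> x))\<^sup>2)"
        unfolding sum_pF_eq using s by (simp add: partition_def)
      finally have U: "U = (\<Sum>i<k. s (Suc i) * (norm (dF s i \<cdot> x))\<^sup>2) + d * (norm x)\<^sup>2" .
      have Tpos: "0 \<le> qf (T n) x" using T_pos[OF elim(3)] by (rule posD_qf)
      have "(\<Sum>i<k. (s i - d) * (norm (dF s i \<cdot> x))\<^sup>2) \<le> root (2 * n) L' * qf (T n) x"
        by (rule L'(2)[OF elim(3)])
      also have "\<dots> \<le> (1 + d / (R + d)) * qf (T n) x" using elim Tpos by (intro mult_right_mono) auto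
      also have "\<dots> = qf (T n) x + d * (qf (T n) x / (R + d))" by (simp add: algebra_simps)
      also have "qf (T n) x / (R + d) \<le> (norm x)\<^sup>2"
        using T1 UR R d by (simp add: field_simps)
      hence "qf (T n) x + d * (qf (T n) x / (R + d)) \<le> qf (T n) x + d * (norm x)\<^sup>2"
        using d by (intro add_left_mono mult_left_mono) auto
      finally have "(\<Sum>i<k. s i * (norm (dF s i \<cdot> x))\<^sup>2) - d * (\<Sum>i<k. (norm (dF s i \<cdot> x))\<^sup>2) \<le> qf (T n) x + d * (norm x)\<^sup>2"
        by (simp add: left_diff_distrib sum_subtractf sum_distrib_left)
      moreover have "d * (\<Sum>i<k. (norm (dF s i \<cdot> x))\<^sup>2) \<le> d * (norm x)\<^sup>2"
        using decd d by (intro mult_left_mono) auto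
      moreover have "\<epsilon> * (norm x)\<^sup>2 = d * (norm x)\<^sup>2 + d * (norm x)\<^sup>2" by (simp add: d_def)
      ultimately show "qf (T n) x \<le> (\<Sum>i<k. s (Suc i) * (norm (dF s i \<cdot> x))\<^sup>2) + \<epsilon> * (norm x)\<^sup>2 \<and>
          (\<Sum>i<k. s i * (norm (dF s i \<cdot> x))\<^sup>2) - \<epsilon> * (norm x)\<^sup>2 \<le> qf (T n) x"
        using T1 U by linarith
    qed
  qed
qed

section \<open>Riemann sums and the limit operator\<close>

definition Rsum :: "(nat \<Rightarrow> real) \<Rightarrow> (nat \<Rightarrow> real) \<Rightarrow> nat \<Rightarrow> 'a bop"
  where "Rsum s t k = (\<Sum>i<k. t i *\<^sub>R dF s i)"

lemma adj_dF: "adj (dF s i) = dF s i"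
  by (simp add: dF_def adj_diff F)

text \<open>Any tag is within \<open>\<delta>\<close> of both ends of its cell, so the form of the
  sum differs by at most \<open>\<delta>\<close> from either side of
  \<open>T_squeeze\<close>.\<close>

lemma Rsum_near_T:
  assumes s: "partition s k" and st: "\<And>i. i < k \<Longrightarrow> s i \<le> t i \<and> t i \<le> s (Suc i) \<and> s (Suc i) - s i < \<delta>"
    and \<delta>: "0 \<le> \<delta>" and e: "\<epsilon> > 0"
  shows "\<forall>\<^sub>F n in sequentially. norm (T n - Rsum s t k) \<le> \<delta> + \<epsilon>"
proof -
  interpret p: orth_projections "pF s" "{..k}" using s by (rule orth_projections_pF)
  have decd: "(\<Sum>i<k. (norm (dF s i \<cdot> x))\<^sup>2) \<le> (norm x)\<^sup>2" for x
    using p.norm_square_decomp[of x] zero_le_power2[of "norm (F (s 0) \<cdot> x)"]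
    unfolding sum_pF_eq pF_simps by linarith
  have qR: "qf (Rsum s t k) x = (\<Sum>i<k. t i * (norm (dF s i \<cdot> x))\<^sup>2)" for x
  proof -
    have "qf (dF s i) x = (norm (dF s i \<cdot> x))\<^sup>2" if "i < k" for i
      using p.p_idem[of "Suc i"] that by (intro qf_projection) (auto simp: adj_dF)
    thus ?thesis by (simp add: Rsum_def qf_sum qf_simps)
  qed
  have "\<forall>\<^sub>F n in sequentially. n \<ge> 1" by (rule eventually_ge_at_top)
  with T_squeeze[OF s e] show ?thesis
  proof eventually_elim
    case (elim n)
    show ?case
    proof (rule norm_le_qf)
      show "adj (T n - Rsum s t k) = T n - Rsum s t k"
        using T_pos[OF elim(2)] by (simp add: Rsum_def adj_diff adj_sum adj_scaleR adj_dF pos_def)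
      show "0 \<le> \<delta> + \<epsilon>" using \<delta> e by simp
      fix x
      have "(\<Sum>i<k. s (Suc i) * (norm (dF s i \<cdot> x))\<^sup>2) \<le> (\<Sum>i<k. (t i + \<delta>) * (norm (dF s i \<cdot> x))\<^sup>2)"
        "(\<Sum>i<k. (t i - \<delta>) * (norm (dF s i \<cdot> x))\<^sup>2) \<le> (\<Sum>i<k. s i * (norm (dF s i \<cdot> x))\<^sup>2)"
        using st by (force intro!: sum_mono mult_right_mono)+
      hence "(\<Sum>i<k. s (Suc i) * (norm (dF s i \<cdot> x))\<^sup>2) \<le> qf (Rsum s t k) x + \<delta> * (\<Sum>i<k. (norm (dF s i \<cdot> x))\<^sup>2)"
        "qf (Rsum s t k) x - \<delta> * (\<Sum>i<k. (norm (dF s i \<cdot> x))\<^sup>2) \<le> (\<Sum>i<k. s i * (norm (dF s i \<cdot> x))\<^sup>2)"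
        unfolding qR by (simp_all add: distrib_right left_diff_distrib sum.distrib sum_subtractf sum_distrib_left)
      moreover have "\<delta> * (\<Sum>i<k. (norm (dF s i \<cdot> x))\<^sup>2) \<le> \<delta> * (norm x)\<^sup>2"
        using decd \<delta> by (intro mult_left_mono) auto
      ultimately show "\<bar>qf (T n - Rsum s t k) x\<bar> \<le> (\<delta> + \<epsilon>) * (norm x)\<^sup>2"
        using elim(1)[rule_format, of x] unfolding qf_simps distrib_right by linarith
    qed
  qed
qed

lemma fine_partition_exists:
  assumes \<delta>: "\<delta> > 0"
  shows "\<exists>s k. partition s k \<and> (\<forall>i<k. s (Suc i) - s i < \<delta>)"
proof -
  obtain k where k: "r / \<delta> < real k" using reals_Archimedean2 by blast
  hence kp: "real k > 0" using r_nonneg \<delta> by (smt (verit) divide_nonneg_nonneg)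
  define s where "s i = real i * (r / k)" for i
  have "partition s k"
    using r_nonneg kp by (auto simp: partition_def s_def intro!: mult_right_mono divide_right_mono)
  moreover have "s (Suc i) - s i < \<delta>" for i
  proof -
    have "s (Suc i) - s i = r / k" by (simp add: s_def algebra_simps add_divide_distrib)
    also have "\<dots> < \<delta>" using k kp \<delta> by (simp add: field_simps)
    finally show ?thesis .
  qed
  ultimately show ?thesis by blast
qed

lemma T_convergent: "convergent T"
proof -
  have "Cauchy T"
  proof (rule metric_CauchyI)
    fix e :: real assume e: "e > 0"
    obtain s k where s: "partition s k" "\<And>i. i < k \<Longrightarrow> s (Suc i) - s i < e / 6"
      using fine_partition_exists[of "e / 6"] e by auto
    have "\<forall>\<^sub>F n in sequentially. norm (T n - Rsum s s k) \<le> e / 6 + e / 6"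
      by (rule Rsum_near_T) (use s e in \<open>auto simp: partition_def\<close>)
    then obtain N where N: "\<And>n. n \<ge> N \<Longrightarrow> norm (T n - Rsum s s k) \<le> e / 3"
      by (auto simp: eventually_sequentially)
    have "dist (T m) (T n) < e" if "m \<ge> N" "n \<ge> N" for m n
    proof -
      have "norm (T m - T n) \<le> norm (T m - Rsum s s k) + norm (T n - Rsum s s k)"
        using norm_triangle_ineq4[of "T m - Rsum s s k" "T n - Rsum s s k"] by simp
      thus ?thesis using N[OF that(1)] N[OF that(2)] e by (simp add: dist_norm)
    qed
    thus "\<exists>N. \<forall>m\<ge>N. \<forall>n\<ge>N. dist (T m) (T n) < e" by blast
  qed
  thus ?thesis by (simp add: Cauchy_convergent_iff)
qed

definition J :: "'a bop" where "J = lim T"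

lemma T_tendsto_J: "T \<longlonglongrightarrow> J"
  unfolding J_def using T_convergent by (simp add: convergent_LIMSEQ_iff)

lemma pos_J: "pos J"
  by (rule pos_tendsto[OF T_tendsto_J])
     (use T_pos in \<open>auto simp: eventually_sequentially intro!: exI[of _ 1]\<close>)

lemma Rsum_near_J:
  assumes "partition s k" "\<And>i. i < k \<Longrightarrow> s i \<le> t i \<and> t i \<le> s (Suc i) \<and> s (Suc i) - s i < \<delta>" "0 \<le> \<delta>"
  shows "norm (J - Rsum s t k) \<le> \<delta>"
proof (rule field_le_epsilon)
  fix e :: real assume e: "e > 0"
  have "(\<lambda>n. norm (T n - Rsum s t k)) \<longlonglongrightarrow> norm (J - Rsum s t k)"
    by (intro tendsto_intros T_tendsto_J)
  from tendsto_upperbound[OF this Rsum_near_T[OF assms e]]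
  show "norm (J - Rsum s t k) \<le> \<delta> + e" by simp
qed

lemma stieltjes_J: "has_stieltjes_integral (\<lambda>l. l) (\<lambda>l. Rep_bop (F l)) 0 r (Rep_bop J)"
  unfolding has_stieltjes_integral_def
proof (intro allI impI)
  fix e :: real assume e: "e > 0"
  show "\<exists>\<delta>>0. \<forall>n s t. s 0 = 0 \<and> s n = r \<and>
      (\<forall>i<n. s i \<le> t i \<and> t i \<le> s (Suc i) \<and> s (Suc i) - s i < \<delta>) \<longrightarrow>
      norm ((\<Sum>i<n. t i *\<^sub>R (Rep_bop (F (s (Suc i))) - Rep_bop (F (s i)))) - Rep_bop J) < e"
  proof (intro exI conjI allI impI)
    show "e / 2 > 0" using e by simp
    fix n and s t :: "nat \<Rightarrow> real"
    assume a: "s 0 = 0 \<and> s n = r \<and>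
      (\<forall>i<n. s i \<le> t i \<and> t i \<le> s (Suc i) \<and> s (Suc i) - s i < e / 2)"
    have p: "partition s n" using a by (fastforce simp: partition_def)
    have Rep_sum: "Rep_bop (sum f K) = (\<Sum>i\<in>K. Rep_bop (f i))" for f :: "nat \<Rightarrow> 'a bop" and K
      by (induction K rule: infinite_finite_induct) (simp_all add: zero_bop.rep_eq plus_bop.rep_eq)
    have "(\<Sum>i<n. t i *\<^sub>R (Rep_bop (F (s (Suc i))) - Rep_bop (F (s i)))) - Rep_bop J
        = Rep_bop (Rsum s t n - J)"
      by (simp add: Rsum_def dF_def Rep_sum minus_bop.rep_eq scaleR_bop.rep_eq)
    hence "norm ((\<Sum>i<n. t i *\<^sub>R (Rep_bop (F (s (Suc i))) - Rep_bop (F (s i)))) - Rep_bop J)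
        = norm (J - Rsum s t n)"
      by (simp add: norm_bop.rep_eq[symmetric] norm_minus_commute)
    also have "\<dots> \<le> e / 2" by (rule Rsum_near_J[OF p]) (use a e in auto)
    finally show "norm ((\<Sum>i<n. t i *\<^sub>R (Rep_bop (F (s (Suc i))) - Rep_bop (F (s i)))) - Rep_bop J) < e"
      using e by simp
  qed
qed

end

section \<open>The spectrum of the limit\<close>

text \<open>\<open>X = J - z\<close> is normal and \<open>adj X * X\<close> is invertible, being
  bounded below; by normality its inverse provides a left and a right inverse of \<open>X\<close>,
  also for non-real \<open>z\<close>.\<close>

lemma selfadjoint_notin_spectrum:
  assumes J: "adj J = J" and c: "c > 0" "\<And>x. c * norm x \<le> norm ((J - scalar_op z) \<cdot> x)"
  shows "z \<notin> spectrum (Rep_bop J)"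
proof -
  have az: "adj (scalar_op z) = scalar_op (cnj z)"
    by (rule adj_eqI) (simp add: cinner_scaleC_left cinner_scaleC_right)
  define X where "X = J - scalar_op z"
  have aX: "adj X = J - scalar_op (cnj z)" by (simp add: X_def adj_diff J az)
  have comm: "X * adj X = adj X * X"
    unfolding aX unfolding X_def
    by (simp add: left_diff_distrib right_diff_distrib scalar_op_commute[of J] scalar_op_mult mult.commute)
  have "c\<^sup>2 * (norm x)\<^sup>2 \<le> qf (adj X * X) x" for x
    unfolding qf_adj_mult power_mult_distrib[symmetric]
    using c(2)[of x] c(1) by (intro power_mono) (auto simp: X_def)
  then obtain W where W: "W * (adj X * X) = 1" "(adj X * X) * W = 1"
    using pos_bounded_below_inverse[OF posD_adj[OF pos_adj_mult], of "c\<^sup>2" X] c(1) by auto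
  have 1: "(W * adj X) * X = 1" "X * (adj X * W) = 1"
    using W comm by (simp_all add: mult.assoc[symmetric])
  have "W * adj X = (W * adj X) * (X * (adj X * W))" by (simp add: 1)
  also have "\<dots> = adj X * W" by (simp only: mult.assoc[symmetric] 1 mult_1_left)
  finally show ?thesis using 1 notin_spectrum_iff[of z J] by (auto simp: X_def)
qed

context normalised_powers
begin

lemma Rsum_dF:
  assumes s: "partition s k" and i: "i < k"
  shows "Rsum s t k * dF s i = t i *\<^sub>R dF s i"
proof -
  interpret p: orth_projections "pF s" "{..k}" using s by (rule orth_projections_pF)
  have "Rsum s t k * dF s i = (\<Sum>j<k. if j = i then t i *\<^sub>R dF s i else 0)"
    unfolding Rsum_def sum_distrib_right
    using p.p_orth[of "Suc _" "Suc i"] p.p_idem[of "Suc i"] i by (intro sum.cong) auto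
  thus ?thesis using i by simp
qed

lemma Rsum_F0:
  assumes s: "partition s k"
  shows "Rsum s t k * F 0 = 0"
proof -
  interpret p: orth_projections "pF s" "{..k}" using s by (rule orth_projections_pF)
  have s0: "s 0 = 0" using s by (simp add: partition_def)
  show ?thesis
    unfolding Rsum_def sum_distrib_right
    using p.p_orth[of "Suc _" 0] by (intro sum.neutral) (auto simp: s0)
qed

lemma compact_spectrum: "compact (spectrum (Rep_bop A))"
proof -
  have "bounded (spectrum (Rep_bop A))"
    using spectrum_cmod_le[of _ A] by (auto simp: bounded_iff)
  thus ?thesis by (simp add: compact_eq_bounded_closed closed_spectrum)
qed

lemma spectrum_J_subset:
  assumes z: "z \<notin> (\<lambda>z. complex_of_real (cmod z)) ` spectrum (Rep_bop A)"
  shows "z \<notin> spectrum (Rep_bop J)"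
proof -
  have "\<exists>\<eta>>0. \<forall>w\<in>spectrum (Rep_bop A). \<eta> \<le> cmod (of_real (cmod w) - z)"
  proof -
    define S where "S = (\<lambda>z. complex_of_real (cmod z)) ` spectrum (Rep_bop A)"
    have "closed S"
      unfolding S_def
      by (intro compact_imp_closed compact_continuous_image continuous_intros compact_spectrum)
    moreover have "z \<notin> S" using z by (auto simp: S_def)
    ultimately obtain \<eta> where "\<eta> > 0" "\<forall>w\<in>S. \<eta> \<le> dist z w"
      using separate_point_closed by blast
    thus ?thesis by (auto simp: S_def dist_norm norm_minus_commute)
  qed
  then obtain \<eta> where \<eta>: "\<eta> > 0" "\<And>w. w \<in> spectrum (Rep_bop A) \<Longrightarrow> \<eta> \<le> cmod (of_real (cmod w) - z)"
    by blast
  \<comment> \<open>If the node of a cell is within \<open>2 * \<delta>\<close> of \<open>z\<close>,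
    every modulus in the cell is within \<open>3 * \<delta> < \<eta>\<close>, so the cell is free of
    spectrum and its increment vanishes. The other cells bound \<open>Rsum - z\<close> below by
    \<open>2 * \<delta>\<close>, and passing to \<open>J\<close> costs
    \<open>\<delta>\<close>.\<close>
  define \<delta> where "\<delta> = \<eta> / 4"
  have \<delta>: "\<delta> > 0" using \<eta> by (simp add: \<delta>_def)
  obtain s k where s: "partition s k" and mesh: "\<And>i. i < k \<Longrightarrow> s (Suc i) - s i < \<delta>"
    using fine_partition_exists[OF \<delta>] by blast
  interpret p: orth_projections "pF s" "{..k}" using s by (rule orth_projections_pF)
  have s0: "s 0 = 0" using s by (simp add: partition_def)
  \<comment> \<open>The alternative \<open>b = 0\<close> is for a possible jump of \<open>F\<close>
    at 0: the interval then starts at \<open>-1\<close>, but moduli are nonnegative.\<close>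
  have gap: "F b = F a" if "a \<le> b" "b - a \<le> \<delta> \<or> b = 0" "cmod (of_real t - z) < 2 * \<delta>"
    "t \<le> b" "a \<le> t" "0 \<le> t" for a b t :: real
  proof -
    have "\<not> (a \<le> cmod w \<and> cmod w \<le> b)" if w: "w \<in> spectrum (Rep_bop A)" for w
    proof
      assume ab: "a \<le> cmod w \<and> cmod w \<le> b"
      have "cmod (of_real (cmod w) - z) \<le> cmod (of_real (cmod w - t)) + cmod (of_real t - z)"
        using norm_triangle_ineq[of "of_real (cmod w - t)" "of_real t - z"] by simp
      also have "cmod (of_real (cmod w - t)) \<le> \<delta>"
        unfolding norm_of_real
        using ab \<open>b - a \<le> \<delta> \<or> b = 0\<close> \<open>t \<le> b\<close> \<open>a \<le> t\<close> \<open>0 \<le> t\<close> \<delta> norm_ge_zero[of w] by linarith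
      finally show False using \<eta>(2)[OF w] \<open>cmod (of_real t - z) < 2 * \<delta>\<close> \<delta> by (simp add: \<delta>_def)
    qed
    hence "D b = D a" by (rule D_eq_of_spectral_gap[OF \<open>a \<le> b\<close>])
    thus ?thesis using F_eq_iff[OF \<open>a \<le> b\<close>] by simp
  qed
  define c where "c i = (case i of 0 \<Rightarrow> - z | Suc j \<Rightarrow> of_real (s j) - z)" for i
  have c: "2 * \<delta> * norm (pF s i \<cdot> x) \<le> cmod (c i) * norm (pF s i \<cdot> x)" if "i \<le> k" for i x
  proof (cases "cmod (c i) < 2 * \<delta>")
    case True
    have "pF s i = 0"
    proof (cases i)
      case 0
      have "F 0 = F (- 1)" using True 0 by (intro gap[of "-1" 0 0]) (auto simp: c_def)
      thus ?thesis using 0 by (simp add: s0 F_neg)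
    next
      case (Suc j)
      have "F (s (Suc j)) = F (s j)"
        using True Suc mesh[of j] that partition_mono[OF s, of j "Suc j"] partition_nonneg[OF s, of j]
        by (intro gap[of "s j" _ "s j"]) (auto simp: c_def)
      thus ?thesis using Suc by (simp add: dF_def)
    qed
    thus ?thesis by simp
  qed (simp add: mult_right_mono)
  have lower: "2 * \<delta> * norm x \<le> norm ((Rsum s s k - scalar_op z) \<cdot> x)" for x
  proof (rule power2_le_imp_le)
    have "(\<Sum>i\<le>k. c i *\<^sub>C (pF s i \<cdot> x)) = (Rsum s s k - scalar_op z) \<cdot> x"
    proof -
      have "(\<Sum>i\<le>k. c i *\<^sub>C (pF s i \<cdot> x))
          = (\<Sum>i\<le>k. of_real (case i of 0 \<Rightarrow> 0 | Suc j \<Rightarrow> s j) *\<^sub>C (pF s i \<cdot> x)) - z *\<^sub>C (\<Sum>i\<le>k. pF s i \<cdot> x)"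
      proof -
        have zs: "z *\<^sub>C (\<Sum>i\<le>k. pF s i \<cdot> x) = (\<Sum>i\<le>k. z *\<^sub>C (pF s i \<cdot> x))"
          using bounded_linear.linear[OF bounded_linear_scaleC[of z]] by (rule linear_sum)
        show ?thesis unfolding zs sum_subtractf[symmetric]
          by (intro sum.cong refl) (simp add: c_def scaleC_diff_left scaleC_minus_left split: nat.split)
      qed
      also have "(\<Sum>i\<le>k. pF s i \<cdot> x) = x" using p.p_sum by (simp add: ap_sum_left[symmetric])
      also have "(\<Sum>i\<le>k. of_real (case i of 0 \<Rightarrow> 0 | Suc j \<Rightarrow> s j) *\<^sub>C (pF s i \<cdot> x)) = Rsum s s k \<cdot> x"
        unfolding lessThan_Suc_atMost[symmetric] sum.lessThan_Suc_shift
        by (simp add: Rsum_def ap_sum_left ap_scaleR_left scaleR_scaleC)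
      finally show ?thesis by (simp add: ap_sub)
    qed
    hence "(norm ((Rsum s s k - scalar_op z) \<cdot> x))\<^sup>2 = (\<Sum>i\<le>k. (cmod (c i) * norm (pF s i \<cdot> x))\<^sup>2)"
      using p.norm_square_sum[of c x] by (simp add: power_mult_distrib)
    also have "\<dots> \<ge> (\<Sum>i\<le>k. (2 * \<delta> * norm (pF s i \<cdot> x))\<^sup>2)"
      using c \<delta> by (intro sum_mono power_mono) auto
    also have "(\<Sum>i\<le>k. (2 * \<delta> * norm (pF s i \<cdot> x))\<^sup>2) = (2 * \<delta> * norm x)\<^sup>2"
      by (simp add: power_mult_distrib sum_distrib_left[symmetric] p.norm_square_decomp[symmetric])
    finally show "(2 * \<delta> * norm x)\<^sup>2 \<le> (norm ((Rsum s s k - scalar_op z) \<cdot> x))\<^sup>2" .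
  qed simp
  have near: "norm (J - Rsum s s k) \<le> \<delta>"
    by (rule Rsum_near_J[OF s]) (use s mesh \<delta> in \<open>auto simp: partition_def\<close>)
  show ?thesis
  proof (rule selfadjoint_notin_spectrum[OF posD_adj[OF pos_J] \<delta>])
    fix x
    have "(Rsum s s k - scalar_op z) \<cdot> x = (J - scalar_op z) \<cdot> x - (J - Rsum s s k) \<cdot> x"
      by (simp add: ap_sub)
    hence "norm ((Rsum s s k - scalar_op z) \<cdot> x) \<le> norm ((J - scalar_op z) \<cdot> x) + norm ((J - Rsum s s k) \<cdot> x)"
      by (metis norm_triangle_ineq4)
    moreover have "norm ((J - Rsum s s k) \<cdot> x) \<le> \<delta> * norm x"
      using norm_ap[of "J - Rsum s s k" x] mult_right_mono[OF near norm_ge_zero[of x]] by linarith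
    ultimately show "\<delta> * norm x \<le> norm ((J - scalar_op z) \<cdot> x)" using lower[of x] by linarith
  qed
qed

text \<open>
  If \<open>J - z\<close> were invertible, the increment of \<open>F\<close> over a small interval around \<open>z\<close> would vanish. The
  partition is an equidistant grid with \<open>z\<close> in the middle of a cell, clipped to \<open>[0, r]\<close>.
\<close>

lemma spectrum_J_supset:
  assumes w: "w \<in> spectrum (Rep_bop A)"
  shows "complex_of_real (cmod w) \<in> spectrum (Rep_bop J)"
proof (rule ccontr)
  define z where "z = cmod w"
  assume "complex_of_real (cmod w) \<notin> spectrum (Rep_bop J)"
  then obtain S where S: "S * (J - scalar_op (of_real z)) = 1"
    using notin_spectrum_iff by (auto simp: z_def)
  have z: "0 \<le> z" "z \<le> r" using spectrum_le_r[OF w] by (auto simp: z_def)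
  \<comment> \<open>The left inverse \<open>S\<close> bounds \<open>J - z\<close> below by
    \<open>c\<close>; the summand 1 avoids division by 0.\<close>
  define c where "c = 1 / (norm S + 1)"
  have S1: "norm S + 1 > 0" using norm_ge_zero[of S] by linarith
  have c: "c > 0" using S1 by (simp add: c_def)
  have low: "c * norm x \<le> norm (J \<cdot> x - z *\<^sub>R x)" for x
  proof -
    have "norm x = norm (S \<cdot> (J \<cdot> x - z *\<^sub>R x))"
      using arg_cong[OF S, of "\<lambda>X. X \<cdot> x"] by (simp add: ap_sub scaleR_scaleC)
    also have "\<dots> \<le> norm S * norm (J \<cdot> x - z *\<^sub>R x)" by (rule norm_ap)
    also have "\<dots> \<le> (norm S + 1) * norm (J \<cdot> x - z *\<^sub>R x)" by (intro mult_right_mono) auto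
    finally show ?thesis using S1 by (simp add: c_def field_simps)
  qed
  \<comment> \<open>On the cell around \<open>z\<close> the operator \<open>J\<close> would differ
    from \<open>z\<close> by at most \<open>2 * h\<close> for the Riemann sum plus \<open>h\<close>
    for the node, and \<open>3 * h < c\<close>.\<close>
  define h where "h = c / 4"
  have h: "h > 0" using c by (simp add: h_def)
  \<comment> \<open>\<open>N\<close> cells on either side carry the grid beyond
    \<open>[0, r]\<close>, so clipping produces the end points 0 and \<open>r\<close>.\<close>
  obtain N where N: "(r + h) / h < real N" using reals_Archimedean2 by blast
  hence N': "r + h < N * h" using h by (simp add: field_simps)
  define s where "s i = max 0 (min r (z + (real i - real N) * h - h / 2))" for i
  define k where "k = 2 * N"
  have s: "partition s k"
    unfolding partition_def
  proof (intro conjI allI impI)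
    show "s 0 = 0" using z N' h r_nonneg by (simp add: s_def)
    show "s k = r" using z N' h r_nonneg by (simp add: s_def k_def algebra_simps)
    fix i
    have "(real i - real N) * h \<le> (real (Suc i) - real N) * h" using h by (intro mult_right_mono) auto
    thus "s i \<le> s (Suc i)" unfolding s_def by linarith
  qed
  have mesh: "s (Suc i) - s i \<le> h" for i
  proof -
    have "(real (Suc i) - real N) * h = (real i - real N) * h + h" by (simp add: algebra_simps)
    thus ?thesis unfolding s_def using h by linarith
  qed
  have Nk: "N < k" using N r_nonneg h by (cases N) (auto simp: k_def field_simps)
  have near: "norm (J - Rsum s s k) \<le> 2 * h"
  proof (rule Rsum_near_J[OF s])
    fix i assume "i < k"
    thus "s i \<le> s i \<and> s i \<le> s (Suc i) \<and> s (Suc i) - s i < 2 * h"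
      using mesh[of i] h s by (auto simp: partition_def intro: le_less_trans)
  qed (use h in simp)
  have zero: "P = 0" if P: "Rsum s s k * P = t *\<^sub>R P" and t: "\<bar>t - z\<bar> \<le> h" for P :: "'a bop" and t
  proof (rule bop_eqI)
    fix y
    define x where "x = P \<cdot> y"
    have "Rsum s s k \<cdot> x = t *\<^sub>R x"
      using arg_cong[OF P, of "\<lambda>X. X \<cdot> y"] by (simp add: x_def ap_scaleR_left)
    hence "J \<cdot> x - z *\<^sub>R x = (J - Rsum s s k) \<cdot> x + (t - z) *\<^sub>R x"
      by (simp add: ap_sub scaleR_diff_left)
    hence "norm (J \<cdot> x - z *\<^sub>R x) \<le> norm ((J - Rsum s s k) \<cdot> x) + \<bar>t - z\<bar> * norm x"
      by (metis norm_triangle_ineq norm_scaleR)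
    also have "\<dots> \<le> 2 * h * norm x + h * norm x"
      using norm_ap[of "J - Rsum s s k" x] mult_right_mono[OF near norm_ge_zero[of x]]
        mult_right_mono[OF t norm_ge_zero[of x]] by linarith
    finally have "c * norm x \<le> 3 / 4 * c * norm x" using low[of x] by (simp add: h_def)
    hence "x = 0" using c by auto
    thus "P \<cdot> y = 0 \<cdot> y" by (simp add: x_def)
  qed
  have sN: "s N = max 0 (z - h / 2)" "s (Suc N) = min r (z + h / 2)"
    using z h by (auto simp: s_def algebra_simps)
  have "dF s N = 0"
  proof (rule zero)
    show "Rsum s s k * dF s N = s N *\<^sub>R dF s N" by (rule Rsum_dF[OF s Nk])
    show "\<bar>s N - z\<bar> \<le> h" using z h unfolding sN by (auto simp: max_def)
  qed
  hence 1: "F (z + h / 2) = F (s N)"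
    unfolding dF_def sN using F_ge_r[of r] F_ge_r[of "z + h / 2"] by (auto simp: min_def split: if_splits)
  have "F (s N) = F (z - h / 2)"
  \<comment> \<open>When the cell is cut off at 0, the jump of \<open>F\<close> at 0 must vanish
    too; the Riemann sum has eigenvalue 0 there, which is within \<open>h\<close> of
    \<open>z\<close>.\<close>
  proof (cases "z - h / 2 \<ge> 0")
    case False
    have "F 0 = 0" by (rule zero[of _ 0]) (use Rsum_F0[OF s] False h z in auto)
    thus ?thesis using False by (simp add: sN F_neg)
  qed (simp add: sN)
  with 1 have "F (z + h / 2) = F (z - h / 2)" by simp
  hence "D (z + h / 2) = D (z - h / 2)" using F_eq_iff[of "z - h / 2" "z + h / 2"] h by simp
  thus False using D_neq_of_spectrum[OF w, of "z - h / 2" "z + h / 2"] h by (simp add: z_def)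
qed

lemma spectrum_J: "spectrum (Rep_bop J) = (\<lambda>z. complex_of_real (cmod z)) ` spectrum (Rep_bop A)"
  using spectrum_J_subset spectrum_J_supset by blast

end

theorem theorem4p4:
  fixes A :: "'a::complex_hilbert_space \<Rightarrow>\<^sub>L 'a"
    and e :: "complex set \<Rightarrow> ('a \<Rightarrow>\<^sub>L 'a)"
    and F :: "real \<Rightarrow> ('a \<Rightarrow>\<^sub>L 'a)"
  assumes A: "spectral_operator A"
    and e: "idempotent_spectral_resolution A e"
    and F: "\<And>l. F l = range_projection (e (cball 0 l))"
  shows "(bounded_resolution_of_identity F \<and>
          (\<exists>J. has_stieltjes_integral (\<lambda>l. l) F 0 (spectral_radius A) J \<and>
               (\<lambda>n. op_root n (op_abs (op_power A n))) \<longlonglongrightarrow> J \<and>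
               positive_op J \<and>
               spectrum J = (\<lambda>z. complex_of_real (cmod z)) ` spectrum A)) \<and>
         (\<forall>x. \<exists>l\<ge>0.
            x \<in> range (e (cball 0 l)) \<and>
            (\<forall>m\<ge>0. x \<in> range (e (cball 0 m)) \<longrightarrow> l \<le> m) \<and>
            (\<lambda>n. root n (norm (op_power A n x))) \<longlonglongrightarrow> l)"
proof -
  have "A \<in> bounded_ops" using A by (simp add: spectral_operator_def)
  then obtain A' where A': "A = Rep_bop A'" by (metis Abs_bop_inverse)
  \<comment> \<open>Outside the Borel sets \<open>e\<close> need not be complex-linear and
    \<open>Abs_bop\<close> is uninformative, so every transfer below carries a Borel
    condition.\<close>
  define E where "E \<Omega> = Abs_bop (e \<Omega>)" for \<Omega>
  have eB: "e \<Omega> \<in> bounded_ops" if "\<Omega> \<in> sets borel" for \<Omega>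
    using e that unfolding idempotent_spectral_resolution_def by blast
  have RE: "Rep_bop (E \<Omega>) = e \<Omega>" if "\<Omega> \<in> sets borel" for \<Omega>
    using eB[OF that] by (simp add: E_def Abs_bop_inverse)
  obtain M where M: "\<And>\<Omega>. \<Omega> \<in> sets borel \<Longrightarrow> norm (e \<Omega>) \<le> M"
    using e unfolding idempotent_spectral_resolution_def by blast
  have apE: "ap (E \<Omega>) = blinfun_apply (e \<Omega>)" if "\<Omega> \<in> sets borel" for \<Omega>
    using RE[OF that] Rep_bop_apply by metis
  interpret spectral_resolution A' E M
  proof
    fix \<Omega> :: "complex set" assume \<Omega>: "\<Omega> \<in> sets borel"
    show "E \<Omega> * E \<Omega> = E \<Omega>" "A' * E \<Omega> = E \<Omega> * A'"
      using e \<Omega> unfolding idempotent_spectral_resolution_def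
      by (simp_all add: Rep_bop_inject[symmetric] times_bop.rep_eq RE A')
    show "spectrum_on (range (ap (E \<Omega>))) (Rep_bop A') \<subseteq> closure \<Omega>"
      using e \<Omega> unfolding idempotent_spectral_resolution_def apE[OF \<Omega>] A' by blast
    show "E (- \<Omega>) = 1 - E \<Omega>"
      using e \<Omega> unfolding idempotent_spectral_resolution_def
      by (simp add: Rep_bop_inject[symmetric] minus_bop.rep_eq one_bop.rep_eq RE)
    show "norm (E \<Omega>) \<le> M" using M[OF \<Omega>] by (simp add: norm_bop.rep_eq RE \<Omega>)
    fix \<Omega>' :: "complex set" assume \<Omega>': "\<Omega>' \<in> sets borel"
    show "E (\<Omega> \<inter> \<Omega>') = E \<Omega> * E \<Omega>'"
      using e \<Omega> \<Omega>' unfolding idempotent_spectral_resolution_def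
      by (simp add: Rep_bop_inject[symmetric] times_bop.rep_eq RE sets.Int)
  next
    show "E {} = 0" "E UNIV = 1"
      using e unfolding idempotent_spectral_resolution_def
      by (simp_all add: Rep_bop_inject[symmetric] zero_bop.rep_eq one_bop.rep_eq RE)
    fix W :: "nat \<Rightarrow> complex set" and x
    assume W: "range W \<subseteq> sets borel" "disjoint_family W"
    hence "(\<lambda>n. e (W n) x) sums e (\<Union>n. W n) x"
      using e unfolding idempotent_spectral_resolution_def by blast
    moreover have "W n \<in> sets borel" for n using W by blast
    moreover have "(\<Union>n. W n) \<in> sets borel" using W by (intro sets.countable_UN)
    ultimately show "(\<lambda>n. E (W n) \<cdot> x) sums (E (\<Union>n. W n) \<cdot> x)" by (simp add: apE)
  qed
  have FF: "F l = Rep_bop (local.F l)" for l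
    unfolding assms(3) F_def by (subst range_projection_Rep_bop[symmetric, OF D_idem]) (simp add: D_def RE)
  have "\<exists>S. n \<ge> 1 \<longrightarrow> pos S \<and> op_root n (op_abs (op_power A n)) = Rep_bop S \<and> S ^ (2 * n) = adj (A' ^ n) * A' ^ n" for n
    unfolding A' op_power_Rep_bop using op_root_op_abs_obtain[of n "A' ^ n"] by metis
  then obtain T where T: "\<And>n. n \<ge> 1 \<Longrightarrow> pos (T n)"
    "\<And>n. n \<ge> 1 \<Longrightarrow> op_root n (op_abs (op_power A n)) = Rep_bop (T n)"
    "\<And>n. n \<ge> 1 \<Longrightarrow> T n ^ (2 * n) = adj (A' ^ n) * A' ^ n" by metis
  interpret normalised_powers A' E M T
    by unfold_locales (use T in auto)
  \<comment> \<open>The identification with \<open>T n\<close> starts at \<open>n = 1\<close>;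
    eventual agreement suffices for the limit.\<close>
  have "(\<lambda>n. op_root n (op_abs (op_power A n))) \<longlonglongrightarrow> Rep_bop J"
  proof (rule Lim_transform_eventually)
    show "(\<lambda>n. Rep_bop (T n)) \<longlonglongrightarrow> Rep_bop J" using T_tendsto_J by (simp add: tendsto_Rep_bop_iff)
    show "\<forall>\<^sub>F n in sequentially. Rep_bop (T n) = op_root n (op_abs (op_power A n))"
      using T(2) by (auto simp: eventually_sequentially intro!: exI[of _ 1])
  qed
  moreover have "bounded_resolution_of_identity F"
    using bounded_resolution_F by (simp add: FF[abs_def])
  moreover have "has_stieltjes_integral (\<lambda>l. l) F 0 (spectral_radius A) (Rep_bop J)"
    using stieltjes_J by (simp add: FF[abs_def] r_def A')
  moreover have "positive_op (Rep_bop J)" using pos_J by (simp add: positive_op_Rep_bop)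
  moreover have "spectrum (Rep_bop J) = (\<lambda>z. complex_of_real (cmod z)) ` spectrum A"
    using spectrum_J by (simp add: A')
  moreover have "\<exists>l\<ge>0. x \<in> range (e (cball 0 l)) \<and> (\<forall>m\<ge>0. x \<in> range (e (cball 0 m)) \<longrightarrow> l \<le> m) \<and>
      (\<lambda>n. root n (norm (op_power A n x))) \<longlonglongrightarrow> l" for x
  proof -
    have "x \<in> range (e (cball 0 l)) \<longleftrightarrow> D l \<cdot> x = x" for l
    proof -
      have "D l \<cdot> (D l \<cdot> y) = D l \<cdot> y" for y using arg_cong[OF D_idem[of l], of "\<lambda>X. X \<cdot> y"] by simp
      moreover have "blinfun_apply (e (cball 0 l)) = ap (D l)" by (simp add: apE D_def)
      ultimately show ?thesis by (metis imageE rangeI)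
    qed
    thus ?thesis
      using local_spectral_radius[of x] by (simp add: A' op_power_Rep_bop Rep_bop_apply)
  qed
  ultimately show ?thesis by blast
qed

end
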